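(* In Bishop's constructive mathematics, the statement "every element of every finite-dimensional q-normed space is normable" implies the omniscience principle LPO: for each binary sequence $(a_n)_{n\ge1}$, either $a_n=0$ for all $n$ or else there exists $N$ such that $a_N=1$.
   Context: Setting: Bishop-style constructive mathematics (BISH: intuitionistic logic with dependent choice); the implication is to be derived there, without the law of excluded middle. All linear spaces are real. A q-normed space is a pair $(X,(\|\cdot\|_i)_{i\in I})$ where $X$ is a real linear space and $(\|\cdot\|_i)_{i\in I}$ (the q-norm) is a family of seminorms on $X$ such that for each $x\in X$ the set $\{\|x\|_i:i\in I\}$ is bounded in $\mathbf{R}$. Equality and inequality: $x=y$ iff $\|x-y\|_i=0$ for all $i\in I$; $x\neq y$ iff $\|x-y\|_i>0$ for some $i\in I$. An element $x$ of $X$ is normable if $\sup\{\|x\|_i:i\in I\}$ exists, i.e. there is a real number $s$ with $\|x\|_i\le s$ for all $i$ and, for each $\varepsilon>0$, some $i$ with $\|x\|_i>s-\varepsilon$. $X$ is finite-dimensional if for some $n$ it has a basis $\{b_1,\dots,b_n\}$: every element of $X$ is of the form $\sum_{k=1}^n\lambda_kb_k$ with $\lambda_k\in\mathbf{R}$, and $\sum_{k=1}^n\lambda_kb_k\neq0$ whenever $\sum_{k=1}^n|\lambda_k|>0$. A binary sequence is a sequence with values in $\{0,1\}$. *)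

theory Defs
  imports Main
begin

text \<open>
  The theorem says that an implication is derivable in Bishop-style constructive mathematics. In the
  classical logic of HOL this implication is trivial, since LPO is true, so the constructive theory
  is represented as an object: its syntax, its intuitionistic natural deduction calculus, and its
  axioms. The theory is of the kind introduced by Feferman to formalize Bishop's mathematics
  (explicit mathematics): individuals can be applied to one another as operations, and there are
  classes of individuals. A set in Bishop's sense is a class together with an equivalence relation
  on it, a function between sets is an operation respecting the equalities. Application is total;
  an operation on a class may take arbitrary values outside that class.
\<close>

section \<open>Syntax\<close>

type_synonym name = string

text \<open>
  Combinators, pairing with projections, zero, successor and primitive recursion on natural numbers,
  and zero, one, sum, negation, product and maximum of real numbers.
\<close>

datatype const =
    cK | cS | cPair | cFst | cSnd
  | cZero | cSuc | cRec
  | cRZero | cROne | cRAdd | cRNeg | cRMul | cRMax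

datatype tm = V name | C const | App tm tm (infixl "\<cdot>" 100)

text \<open>\<open>Less\<close> is the class of pairs of real numbers the first of which is smaller.\<close>

datatype cls = CV name | Nat | Real | Less

datatype fm =
    Eq tm tm (infix "\<^bold>=" 55)
  | Mem tm cls (infix "\<^bold>\<in>" 55)
  | Falsum ("\<^bold>\<bottom>")
  | Conj fm fm (infixr "\<^bold>\<and>" 45)
  | Disj fm fm (infixr "\<^bold>\<or>" 40)
  | Imp fm fm (infixr "\<^bold>\<longrightarrow>" 35)
  | All name fm ("(3\<^bold>\<forall>_./ _)" [1000, 10] 10)
  | Ex name fm ("(3\<^bold>\<exists>_./ _)" [1000, 10] 10)
  | AllC name fm ("(3\<^bold>\<forall>\<^sub>C_./ _)" [1000, 10] 10)
  | ExC name fm ("(3\<^bold>\<exists>\<^sub>C_./ _)" [1000, 10] 10)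

abbreviation Neg :: "fm \<Rightarrow> fm" ("\<^bold>\<not> _" [50] 50) where
  "\<^bold>\<not> \<phi> \<equiv> \<phi> \<^bold>\<longrightarrow> \<^bold>\<bottom>"

abbreviation Iff :: "fm \<Rightarrow> fm \<Rightarrow> fm" (infix "\<^bold>\<longleftrightarrow>" 36) where
  "\<phi> \<^bold>\<longleftrightarrow> \<psi> \<equiv> (\<phi> \<^bold>\<longrightarrow> \<psi>) \<^bold>\<and> (\<psi> \<^bold>\<longrightarrow> \<phi>)"

abbreviation AllIn :: "name \<Rightarrow> cls \<Rightarrow> fm \<Rightarrow> fm" ("(3\<^bold>\<forall>_\<^bold>\<in>_./ _)" [1000, 1000, 10] 10) where
  "\<^bold>\<forall>x\<^bold>\<in>A. \<phi> \<equiv> All x (V x \<^bold>\<in> A \<^bold>\<longrightarrow> \<phi>)"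

abbreviation ExIn :: "name \<Rightarrow> cls \<Rightarrow> fm \<Rightarrow> fm" ("(3\<^bold>\<exists>_\<^bold>\<in>_./ _)" [1000, 1000, 10] 10) where
  "\<^bold>\<exists>x\<^bold>\<in>A. \<phi> \<equiv> Ex x (V x \<^bold>\<in> A \<^bold>\<and> \<phi>)"

abbreviation pr :: "tm \<Rightarrow> tm \<Rightarrow> tm" where
  "pr s t \<equiv> C cPair \<cdot> s \<cdot> t"

abbreviation zero :: tm where
  "zero \<equiv> C cZero"

abbreviation suc :: "tm \<Rightarrow> tm" where
  "suc t \<equiv> C cSuc \<cdot> t"

fun fv_tm :: "tm \<Rightarrow> name set" where
  "fv_tm (V x) = {x}"
| "fv_tm (C c) = {}"
| "fv_tm (s \<cdot> t) = fv_tm s \<union> fv_tm t"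

fun fv :: "fm \<Rightarrow> name set" where
  "fv (s \<^bold>= t) = fv_tm s \<union> fv_tm t"
| "fv (t \<^bold>\<in> A) = fv_tm t"
| "fv \<^bold>\<bottom> = {}"
| "fv (\<phi> \<^bold>\<and> \<psi>) = fv \<phi> \<union> fv \<psi>"
| "fv (\<phi> \<^bold>\<or> \<psi>) = fv \<phi> \<union> fv \<psi>"
| "fv (\<phi> \<^bold>\<longrightarrow> \<psi>) = fv \<phi> \<union> fv \<psi>"
| "fv (All x \<phi>) = fv \<phi> - {x}"
| "fv (Ex x \<phi>) = fv \<phi> - {x}"
| "fv (AllC X \<phi>) = fv \<phi>"
| "fv (ExC X \<phi>) = fv \<phi>"

fun fv_cls :: "cls \<Rightarrow> name set" where
  "fv_cls (CV X) = {X}"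
| "fv_cls Nat = {}"
| "fv_cls Real = {}"
| "fv_cls Less = {}"

fun fvC :: "fm \<Rightarrow> name set" where
  "fvC (s \<^bold>= t) = {}"
| "fvC (t \<^bold>\<in> A) = fv_cls A"
| "fvC \<^bold>\<bottom> = {}"
| "fvC (\<phi> \<^bold>\<and> \<psi>) = fvC \<phi> \<union> fvC \<psi>"
| "fvC (\<phi> \<^bold>\<or> \<psi>) = fvC \<phi> \<union> fvC \<psi>"
| "fvC (\<phi> \<^bold>\<longrightarrow> \<psi>) = fvC \<phi> \<union> fvC \<psi>"
| "fvC (All x \<phi>) = fvC \<phi>"
| "fvC (Ex x \<phi>) = fvC \<phi>"
| "fvC (AllC X \<phi>) = fvC \<phi> - {X}"
| "fvC (ExC X \<phi>) = fvC \<phi> - {X}"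

text \<open>
  Substitution does not rename bound variables; the rules that use it require the substituted term
  to be free for the variable.
\<close>

fun subst_tm :: "name \<Rightarrow> tm \<Rightarrow> tm \<Rightarrow> tm" where
  "subst_tm x u (V y) = (if y = x then u else V y)"
| "subst_tm x u (C c) = C c"
| "subst_tm x u (s \<cdot> t) = subst_tm x u s \<cdot> subst_tm x u t"

fun subst :: "name \<Rightarrow> tm \<Rightarrow> fm \<Rightarrow> fm" where
  "subst x u (s \<^bold>= t) = (subst_tm x u s \<^bold>= subst_tm x u t)"
| "subst x u (t \<^bold>\<in> A) = (subst_tm x u t \<^bold>\<in> A)"
| "subst x u \<^bold>\<bottom> = \<^bold>\<bottom>"
| "subst x u (\<phi> \<^bold>\<and> \<psi>) = (subst x u \<phi> \<^bold>\<and> subst x u \<psi>)"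
| "subst x u (\<phi> \<^bold>\<or> \<psi>) = (subst x u \<phi> \<^bold>\<or> subst x u \<psi>)"
| "subst x u (\<phi> \<^bold>\<longrightarrow> \<psi>) = (subst x u \<phi> \<^bold>\<longrightarrow> subst x u \<psi>)"
| "subst x u (All y \<phi>) = All y (if y = x then \<phi> else subst x u \<phi>)"
| "subst x u (Ex y \<phi>) = Ex y (if y = x then \<phi> else subst x u \<phi>)"
| "subst x u (AllC X \<phi>) = AllC X (subst x u \<phi>)"
| "subst x u (ExC X \<phi>) = ExC X (subst x u \<phi>)"

fun free_for :: "tm \<Rightarrow> name \<Rightarrow> fm \<Rightarrow> bool" where
  "free_for u x (s \<^bold>= t) = True"
| "free_for u x (t \<^bold>\<in> A) = True"
| "free_for u x \<^bold>\<bottom> = True"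
| "free_for u x (\<phi> \<^bold>\<and> \<psi>) = (free_for u x \<phi> \<and> free_for u x \<psi>)"
| "free_for u x (\<phi> \<^bold>\<or> \<psi>) = (free_for u x \<phi> \<and> free_for u x \<psi>)"
| "free_for u x (\<phi> \<^bold>\<longrightarrow> \<psi>) = (free_for u x \<phi> \<and> free_for u x \<psi>)"
| "free_for u x (All y \<phi>) = (x \<notin> fv (All y \<phi>) \<or> y \<notin> fv_tm u \<and> free_for u x \<phi>)"
| "free_for u x (Ex y \<phi>) = (x \<notin> fv (Ex y \<phi>) \<or> y \<notin> fv_tm u \<and> free_for u x \<phi>)"
| "free_for u x (AllC X \<phi>) = free_for u x \<phi>"
| "free_for u x (ExC X \<phi>) = free_for u x \<phi>"

fun subst_cls :: "name \<Rightarrow> cls \<Rightarrow> cls \<Rightarrow> cls" where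
  "subst_cls X A (CV Y) = (if Y = X then A else CV Y)"
| "subst_cls X A Nat = Nat"
| "subst_cls X A Real = Real"
| "subst_cls X A Less = Less"

fun substC :: "name \<Rightarrow> cls \<Rightarrow> fm \<Rightarrow> fm" where
  "substC X A (s \<^bold>= t) = (s \<^bold>= t)"
| "substC X A (t \<^bold>\<in> B) = (t \<^bold>\<in> subst_cls X A B)"
| "substC X A \<^bold>\<bottom> = \<^bold>\<bottom>"
| "substC X A (\<phi> \<^bold>\<and> \<psi>) = (substC X A \<phi> \<^bold>\<and> substC X A \<psi>)"
| "substC X A (\<phi> \<^bold>\<or> \<psi>) = (substC X A \<phi> \<^bold>\<or> substC X A \<psi>)"
| "substC X A (\<phi> \<^bold>\<longrightarrow> \<psi>) = (substC X A \<phi> \<^bold>\<longrightarrow> substC X A \<psi>)"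
| "substC X A (All y \<phi>) = All y (substC X A \<phi>)"
| "substC X A (Ex y \<phi>) = Ex y (substC X A \<phi>)"
| "substC X A (AllC Y \<phi>) = AllC Y (if Y = X then \<phi> else substC X A \<phi>)"
| "substC X A (ExC Y \<phi>) = ExC Y (if Y = X then \<phi> else substC X A \<phi>)"

fun free_forC :: "cls \<Rightarrow> name \<Rightarrow> fm \<Rightarrow> bool" where
  "free_forC A X (s \<^bold>= t) = True"
| "free_forC A X (t \<^bold>\<in> B) = True"
| "free_forC A X \<^bold>\<bottom> = True"
| "free_forC A X (\<phi> \<^bold>\<and> \<psi>) = (free_forC A X \<phi> \<and> free_forC A X \<psi>)"
| "free_forC A X (\<phi> \<^bold>\<or> \<psi>) = (free_forC A X \<phi> \<and> free_forC A X \<psi>)"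
| "free_forC A X (\<phi> \<^bold>\<longrightarrow> \<psi>) = (free_forC A X \<phi> \<and> free_forC A X \<psi>)"
| "free_forC A X (All y \<phi>) = free_forC A X \<phi>"
| "free_forC A X (Ex y \<phi>) = free_forC A X \<phi>"
| "free_forC A X (AllC Y \<phi>) =
     (X \<notin> fvC (AllC Y \<phi>) \<or> Y \<notin> fv_cls A \<and> free_forC A X \<phi>)"
| "free_forC A X (ExC Y \<phi>) =
     (X \<notin> fvC (ExC Y \<phi>) \<or> Y \<notin> fv_cls A \<and> free_forC A X \<phi>)"

text \<open>Formulas without class quantifiers.\<close>

fun elementary :: "fm \<Rightarrow> bool" where
  "elementary (s \<^bold>= t) = True"
| "elementary (t \<^bold>\<in> A) = True"
| "elementary \<^bold>\<bottom> = True"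
| "elementary (\<phi> \<^bold>\<and> \<psi>) = (elementary \<phi> \<and> elementary \<psi>)"
| "elementary (\<phi> \<^bold>\<or> \<psi>) = (elementary \<phi> \<and> elementary \<psi>)"
| "elementary (\<phi> \<^bold>\<longrightarrow> \<psi>) = (elementary \<phi> \<and> elementary \<psi>)"
| "elementary (All x \<phi>) = elementary \<phi>"
| "elementary (Ex x \<phi>) = elementary \<phi>"
| "elementary (AllC X \<phi>) = False"
| "elementary (ExC X \<phi>) = False"

text \<open>Bracket abstraction: \<open>lam x t\<close> is a term denoting the operation that maps \<open>x\<close> to \<open>t\<close>.\<close>

fun lam :: "name \<Rightarrow> tm \<Rightarrow> tm" where
  "lam x (V y) = (if y = x then C cS \<cdot> C cK \<cdot> C cK else C cK \<cdot> V y)"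
| "lam x (C c) = C cK \<cdot> C c"
| "lam x (s \<cdot> t) = C cS \<cdot> lam x s \<cdot> lam x t"

section \<open>Real numbers\<close>

abbreviation rzero :: tm ("\<zero>") where
  "\<zero> \<equiv> C cRZero"

abbreviation rone :: tm ("\<one>") where
  "\<one> \<equiv> C cROne"

abbreviation radd :: "tm \<Rightarrow> tm \<Rightarrow> tm" (infixl "\<oplus>" 65) where
  "s \<oplus> t \<equiv> C cRAdd \<cdot> s \<cdot> t"

abbreviation rneg :: "tm \<Rightarrow> tm" ("\<ominus> _" [81] 80) where
  "\<ominus> t \<equiv> C cRNeg \<cdot> t"

abbreviation rmul :: "tm \<Rightarrow> tm \<Rightarrow> tm" (infixl "\<otimes>" 70) where
  "s \<otimes> t \<equiv> C cRMul \<cdot> s \<cdot> t"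

abbreviation rmax :: "tm \<Rightarrow> tm \<Rightarrow> tm" where
  "rmax s t \<equiv> C cRMax \<cdot> s \<cdot> t"

abbreviation rabs :: "tm \<Rightarrow> tm" where
  "rabs t \<equiv> rmax t (\<ominus> t)"

abbreviation rless :: "tm \<Rightarrow> tm \<Rightarrow> fm" (infix "\<^bold><" 55) where
  "s \<^bold>< t \<equiv> pr s t \<^bold>\<in> Less"

abbreviation rle :: "tm \<Rightarrow> tm \<Rightarrow> fm" (infix "\<^bold>\<le>" 55) where
  "s \<^bold>\<le> t \<equiv> \<^bold>\<not> (t \<^bold>< s)"

text \<open>
  Equality of real numbers, as opposed to identity \<open>\<^bold>=\<close> of the individuals representing them.
\<close>

abbreviation req :: "tm \<Rightarrow> tm \<Rightarrow> fm" (infix "\<^bold>\<simeq>" 55) where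
  "s \<^bold>\<simeq> t \<equiv> s \<^bold>\<le> t \<^bold>\<and> t \<^bold>\<le> s"

text \<open>
  \<open>rsum f n\<close> is \<open>f 0 + \<dots> + f (n - 1)\<close>; the names \<open>k\<close> and \<open>t\<close> must not be free in the summand.
\<close>

definition rsum :: "(tm \<Rightarrow> tm) \<Rightarrow> tm \<Rightarrow> tm" where
  "rsum f n = C cRec \<cdot> \<zero> \<cdot> lam ''k'' (lam ''t'' (V ''t'' \<oplus> f (V ''k''))) \<cdot> n"

section \<open>The constructive theory\<close>

text \<open>
  Bridges' axioms for the constructive real line (Heyting field, properties of the order,
  Archimedean property, constructive least-upper-bound principle). Equality is defined from the
  order, so its compatibility with the operations is stated. The operation \<open>max\<close> is added, with the
  property that determines it up to equality: it is needed for the absolute value.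
\<close>

inductive real_axiom :: "fm \<Rightarrow> bool" where
  "real_axiom (\<zero> \<^bold>\<in> Real)"
| "real_axiom (\<one> \<^bold>\<in> Real)"
| "real_axiom (\<^bold>\<forall>''x''\<^bold>\<in>Real. \<ominus> V ''x'' \<^bold>\<in> Real)"
| "real_axiom (\<^bold>\<forall>''x''\<^bold>\<in>Real. \<^bold>\<forall>''y''\<^bold>\<in>Real. V ''x'' \<oplus> V ''y'' \<^bold>\<in> Real)"
| "real_axiom (\<^bold>\<forall>''x''\<^bold>\<in>Real. \<^bold>\<forall>''y''\<^bold>\<in>Real. V ''x'' \<otimes> V ''y'' \<^bold>\<in> Real)"
| "real_axiom (\<^bold>\<forall>''x''\<^bold>\<in>Real. \<^bold>\<forall>''y''\<^bold>\<in>Real. rmax (V ''x'') (V ''y'') \<^bold>\<in> Real)"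
| "real_axiom (\<^bold>\<forall>''x''\<^bold>\<in>Real. \<^bold>\<forall>''y''\<^bold>\<in>Real.
     V ''x'' \<^bold>\<simeq> V ''y'' \<^bold>\<longrightarrow> \<ominus> V ''x'' \<^bold>\<simeq> \<ominus> V ''y'')"
| "real_axiom (\<^bold>\<forall>''x''\<^bold>\<in>Real. \<^bold>\<forall>''y''\<^bold>\<in>Real. \<^bold>\<forall>''z''\<^bold>\<in>Real.
     V ''x'' \<^bold>\<simeq> V ''y'' \<^bold>\<longrightarrow> V ''x'' \<oplus> V ''z'' \<^bold>\<simeq> V ''y'' \<oplus> V ''z'')"
| "real_axiom (\<^bold>\<forall>''x''\<^bold>\<in>Real. \<^bold>\<forall>''y''\<^bold>\<in>Real. \<^bold>\<forall>''z''\<^bold>\<in>Real.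
     V ''x'' \<^bold>\<simeq> V ''y'' \<^bold>\<longrightarrow> V ''x'' \<otimes> V ''z'' \<^bold>\<simeq> V ''y'' \<otimes> V ''z'')"
| "real_axiom (\<^bold>\<forall>''x''\<^bold>\<in>Real. \<^bold>\<forall>''y''\<^bold>\<in>Real. V ''x'' \<oplus> V ''y'' \<^bold>\<simeq> V ''y'' \<oplus> V ''x'')"
| "real_axiom (\<^bold>\<forall>''x''\<^bold>\<in>Real. \<^bold>\<forall>''y''\<^bold>\<in>Real. \<^bold>\<forall>''z''\<^bold>\<in>Real.
     (V ''x'' \<oplus> V ''y'') \<oplus> V ''z'' \<^bold>\<simeq> V ''x'' \<oplus> (V ''y'' \<oplus> V ''z''))"
| "real_axiom (\<^bold>\<forall>''x''\<^bold>\<in>Real. V ''x'' \<oplus> \<zero> \<^bold>\<simeq> V ''x'')"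
| "real_axiom (\<^bold>\<forall>''x''\<^bold>\<in>Real. V ''x'' \<oplus> \<ominus> V ''x'' \<^bold>\<simeq> \<zero>)"
| "real_axiom (\<^bold>\<forall>''x''\<^bold>\<in>Real. \<^bold>\<forall>''y''\<^bold>\<in>Real. V ''x'' \<otimes> V ''y'' \<^bold>\<simeq> V ''y'' \<otimes> V ''x'')"
| "real_axiom (\<^bold>\<forall>''x''\<^bold>\<in>Real. \<^bold>\<forall>''y''\<^bold>\<in>Real. \<^bold>\<forall>''z''\<^bold>\<in>Real.
     (V ''x'' \<otimes> V ''y'') \<otimes> V ''z'' \<^bold>\<simeq> V ''x'' \<otimes> (V ''y'' \<otimes> V ''z''))"
| "real_axiom (\<^bold>\<forall>''x''\<^bold>\<in>Real. V ''x'' \<otimes> \<one> \<^bold>\<simeq> V ''x'')"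
| "real_axiom (\<^bold>\<forall>''x''\<^bold>\<in>Real. \<^bold>\<forall>''y''\<^bold>\<in>Real. \<^bold>\<forall>''z''\<^bold>\<in>Real.
     V ''x'' \<otimes> (V ''y'' \<oplus> V ''z'') \<^bold>\<simeq> V ''x'' \<otimes> V ''y'' \<oplus> V ''x'' \<otimes> V ''z'')"
| "real_axiom (\<^bold>\<forall>''x''\<^bold>\<in>Real. V ''x'' \<^bold>< \<zero> \<^bold>\<or> \<zero> \<^bold>< V ''x'' \<^bold>\<longrightarrow>
     (\<^bold>\<exists>''y''\<^bold>\<in>Real. V ''x'' \<otimes> V ''y'' \<^bold>\<simeq> \<one>))"
| "real_axiom (\<zero> \<^bold>< \<one>)"
| "real_axiom (\<^bold>\<forall>''x''\<^bold>\<in>Real. \<^bold>\<forall>''y''\<^bold>\<in>Real. \<^bold>\<not> (V ''x'' \<^bold>< V ''y'' \<^bold>\<and> V ''y'' \<^bold>< V ''x''))"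
| "real_axiom (\<^bold>\<forall>''x''\<^bold>\<in>Real. \<^bold>\<forall>''y''\<^bold>\<in>Real. \<^bold>\<forall>''z''\<^bold>\<in>Real.
     V ''x'' \<^bold>< V ''y'' \<^bold>\<longrightarrow> V ''x'' \<^bold>< V ''z'' \<^bold>\<or> V ''z'' \<^bold>< V ''y'')"
| "real_axiom (\<^bold>\<forall>''x''\<^bold>\<in>Real. \<^bold>\<forall>''y''\<^bold>\<in>Real. \<^bold>\<forall>''z''\<^bold>\<in>Real.
     V ''x'' \<^bold>< V ''y'' \<^bold>\<longrightarrow> V ''x'' \<oplus> V ''z'' \<^bold>< V ''y'' \<oplus> V ''z'')"
| "real_axiom (\<^bold>\<forall>''x''\<^bold>\<in>Real. \<^bold>\<forall>''y''\<^bold>\<in>Real.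
     \<zero> \<^bold>< V ''x'' \<^bold>\<and> \<zero> \<^bold>< V ''y'' \<^bold>\<longrightarrow> \<zero> \<^bold>< V ''x'' \<otimes> V ''y'')"
| "real_axiom (\<^bold>\<forall>''x''\<^bold>\<in>Real. \<^bold>\<forall>''y''\<^bold>\<in>Real.
     V ''x'' \<^bold>\<le> rmax (V ''x'') (V ''y'') \<^bold>\<and> V ''y'' \<^bold>\<le> rmax (V ''x'') (V ''y''))"
| "real_axiom (\<^bold>\<forall>''x''\<^bold>\<in>Real. \<^bold>\<forall>''y''\<^bold>\<in>Real. \<^bold>\<forall>''z''\<^bold>\<in>Real.
     V ''z'' \<^bold>< rmax (V ''x'') (V ''y'') \<^bold>\<longrightarrow> V ''z'' \<^bold>< V ''x'' \<^bold>\<or> V ''z'' \<^bold>< V ''y'')"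
| "real_axiom (\<^bold>\<forall>''x''\<^bold>\<in>Real. \<^bold>\<exists>''n''\<^bold>\<in>Nat. V ''x'' \<^bold>< rsum (\<lambda>_. \<one>) (V ''n''))"
| "real_axiom (\<^bold>\<forall>\<^sub>C''S''.
     (\<^bold>\<forall>''x''\<^bold>\<in>(CV ''S''). V ''x'' \<^bold>\<in> Real) \<^bold>\<and>
     (\<^bold>\<exists>''x''. V ''x'' \<^bold>\<in> CV ''S'') \<^bold>\<and>
     (\<^bold>\<exists>''y''\<^bold>\<in>Real. \<^bold>\<forall>''x''\<^bold>\<in>(CV ''S''). V ''x'' \<^bold>\<le> V ''y'') \<^bold>\<and>
     (\<^bold>\<forall>''y''\<^bold>\<in>Real. \<^bold>\<forall>''z''\<^bold>\<in>Real. V ''y'' \<^bold>< V ''z'' \<^bold>\<longrightarrow>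
        (\<^bold>\<exists>''x''\<^bold>\<in>(CV ''S''). V ''y'' \<^bold>< V ''x'') \<^bold>\<or> (\<^bold>\<forall>''x''\<^bold>\<in>(CV ''S''). V ''x'' \<^bold>\<le> V ''z''))
     \<^bold>\<longrightarrow>
     (\<^bold>\<exists>''s''\<^bold>\<in>Real. (\<^bold>\<forall>''x''\<^bold>\<in>(CV ''S''). V ''x'' \<^bold>\<le> V ''s'') \<^bold>\<and>
        (\<^bold>\<forall>''y''\<^bold>\<in>Real. V ''y'' \<^bold>< V ''s'' \<^bold>\<longrightarrow> (\<^bold>\<exists>''x''\<^bold>\<in>(CV ''S''). V ''y'' \<^bold>< V ''x''))))"

inductive bish_axiom :: "fm \<Rightarrow> bool" where
  comb_K: "bish_axiom (\<^bold>\<forall>''x''. \<^bold>\<forall>''y''. C cK \<cdot> V ''x'' \<cdot> V ''y'' \<^bold>= V ''x'')"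
| comb_S: "bish_axiom (\<^bold>\<forall>''x''. \<^bold>\<forall>''y''. \<^bold>\<forall>''z''.
     C cS \<cdot> V ''x'' \<cdot> V ''y'' \<cdot> V ''z'' \<^bold>= V ''x'' \<cdot> V ''z'' \<cdot> (V ''y'' \<cdot> V ''z''))"
| pair_fst: "bish_axiom (\<^bold>\<forall>''x''. \<^bold>\<forall>''y''. C cFst \<cdot> pr (V ''x'') (V ''y'') \<^bold>= V ''x'')"
| pair_snd: "bish_axiom (\<^bold>\<forall>''x''. \<^bold>\<forall>''y''. C cSnd \<cdot> pr (V ''x'') (V ''y'') \<^bold>= V ''y'')"
| nat_zero: "bish_axiom (zero \<^bold>\<in> Nat)"
| nat_suc: "bish_axiom (\<^bold>\<forall>''n''\<^bold>\<in>Nat. suc (V ''n'') \<^bold>\<in> Nat)"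
| suc_not_zero: "bish_axiom (\<^bold>\<forall>''n''\<^bold>\<in>Nat. \<^bold>\<not> (suc (V ''n'') \<^bold>= zero))"
| suc_inject: "bish_axiom (\<^bold>\<forall>''n''\<^bold>\<in>Nat. \<^bold>\<forall>''m''\<^bold>\<in>Nat.
     suc (V ''n'') \<^bold>= suc (V ''m'') \<^bold>\<longrightarrow> V ''n'' \<^bold>= V ''m'')"
| rec_zero: "bish_axiom (\<^bold>\<forall>''a''. \<^bold>\<forall>''f''. C cRec \<cdot> V ''a'' \<cdot> V ''f'' \<cdot> zero \<^bold>= V ''a'')"
| rec_suc: "bish_axiom (\<^bold>\<forall>''a''. \<^bold>\<forall>''f''. \<^bold>\<forall>''n''\<^bold>\<in>Nat.
     C cRec \<cdot> V ''a'' \<cdot> V ''f'' \<cdot> suc (V ''n'')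
       \<^bold>= V ''f'' \<cdot> V ''n'' \<cdot> (C cRec \<cdot> V ''a'' \<cdot> V ''f'' \<cdot> V ''n''))"
| induction: "free_for (suc (V x)) x \<phi> \<Longrightarrow>
     bish_axiom (subst x zero \<phi> \<^bold>\<and> (\<^bold>\<forall>x\<^bold>\<in>Nat. \<phi> \<^bold>\<longrightarrow> subst x (suc (V x)) \<phi>)
       \<^bold>\<longrightarrow> (\<^bold>\<forall>x\<^bold>\<in>Nat. \<phi>))"
| comprehension: "elementary \<phi> \<Longrightarrow> X \<notin> fvC \<phi> \<Longrightarrow>
     bish_axiom (\<^bold>\<exists>\<^sub>CX. \<^bold>\<forall>x. V x \<^bold>\<in> CV X \<^bold>\<longleftrightarrow> \<phi>)"
| dependent_choice: "distinct [x, y, f, n] \<Longrightarrow> f \<notin> fv \<phi> \<Longrightarrow> n \<notin> fv \<phi> \<Longrightarrow>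
     free_for (V f \<cdot> V n) x \<phi> \<Longrightarrow> free_for (V f \<cdot> suc (V n)) y (subst x (V f \<cdot> V n) \<phi>) \<Longrightarrow>
     bish_axiom ((\<^bold>\<forall>x\<^bold>\<in>A. \<^bold>\<exists>y\<^bold>\<in>A. \<phi>) \<^bold>\<longrightarrow>
       (\<^bold>\<forall>x\<^bold>\<in>A. \<^bold>\<exists>f. V f \<cdot> zero \<^bold>= V x \<^bold>\<and>
          (\<^bold>\<forall>n\<^bold>\<in>Nat. V f \<cdot> V n \<^bold>\<in> A \<^bold>\<and>
             subst y (V f \<cdot> suc (V n)) (subst x (V f \<cdot> V n) \<phi>))))"
| real: "real_axiom \<phi> \<Longrightarrow> bish_axiom \<phi>"

text \<open>
  Intuitionistic natural deduction with equality. There is no rule for excluded middle or double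
  negation.
\<close>

inductive derivable :: "fm set \<Rightarrow> fm \<Rightarrow> bool" (infix "\<turnstile>" 5) where
  ax: "bish_axiom \<phi> \<Longrightarrow> \<Gamma> \<turnstile> \<phi>"
| hyp: "\<phi> \<in> \<Gamma> \<Longrightarrow> \<Gamma> \<turnstile> \<phi>"
| weaken: "\<Gamma> \<turnstile> \<phi> \<Longrightarrow> \<Gamma> \<subseteq> \<Delta> \<Longrightarrow> \<Delta> \<turnstile> \<phi>"
| eq_refl: "\<Gamma> \<turnstile> t \<^bold>= t"
| eq_subst: "\<Gamma> \<turnstile> s \<^bold>= t \<Longrightarrow> \<Gamma> \<turnstile> subst x s \<phi> \<Longrightarrow> free_for s x \<phi> \<Longrightarrow> free_for t x \<phi> \<Longrightarrow>
     \<Gamma> \<turnstile> subst x t \<phi>"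
| falsum_E: "\<Gamma> \<turnstile> \<^bold>\<bottom> \<Longrightarrow> \<Gamma> \<turnstile> \<phi>"
| conj_I: "\<Gamma> \<turnstile> \<phi> \<Longrightarrow> \<Gamma> \<turnstile> \<psi> \<Longrightarrow> \<Gamma> \<turnstile> \<phi> \<^bold>\<and> \<psi>"
| conj_E1: "\<Gamma> \<turnstile> \<phi> \<^bold>\<and> \<psi> \<Longrightarrow> \<Gamma> \<turnstile> \<phi>"
| conj_E2: "\<Gamma> \<turnstile> \<phi> \<^bold>\<and> \<psi> \<Longrightarrow> \<Gamma> \<turnstile> \<psi>"
| disj_I1: "\<Gamma> \<turnstile> \<phi> \<Longrightarrow> \<Gamma> \<turnstile> \<phi> \<^bold>\<or> \<psi>"
| disj_I2: "\<Gamma> \<turnstile> \<psi> \<Longrightarrow> \<Gamma> \<turnstile> \<phi> \<^bold>\<or> \<psi>"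
| disj_E: "\<Gamma> \<turnstile> \<phi> \<^bold>\<or> \<psi> \<Longrightarrow> insert \<phi> \<Gamma> \<turnstile> \<chi> \<Longrightarrow> insert \<psi> \<Gamma> \<turnstile> \<chi> \<Longrightarrow> \<Gamma> \<turnstile> \<chi>"
| imp_I: "insert \<phi> \<Gamma> \<turnstile> \<psi> \<Longrightarrow> \<Gamma> \<turnstile> \<phi> \<^bold>\<longrightarrow> \<psi>"
| imp_E: "\<Gamma> \<turnstile> \<phi> \<^bold>\<longrightarrow> \<psi> \<Longrightarrow> \<Gamma> \<turnstile> \<phi> \<Longrightarrow> \<Gamma> \<turnstile> \<psi>"
| all_I: "\<Gamma> \<turnstile> \<phi> \<Longrightarrow> x \<notin> \<Union> (fv ` \<Gamma>) \<Longrightarrow> \<Gamma> \<turnstile> All x \<phi>"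
| all_E: "\<Gamma> \<turnstile> All x \<phi> \<Longrightarrow> free_for t x \<phi> \<Longrightarrow> \<Gamma> \<turnstile> subst x t \<phi>"
| ex_I: "\<Gamma> \<turnstile> subst x t \<phi> \<Longrightarrow> free_for t x \<phi> \<Longrightarrow> \<Gamma> \<turnstile> Ex x \<phi>"
| ex_E: "\<Gamma> \<turnstile> Ex x \<phi> \<Longrightarrow> insert \<phi> \<Gamma> \<turnstile> \<psi> \<Longrightarrow> x \<notin> fv \<psi> \<union> \<Union> (fv ` \<Gamma>) \<Longrightarrow> \<Gamma> \<turnstile> \<psi>"
| allC_I: "\<Gamma> \<turnstile> \<phi> \<Longrightarrow> X \<notin> \<Union> (fvC ` \<Gamma>) \<Longrightarrow> \<Gamma> \<turnstile> AllC X \<phi>"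
| allC_E: "\<Gamma> \<turnstile> AllC X \<phi> \<Longrightarrow> free_forC A X \<phi> \<Longrightarrow> \<Gamma> \<turnstile> substC X A \<phi>"
| exC_I: "\<Gamma> \<turnstile> substC X A \<phi> \<Longrightarrow> free_forC A X \<phi> \<Longrightarrow> \<Gamma> \<turnstile> ExC X \<phi>"
| exC_E: "\<Gamma> \<turnstile> ExC X \<phi> \<Longrightarrow> insert \<phi> \<Gamma> \<turnstile> \<psi> \<Longrightarrow> X \<notin> fvC \<psi> \<union> \<Union> (fvC ` \<Gamma>) \<Longrightarrow> \<Gamma> \<turnstile> \<psi>"

section \<open>q-normed spaces\<close>

text \<open>
  The formulas below share free variables for the data of a space, which are bound in
  \<open>every_element_normable\<close>: the classes \<open>X\<close> and \<open>I\<close> with their equality relations \<open>E\<close> and \<open>J\<close>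
  (classes of pairs), and the operations \<open>zero\<close>, \<open>add\<close>, \<open>neg\<close>, \<open>smul\<close>, \<open>norm\<close>.
\<close>

abbreviation SpX :: cls where "SpX \<equiv> CV ''X''"
abbreviation IxI :: cls where "IxI \<equiv> CV ''I''"

abbreviation veq :: "tm \<Rightarrow> tm \<Rightarrow> fm" (infix "\<approx>" 55) where
  "s \<approx> t \<equiv> pr s t \<^bold>\<in> CV ''E''"

abbreviation ieq :: "tm \<Rightarrow> tm \<Rightarrow> fm" where
  "ieq s t \<equiv> pr s t \<^bold>\<in> CV ''J''"

abbreviation vzero :: tm where "vzero \<equiv> V ''zero''"

abbreviation vadd :: "tm \<Rightarrow> tm \<Rightarrow> tm" (infixl "\<boxplus>" 65) where
  "s \<boxplus> t \<equiv> V ''add'' \<cdot> s \<cdot> t"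

abbreviation vneg :: "tm \<Rightarrow> tm" where
  "vneg t \<equiv> V ''neg'' \<cdot> t"

abbreviation smul :: "tm \<Rightarrow> tm \<Rightarrow> tm" (infixr "\<odot>" 75) where
  "r \<odot> t \<equiv> V ''smul'' \<cdot> r \<cdot> t"

abbreviation qnorm :: "tm \<Rightarrow> tm \<Rightarrow> tm" where
  "qnorm i t \<equiv> V ''norm'' \<cdot> i \<cdot> t"

definition equivalence :: "cls \<Rightarrow> (tm \<Rightarrow> tm \<Rightarrow> fm) \<Rightarrow> fm" where
  "equivalence A eq =
    ((\<^bold>\<forall>''x''\<^bold>\<in>A. eq (V ''x'') (V ''x'')) \<^bold>\<and>
     (\<^bold>\<forall>''x''\<^bold>\<in>A. \<^bold>\<forall>''y''\<^bold>\<in>A. eq (V ''x'') (V ''y'') \<^bold>\<longrightarrow> eq (V ''y'') (V ''x'')) \<^bold>\<and>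
     (\<^bold>\<forall>''x''\<^bold>\<in>A. \<^bold>\<forall>''y''\<^bold>\<in>A. \<^bold>\<forall>''z''\<^bold>\<in>A.
        eq (V ''x'') (V ''y'') \<^bold>\<and> eq (V ''y'') (V ''z'') \<^bold>\<longrightarrow> eq (V ''x'') (V ''z'')))"

definition linear_operations :: fm where
  "linear_operations =
    (vzero \<^bold>\<in> SpX \<^bold>\<and>
     (\<^bold>\<forall>''x''\<^bold>\<in>SpX. \<^bold>\<forall>''y''\<^bold>\<in>SpX. V ''x'' \<boxplus> V ''y'' \<^bold>\<in> SpX) \<^bold>\<and>
     (\<^bold>\<forall>''x''\<^bold>\<in>SpX. vneg (V ''x'') \<^bold>\<in> SpX) \<^bold>\<and>
     (\<^bold>\<forall>''r''\<^bold>\<in>Real. \<^bold>\<forall>''x''\<^bold>\<in>SpX. V ''r'' \<odot> V ''x'' \<^bold>\<in> SpX) \<^bold>\<and>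
     (\<^bold>\<forall>''x''\<^bold>\<in>SpX. \<^bold>\<forall>''x1''\<^bold>\<in>SpX. \<^bold>\<forall>''y''\<^bold>\<in>SpX. \<^bold>\<forall>''y1''\<^bold>\<in>SpX.
        V ''x'' \<approx> V ''x1'' \<^bold>\<and> V ''y'' \<approx> V ''y1'' \<^bold>\<longrightarrow> V ''x'' \<boxplus> V ''y'' \<approx> V ''x1'' \<boxplus> V ''y1'') \<^bold>\<and>
     (\<^bold>\<forall>''x''\<^bold>\<in>SpX. \<^bold>\<forall>''y''\<^bold>\<in>SpX. V ''x'' \<approx> V ''y'' \<^bold>\<longrightarrow> vneg (V ''x'') \<approx> vneg (V ''y'')) \<^bold>\<and>
     (\<^bold>\<forall>''r''\<^bold>\<in>Real. \<^bold>\<forall>''r1''\<^bold>\<in>Real. \<^bold>\<forall>''x''\<^bold>\<in>SpX. \<^bold>\<forall>''x1''\<^bold>\<in>SpX.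
        V ''r'' \<^bold>\<simeq> V ''r1'' \<^bold>\<and> V ''x'' \<approx> V ''x1'' \<^bold>\<longrightarrow> V ''r'' \<odot> V ''x'' \<approx> V ''r1'' \<odot> V ''x1''))"

definition linear_space :: fm where
  "linear_space =
    (equivalence SpX veq \<^bold>\<and> linear_operations \<^bold>\<and>
     (\<^bold>\<forall>''x''\<^bold>\<in>SpX. \<^bold>\<forall>''y''\<^bold>\<in>SpX. V ''x'' \<boxplus> V ''y'' \<approx> V ''y'' \<boxplus> V ''x'') \<^bold>\<and>
     (\<^bold>\<forall>''x''\<^bold>\<in>SpX. \<^bold>\<forall>''y''\<^bold>\<in>SpX. \<^bold>\<forall>''z''\<^bold>\<in>SpX.
        (V ''x'' \<boxplus> V ''y'') \<boxplus> V ''z'' \<approx> V ''x'' \<boxplus> (V ''y'' \<boxplus> V ''z'')) \<^bold>\<and>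
     (\<^bold>\<forall>''x''\<^bold>\<in>SpX. V ''x'' \<boxplus> vzero \<approx> V ''x'') \<^bold>\<and>
     (\<^bold>\<forall>''x''\<^bold>\<in>SpX. V ''x'' \<boxplus> vneg (V ''x'') \<approx> vzero) \<^bold>\<and>
     (\<^bold>\<forall>''x''\<^bold>\<in>SpX. \<one> \<odot> V ''x'' \<approx> V ''x'') \<^bold>\<and>
     (\<^bold>\<forall>''r''\<^bold>\<in>Real. \<^bold>\<forall>''s''\<^bold>\<in>Real. \<^bold>\<forall>''x''\<^bold>\<in>SpX.
        V ''r'' \<odot> (V ''s'' \<odot> V ''x'') \<approx> (V ''r'' \<otimes> V ''s'') \<odot> V ''x'') \<^bold>\<and>
     (\<^bold>\<forall>''r''\<^bold>\<in>Real. \<^bold>\<forall>''s''\<^bold>\<in>Real. \<^bold>\<forall>''x''\<^bold>\<in>SpX.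
        (V ''r'' \<oplus> V ''s'') \<odot> V ''x'' \<approx> (V ''r'' \<odot> V ''x'') \<boxplus> (V ''s'' \<odot> V ''x'')) \<^bold>\<and>
     (\<^bold>\<forall>''r''\<^bold>\<in>Real. \<^bold>\<forall>''x''\<^bold>\<in>SpX. \<^bold>\<forall>''y''\<^bold>\<in>SpX.
        V ''r'' \<odot> (V ''x'' \<boxplus> V ''y'') \<approx> (V ''r'' \<odot> V ''x'') \<boxplus> (V ''r'' \<odot> V ''y'')))"

definition seminorm_family :: fm where
  "seminorm_family =
    (equivalence IxI ieq \<^bold>\<and>
     (\<^bold>\<forall>''i''\<^bold>\<in>IxI. \<^bold>\<forall>''x''\<^bold>\<in>SpX. qnorm (V ''i'') (V ''x'') \<^bold>\<in> Real) \<^bold>\<and>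
     (\<^bold>\<forall>''i''\<^bold>\<in>IxI. \<^bold>\<forall>''j''\<^bold>\<in>IxI. \<^bold>\<forall>''x''\<^bold>\<in>SpX. \<^bold>\<forall>''y''\<^bold>\<in>SpX.
        ieq (V ''i'') (V ''j'') \<^bold>\<and> V ''x'' \<approx> V ''y'' \<^bold>\<longrightarrow>
        qnorm (V ''i'') (V ''x'') \<^bold>\<simeq> qnorm (V ''j'') (V ''y'')) \<^bold>\<and>
     (\<^bold>\<forall>''i''\<^bold>\<in>IxI. \<^bold>\<forall>''x''\<^bold>\<in>SpX. \<zero> \<^bold>\<le> qnorm (V ''i'') (V ''x'')) \<^bold>\<and>
     (\<^bold>\<forall>''i''\<^bold>\<in>IxI. \<^bold>\<forall>''x''\<^bold>\<in>SpX. \<^bold>\<forall>''y''\<^bold>\<in>SpX.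
        qnorm (V ''i'') (V ''x'' \<boxplus> V ''y'')
          \<^bold>\<le> qnorm (V ''i'') (V ''x'') \<oplus> qnorm (V ''i'') (V ''y'')) \<^bold>\<and>
     (\<^bold>\<forall>''i''\<^bold>\<in>IxI. \<^bold>\<forall>''r''\<^bold>\<in>Real. \<^bold>\<forall>''x''\<^bold>\<in>SpX.
        qnorm (V ''i'') (V ''r'' \<odot> V ''x'') \<^bold>\<simeq> rabs (V ''r'') \<otimes> qnorm (V ''i'') (V ''x'')))"

text \<open>
  The last conjunct says that the given equality of \<open>X\<close> is the one determined by the q-norm.
\<close>

definition qnormed_space :: fm where
  "qnormed_space =
    (linear_space \<^bold>\<and> seminorm_family \<^bold>\<and>
     (\<^bold>\<forall>''x''\<^bold>\<in>SpX. \<^bold>\<exists>''u''\<^bold>\<in>Real. \<^bold>\<forall>''i''\<^bold>\<in>IxI. rabs (qnorm (V ''i'') (V ''x'')) \<^bold>\<le> V ''u'') \<^bold>\<and>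
     (\<^bold>\<forall>''x''\<^bold>\<in>SpX. \<^bold>\<forall>''y''\<^bold>\<in>SpX. V ''x'' \<approx> V ''y'' \<^bold>\<longleftrightarrow>
        (\<^bold>\<forall>''i''\<^bold>\<in>IxI. qnorm (V ''i'') (V ''x'' \<boxplus> vneg (V ''y'')) \<^bold>\<simeq> \<zero>)))"

text \<open>Inequality of elements; the name \<open>i\<close> must not be free in \<open>s\<close> and \<open>t\<close>.\<close>

definition vneq :: "tm \<Rightarrow> tm \<Rightarrow> fm" where
  "vneq s t = (\<^bold>\<exists>''i''\<^bold>\<in>IxI. \<zero> \<^bold>< qnorm (V ''i'') (s \<boxplus> vneg t))"

text \<open>Like \<open>rsum\<close>, in \<open>X\<close>.\<close>

definition vsum :: "(tm \<Rightarrow> tm) \<Rightarrow> tm \<Rightarrow> tm" where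
  "vsum f n = C cRec \<cdot> vzero \<cdot> lam ''k'' (lam ''t'' (V ''t'' \<boxplus> f (V ''k''))) \<cdot> n"

text \<open>
  A basis with \<open>m + 1\<close> elements (so at least one) is given by the first \<open>m + 1\<close> terms of a sequence
  \<open>b\<close> in \<open>X\<close>, and a coefficient tuple by the first \<open>m + 1\<close> terms of a real sequence \<open>l\<close>; the other
  terms are not used. The empty basis is excluded: otherwise the zero space with empty index set,
  whose element is not normable, would refute the premise of the theorem.
\<close>

definition finite_dimensional :: fm where
  "finite_dimensional =
    (\<^bold>\<exists>''m''\<^bold>\<in>Nat. \<^bold>\<exists>''b''.
       (\<^bold>\<forall>''n''\<^bold>\<in>Nat. V ''b'' \<cdot> V ''n'' \<^bold>\<in> SpX) \<^bold>\<and>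
       (\<^bold>\<forall>''x''\<^bold>\<in>SpX. \<^bold>\<exists>''l''. (\<^bold>\<forall>''n''\<^bold>\<in>Nat. V ''l'' \<cdot> V ''n'' \<^bold>\<in> Real) \<^bold>\<and>
          V ''x'' \<approx> vsum (\<lambda>k. (V ''l'' \<cdot> k) \<odot> (V ''b'' \<cdot> k)) (suc (V ''m''))) \<^bold>\<and>
       (\<^bold>\<forall>''l''. (\<^bold>\<forall>''n''\<^bold>\<in>Nat. V ''l'' \<cdot> V ''n'' \<^bold>\<in> Real) \<^bold>\<and>
          \<zero> \<^bold>< rsum (\<lambda>k. rabs (V ''l'' \<cdot> k)) (suc (V ''m'')) \<^bold>\<longrightarrow>
          vneq (vsum (\<lambda>k. (V ''l'' \<cdot> k) \<odot> (V ''b'' \<cdot> k)) (suc (V ''m''))) vzero))"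

text \<open>The names \<open>s\<close>, \<open>i\<close> and \<open>e\<close> must not be free in \<open>x\<close>.\<close>

definition normable :: "tm \<Rightarrow> fm" where
  "normable x =
    (\<^bold>\<exists>''s''\<^bold>\<in>Real.
       (\<^bold>\<forall>''i''\<^bold>\<in>IxI. qnorm (V ''i'') x \<^bold>\<le> V ''s'') \<^bold>\<and>
       (\<^bold>\<forall>''e''\<^bold>\<in>Real. \<zero> \<^bold>< V ''e'' \<^bold>\<longrightarrow>
          (\<^bold>\<exists>''i''\<^bold>\<in>IxI. V ''s'' \<oplus> \<ominus> V ''e'' \<^bold>< qnorm (V ''i'') x)))"

definition every_element_normable :: fm where
  "every_element_normable =
    (\<^bold>\<forall>\<^sub>C''X''. \<^bold>\<forall>\<^sub>C''E''. \<^bold>\<forall>\<^sub>C''I''. \<^bold>\<forall>\<^sub>C''J''.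
     \<^bold>\<forall>''zero''. \<^bold>\<forall>''add''. \<^bold>\<forall>''neg''. \<^bold>\<forall>''smul''. \<^bold>\<forall>''norm''.
       qnormed_space \<^bold>\<and> finite_dimensional \<^bold>\<longrightarrow> (\<^bold>\<forall>''x''\<^bold>\<in>SpX. normable (V ''x'')))"

section \<open>The limited principle of omniscience\<close>

text \<open>Sequences are indexed by the natural numbers including zero.\<close>

definition LPO :: fm where
  "LPO =
    (\<^bold>\<forall>''a''. (\<^bold>\<forall>''n''\<^bold>\<in>Nat. V ''a'' \<cdot> V ''n'' \<^bold>= zero \<^bold>\<or> V ''a'' \<cdot> V ''n'' \<^bold>= suc zero) \<^bold>\<longrightarrow>
       (\<^bold>\<forall>''n''\<^bold>\<in>Nat. V ''a'' \<cdot> V ''n'' \<^bold>= zero) \<^bold>\<or> (\<^bold>\<exists>''n''\<^bold>\<in>Nat. V ''a'' \<cdot> V ''n'' \<^bold>= suc zero))"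

end

(* Given a binary sequence a, take the one-dimensional space of real numbers with the norms
   indexed by natural numbers, the i-th of which maps x to |x| or to 2|x| according to whether
   a_i is 0 or 1. The supremum s of the norms of 1, if it exists, satisfies s > 1 or s < 2 by
   cotransitivity of the order. In the first case some norm of 1 exceeds 1, so a has a value 1; in
   the second case no norm of 1 is 2, so all values of a are 0.

   Inequalities <= and equalities of real numbers are negations, so most of the arithmetic needed
   for the seminorms may be done with classical case distinctions; only the norms of positive
   elements and the final argument are genuinely constructive. *)

theory Submission
  imports Defs
begin

section \<open>Substitution\<close>

text \<open>The obstacle is formal: the space has to be inserted into an object formula, and
  substitution there neither renames bound variables nor, for a compound term, commutes with bracket
  abstraction. Hence axioms are used through matrices moved to fresh variables, and sums and norms
  are evaluated at variables or constants before anything compound is inserted. The linear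
  operations are plain constants and the norm is the term \<open>qn\<close>, but the two equalities
  are not terms: they are class variables obtained by comprehension and eliminated at the very end.

  The factors 1 and 2 make every norm dominate the absolute value. The single index zero therefore
  serves wherever an index has to be exhibited or tested: for the norm of a nonzero combination and
  for the equality determined by the q-norm. Branching on a value of \<open>a\<close> is
  constructively legitimate, since \<open>binary\<close> supplies an actual disjunction; the norm
  realises the branching by taking that value as the number of recursion steps.\<close>

lemma finite_fv_tm [simp]: "finite (fv_tm t)"
  by (induction t) auto

lemma fresh_name:
  assumes "finite (S :: name set)"
  obtains x where "x \<notin> S"
  using assms ex_new_if_finite infinite_UNIV_listI by blast

lemma finite_fv [simp]: "finite (fv \<phi>)"
  by (induction \<phi>) auto

lemma subst_tm_fresh [simp]: "x \<notin> fv_tm t \<Longrightarrow> subst_tm x u t = t"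
  by (induction t) auto

lemma subst_tm_self [simp]: "subst_tm x (V x) t = t"
  by (induction t) auto

lemma subst_self [simp]: "subst x (V x) \<phi> = \<phi>"
  by (induction \<phi>) auto

lemma free_for_self [simp]: "free_for (V x) x \<phi>"
  by (induction \<phi>) auto

lemma free_for_closed [simp]: "fv_tm u = {} \<Longrightarrow> free_for u x \<phi>"
  by (induction \<phi>) auto

lemma subst_cls_self [simp]: "subst_cls X (CV X) A = A"
  by (cases A) auto

lemma substC_self [simp]: "substC X (CV X) \<phi> = \<phi>"
  by (induction \<phi>) auto

lemma free_forC_self [simp]: "free_forC (CV X) X \<phi>"
  by (induction \<phi>) auto

lemma free_forC_closed [simp]: "fv_cls A = {} \<Longrightarrow> free_forC A X \<phi>"
  by (induction \<phi>) auto

lemma fv_lam [simp]: "fv_tm (lam x t) = fv_tm t - {x}"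
  by (induction t) auto

fun atomic :: "tm \<Rightarrow> bool" where
  "atomic (s \<cdot> t) = False"
| "atomic _ = True"

text \<open>
  For compound \<open>u\<close> this fails: \<open>lam x\<close> also distributes over those applications inside \<open>u\<close> in
  which \<open>x\<close> does not occur.
\<close>

lemma subst_lam:
  "atomic u \<Longrightarrow> x \<noteq> y \<Longrightarrow> x \<notin> fv_tm u \<Longrightarrow> subst_tm y u (lam x t) = lam x (subst_tm y u t)"
  by (induction t) (cases u; simp)+

section \<open>Quantifier-free formulas and simultaneous substitution\<close>

fun quantifier_free :: "fm \<Rightarrow> bool" where
  "quantifier_free (\<phi> \<^bold>\<and> \<psi>) = (quantifier_free \<phi> \<and> quantifier_free \<psi>)"
| "quantifier_free (\<phi> \<^bold>\<or> \<psi>) = (quantifier_free \<phi> \<and> quantifier_free \<psi>)"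
| "quantifier_free (\<phi> \<^bold>\<longrightarrow> \<psi>) = (quantifier_free \<phi> \<and> quantifier_free \<psi>)"
| "quantifier_free (All x \<phi>) = False"
| "quantifier_free (Ex x \<phi>) = False"
| "quantifier_free (AllC X \<phi>) = False"
| "quantifier_free (ExC X \<phi>) = False"
| "quantifier_free _ = True"

fun psubst_tm :: "(name \<Rightarrow> tm) \<Rightarrow> tm \<Rightarrow> tm" where
  "psubst_tm \<sigma> (V y) = \<sigma> y"
| "psubst_tm \<sigma> (C c) = C c"
| "psubst_tm \<sigma> (s \<cdot> t) = psubst_tm \<sigma> s \<cdot> psubst_tm \<sigma> t"

text \<open>Meant for quantifier-free formulas: the last equation leaves every quantified formula
  unchanged.\<close>

fun psubst :: "(name \<Rightarrow> tm) \<Rightarrow> fm \<Rightarrow> fm" where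
  "psubst \<sigma> (s \<^bold>= t) = (psubst_tm \<sigma> s \<^bold>= psubst_tm \<sigma> t)"
| "psubst \<sigma> (t \<^bold>\<in> A) = (psubst_tm \<sigma> t \<^bold>\<in> A)"
| "psubst \<sigma> (\<phi> \<^bold>\<and> \<psi>) = (psubst \<sigma> \<phi> \<^bold>\<and> psubst \<sigma> \<psi>)"
| "psubst \<sigma> (\<phi> \<^bold>\<or> \<psi>) = (psubst \<sigma> \<phi> \<^bold>\<or> psubst \<sigma> \<psi>)"
| "psubst \<sigma> (\<phi> \<^bold>\<longrightarrow> \<psi>) = (psubst \<sigma> \<phi> \<^bold>\<longrightarrow> psubst \<sigma> \<psi>)"
| "psubst \<sigma> \<phi> = \<phi>"

lemma free_for_quantifier_free [simp]: "quantifier_free \<phi> \<Longrightarrow> free_for u x \<phi>"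
  by (induction \<phi>) auto

lemma quantifier_free_subst [simp]: "quantifier_free (subst x u \<phi>) = quantifier_free \<phi>"
  by (induction \<phi>) auto

lemma subst_tm_psubst_tm: "subst_tm x u (psubst_tm \<sigma> t) = psubst_tm (\<lambda>y. subst_tm x u (\<sigma> y)) t"
  by (induction t) auto

lemma subst_psubst:
  "quantifier_free \<phi> \<Longrightarrow> subst x u (psubst \<sigma> \<phi>) = psubst (\<lambda>y. subst_tm x u (\<sigma> y)) \<phi>"
  by (induction \<phi>) (auto simp: subst_tm_psubst_tm)

lemma psubst_tm_V: "psubst_tm V t = t"
  by (induction t) auto

lemma psubst_V: "quantifier_free \<phi> \<Longrightarrow> psubst V \<phi> = \<phi>"
  by (induction \<phi>) (auto simp: psubst_tm_V)

lemma psubst_tm_cong: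
  "(\<And>w. w \<in> fv_tm t \<Longrightarrow> \<sigma> w = \<tau> w) \<Longrightarrow> psubst_tm \<sigma> t = psubst_tm \<tau> t"
  by (induction t) auto

lemma psubst_cong:
  "quantifier_free \<phi> \<Longrightarrow> (\<And>w. w \<in> fv \<phi> \<Longrightarrow> \<sigma> w = \<tau> w) \<Longrightarrow> psubst \<sigma> \<phi> = psubst \<tau> \<phi>"
  by (induction \<phi>) (auto intro: psubst_tm_cong)

text \<open>In the empty context every variable can be generalised and then instantiated.\<close>

lemma derivable_subst:
  assumes "{} \<turnstile> \<phi>" "free_for u x \<phi>"
  shows "{} \<turnstile> subst x u \<phi>"
  using all_E[OF all_I[OF assms(1)] assms(2)] by simp

text \<open>
  The theorem is first moved to fresh variables, so that no substituted term contains a variable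
  that is still to be replaced.
\<close>

lemma simultaneous_instance:
  assumes "{} \<turnstile> \<phi>" "quantifier_free \<phi>" "distinct [x, y, z]"
  shows "\<Gamma> \<turnstile> psubst (V(x := s, y := t, z := u)) \<phi>"
proof -
  define S where "S = {x, y, z} \<union> fv_tm s \<union> fv_tm t \<union> fv_tm u \<union> fv \<phi>"
  have fin: "finite S"
    by (simp add: S_def)
  obtain a where a: "a \<notin> S"
    using fresh_name[OF fin] .
  obtain b where b: "b \<notin> insert a S"
    using fresh_name[of "insert a S"] fin by auto
  obtain c where c: "c \<notin> insert a (insert b S)"
    using fresh_name[of "insert a (insert b S)"] fin by auto
  define \<tau> where "\<tau> = (\<lambda>w. subst_tm c u (subst_tm b t (subst_tm a s
      (subst_tm z (V c) (subst_tm y (V b) (subst_tm x (V a) (V w)))))))"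
  have "{} \<turnstile> subst c u (subst b t (subst a s
      (subst z (V c) (subst y (V b) (subst x (V a) (psubst V \<phi>))))))"
    by (intro derivable_subst) (use assms in \<open>simp_all add: psubst_V\<close>)
  \<comment> \<open>\<open>subst_psubst\<close> absorbs the six successive substitutions into one
    map on variables, so that only its values on \<open>fv \<phi>\<close> remain to be
    compared.\<close>
  then have "{} \<turnstile> psubst \<tau> \<phi>"
    using assms(2) by (simp only: subst_psubst \<tau>_def)
  also have "psubst \<tau> \<phi> = psubst (V(x := s, y := t, z := u)) \<phi>"
  proof (rule psubst_cong[OF assms(2)])
    fix w assume "w \<in> fv \<phi>"
    then show "\<tau> w = (V(x := s, y := t, z := u)) w"
      using a b c assms(3) by (auto simp: \<tau>_def S_def)
  qed
  finally show ?thesis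
    by (rule weaken) simp
qed

section \<open>Derived rules\<close>

text \<open>The premise ranges over all larger contexts, as in Kripke forcing: an object hypothesis
  becomes a meta-level assumption about an arbitrary \<open>\<Delta>\<close>, and earlier facts
  follow by weakening.\<close>

lemma imp_cases:
  assumes "\<And>\<Delta>. \<Gamma> \<subseteq> \<Delta> \<Longrightarrow> \<Delta> \<turnstile> \<phi> \<Longrightarrow> \<Delta> \<turnstile> \<psi>"
  shows "\<Gamma> \<turnstile> \<phi> \<^bold>\<longrightarrow> \<psi>"
  by (rule imp_I, rule assms) (auto intro: hyp)

lemma disj_cases:
  assumes "\<Gamma> \<turnstile> \<phi> \<^bold>\<or> \<psi>"
    and "\<And>\<Delta>. \<Gamma> \<subseteq> \<Delta> \<Longrightarrow> \<Delta> \<turnstile> \<phi> \<Longrightarrow> \<Delta> \<turnstile> \<chi>"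
    and "\<And>\<Delta>. \<Gamma> \<subseteq> \<Delta> \<Longrightarrow> \<Delta> \<turnstile> \<psi> \<Longrightarrow> \<Delta> \<turnstile> \<chi>"
  shows "\<Gamma> \<turnstile> \<chi>"
  by (rule disj_E[OF assms(1)]; rule assms) (auto intro: hyp)

text \<open>Intuitionistically valid because the goal is falsum: the first case derives the negation
  of \<open>\<phi>\<close>, which is what the second case asks for.\<close>

lemma classical_cases:
  assumes "\<And>\<Delta>. \<Gamma> \<subseteq> \<Delta> \<Longrightarrow> \<Delta> \<turnstile> \<phi> \<Longrightarrow> \<Delta> \<turnstile> \<^bold>\<bottom>"
    and "\<And>\<Delta>. \<Gamma> \<subseteq> \<Delta> \<Longrightarrow> \<Delta> \<turnstile> \<^bold>\<not> \<phi> \<Longrightarrow> \<Delta> \<turnstile> \<^bold>\<bottom>"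
  shows "\<Gamma> \<turnstile> \<^bold>\<bottom>"
  using assms(2)[OF order_refl imp_cases[OF assms(1)]] .

lemma all_in_I:
  "insert (V x \<^bold>\<in> A) \<Gamma> \<turnstile> \<phi> \<Longrightarrow> x \<notin> \<Union> (fv ` \<Gamma>) \<Longrightarrow> \<Gamma> \<turnstile> \<^bold>\<forall>x\<^bold>\<in>A. \<phi>"
  by (intro all_I imp_I)

lemma all_in_E:
  "\<Gamma> \<turnstile> \<^bold>\<forall>x\<^bold>\<in>A. \<phi> \<Longrightarrow> \<Gamma> \<turnstile> t \<^bold>\<in> A \<Longrightarrow> free_for t x \<phi> \<Longrightarrow> \<Gamma> \<turnstile> subst x t \<phi>"
  using all_E[of \<Gamma> x "V x \<^bold>\<in> A \<^bold>\<longrightarrow> \<phi>" t] by (auto intro: imp_E)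

lemma ex_in_I:
  "\<Gamma> \<turnstile> subst x t \<phi> \<Longrightarrow> \<Gamma> \<turnstile> t \<^bold>\<in> A \<Longrightarrow> free_for t x \<phi> \<Longrightarrow> \<Gamma> \<turnstile> \<^bold>\<exists>x\<^bold>\<in>A. \<phi>"
  by (rule ex_I[of _ _ t]) (auto intro: conj_I)

text \<open>Opens a conjunction inside the context, so that after \<open>imp_I\<close> or
  \<open>ex_E\<close> its parts are available as separate hypotheses.\<close>

lemma conj_insert:
  assumes "insert \<phi> (insert \<psi> \<Gamma>) \<turnstile> \<chi>"
  shows "insert (\<phi> \<^bold>\<and> \<psi>) \<Gamma> \<turnstile> \<chi>"
proof -
  have "\<Gamma> \<turnstile> \<psi> \<^bold>\<longrightarrow> \<phi> \<^bold>\<longrightarrow> \<chi>"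
    by (intro imp_I assms)
  then have "insert (\<phi> \<^bold>\<and> \<psi>) \<Gamma> \<turnstile> \<psi> \<^bold>\<longrightarrow> \<phi> \<^bold>\<longrightarrow> \<chi>"
    by (rule weaken) auto
  moreover have "insert (\<phi> \<^bold>\<and> \<psi>) \<Gamma> \<turnstile> \<phi> \<^bold>\<and> \<psi>"
    by (rule hyp) simp
  ultimately show ?thesis
    by (meson conj_E1 conj_E2 imp_E)
qed

lemma ex_in_E:
  "\<Gamma> \<turnstile> \<^bold>\<exists>x\<^bold>\<in>A. \<phi> \<Longrightarrow> insert (V x \<^bold>\<in> A) (insert \<phi> \<Gamma>) \<turnstile> \<psi> \<Longrightarrow> x \<notin> fv \<psi> \<union> \<Union> (fv ` \<Gamma>) \<Longrightarrow>
    \<Gamma> \<turnstile> \<psi>"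
  by (rule ex_E[OF _ conj_insert])

lemma iff_E1: "\<Gamma> \<turnstile> \<phi> \<^bold>\<longleftrightarrow> \<psi> \<Longrightarrow> \<Gamma> \<turnstile> \<phi> \<Longrightarrow> \<Gamma> \<turnstile> \<psi>"
  by (meson conj_E1 imp_E)

lemma iff_E2: "\<Gamma> \<turnstile> \<phi> \<^bold>\<longleftrightarrow> \<psi> \<Longrightarrow> \<Gamma> \<turnstile> \<psi> \<Longrightarrow> \<Gamma> \<turnstile> \<phi>"
  by (meson conj_E2 imp_E)

text \<open>Leibniz's rule for a formula with a fresh variable at the place to be rewritten;
  freshness keeps other occurrences of \<open>s\<close> intact. The next lemmas follow the same
  pattern.\<close>

lemma eq_sym:
  assumes "\<Gamma> \<turnstile> s \<^bold>= t"
  shows "\<Gamma> \<turnstile> t \<^bold>= s"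
proof -
  obtain x where "x \<notin> fv_tm s"
    using fresh_name[of "fv_tm s"] by auto
  then show ?thesis
    using eq_subst[OF assms, of x "V x \<^bold>= s"] by (simp add: eq_refl)
qed

lemma eq_app_right:
  assumes "\<Gamma> \<turnstile> s \<^bold>= t"
  shows "\<Gamma> \<turnstile> u \<cdot> s \<^bold>= u \<cdot> t"
proof -
  obtain x where "x \<notin> fv_tm u \<union> fv_tm s"
    using fresh_name[of "fv_tm u \<union> fv_tm s"] by auto
  then show ?thesis
    using eq_subst[OF assms, of x "u \<cdot> s \<^bold>= u \<cdot> V x"] by (simp add: eq_refl)
qed

lemma eq_app_left:
  assumes "\<Gamma> \<turnstile> s \<^bold>= t"
  shows "\<Gamma> \<turnstile> s \<cdot> u \<^bold>= t \<cdot> u"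
proof -
  obtain x where "x \<notin> fv_tm u \<union> fv_tm s"
    using fresh_name[of "fv_tm u \<union> fv_tm s"] by auto
  then show ?thesis
    using eq_subst[OF assms, of x "s \<cdot> u \<^bold>= V x \<cdot> u"] by (simp add: eq_refl)
qed

lemma eq_trans [trans]:
  assumes "\<Gamma> \<turnstile> s \<^bold>= t" "\<Gamma> \<turnstile> t \<^bold>= u"
  shows "\<Gamma> \<turnstile> s \<^bold>= u"
proof -
  obtain x where "x \<notin> fv_tm s"
    using fresh_name[of "fv_tm s"] by auto
  then show ?thesis
    using eq_subst[OF assms(2), of x "s \<^bold>= V x"] assms(1) by simp
qed

lemma eq_app: "\<Gamma> \<turnstile> s \<^bold>= s' \<Longrightarrow> \<Gamma> \<turnstile> t \<^bold>= t' \<Longrightarrow> \<Gamma> \<turnstile> s \<cdot> t \<^bold>= s' \<cdot> t'"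
  by (meson eq_app_left eq_app_right eq_trans)

lemma eq_mem: "\<Gamma> \<turnstile> s \<^bold>= t \<Longrightarrow> \<Gamma> \<turnstile> t \<^bold>\<in> A \<Longrightarrow> \<Gamma> \<turnstile> s \<^bold>\<in> A"
  using eq_subst[OF eq_sym, of \<Gamma> s t "''x''" "V ''x'' \<^bold>\<in> A"] by simp

text \<open>
  Axioms are instantiated through their quantifier-free matrices, because the terms need not be free
  for the bound names.
\<close>

lemma all_matrix: "{} \<turnstile> All x \<phi> \<Longrightarrow> {} \<turnstile> \<phi>"
  using all_E[of "{}" x \<phi> "V x"] by simp

lemma all_in_matrix: "\<Gamma> \<turnstile> \<^bold>\<forall>x\<^bold>\<in>A. \<phi> \<Longrightarrow> insert (V x \<^bold>\<in> A) \<Gamma> \<turnstile> \<phi>"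
  using all_in_E[of "insert (V x \<^bold>\<in> A) \<Gamma>" x A \<phi> "V x"] weaken[OF _ subset_insertI]
  by (auto intro: hyp)

lemma instance_2:
  assumes "bish_axiom (\<^bold>\<forall>x. \<^bold>\<forall>y. \<phi>)" "quantifier_free \<phi>" "x \<noteq> y"
  shows "\<Gamma> \<turnstile> psubst (V(x := s, y := t)) \<phi>"
proof -
  \<comment> \<open>A dummy third variable, which is replaced by itself.\<close>
  obtain z where "z \<notin> {x, y}"
    using fresh_name[of "{x, y}"] by auto
  then show ?thesis
    using simultaneous_instance[OF all_matrix[OF all_matrix[OF ax[OF assms(1)]]] assms(2), of x y z \<Gamma> s t "V z"]
      assms(3) by (auto simp: fun_upd_idem)
qed

lemma instance_3:
  assumes "bish_axiom (\<^bold>\<forall>x. \<^bold>\<forall>y. \<^bold>\<forall>z. \<phi>)" "quantifier_free \<phi>" "distinct [x, y, z]"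
  shows "\<Gamma> \<turnstile> psubst (V(x := s, y := t, z := u)) \<phi>"
  using simultaneous_instance[OF all_matrix[OF all_matrix[OF all_matrix[OF ax[OF assms(1)]]]] assms(2,3)] .

section \<open>Computation with combinators, pairs and recursion\<close>

lemma eq_K: "\<Gamma> \<turnstile> C cK \<cdot> s \<cdot> t \<^bold>= s"
  using instance_2[OF comb_K, of \<Gamma> s t] by simp

lemma eq_S: "\<Gamma> \<turnstile> C cS \<cdot> s \<cdot> t \<cdot> u \<^bold>= s \<cdot> u \<cdot> (t \<cdot> u)"
  using instance_3[OF comb_S, of \<Gamma> s t u] by simp

lemma eq_fst: "\<Gamma> \<turnstile> C cFst \<cdot> pr s t \<^bold>= s"
  using instance_2[OF pair_fst, of \<Gamma> s t] by simp

lemma eq_snd: "\<Gamma> \<turnstile> C cSnd \<cdot> pr s t \<^bold>= t"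
  using instance_2[OF pair_snd, of \<Gamma> s t] by simp

text \<open>Holds for arbitrary \<open>u\<close> because a combinator term has no binder that could
  capture a variable: S passes the argument to both sides of an application, K discards it, and
  \<open>S K K\<close> returns it.\<close>

lemma eq_beta: "\<Gamma> \<turnstile> lam x t \<cdot> u \<^bold>= subst_tm x u t"
proof (induction t)
  case (V y)
  then show ?case
    by (auto intro: eq_K eq_trans[OF eq_S])
next
  case (C c)
  then show ?case
    by (simp add: eq_K)
next
  case (App s t)
  then show ?case
    by (auto intro: eq_app eq_trans[OF eq_S])
qed

lemma nat_zero_mem [simp]: "\<Gamma> \<turnstile> zero \<^bold>\<in> Nat"
  by (rule ax[OF nat_zero])

lemma eq_rec_zero: "\<Gamma> \<turnstile> C cRec \<cdot> s \<cdot> t \<cdot> zero \<^bold>= s"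
  using instance_2[OF rec_zero, of \<Gamma> s t] by simp

lemma eq_rec_suc:
  assumes "\<Gamma> \<turnstile> n \<^bold>\<in> Nat"
  shows "\<Gamma> \<turnstile> C cRec \<cdot> s \<cdot> t \<cdot> suc n \<^bold>= t \<cdot> n \<cdot> (C cRec \<cdot> s \<cdot> t \<cdot> n)"
  using instance_3[OF rec_suc, of \<Gamma> s t n] assms by (auto intro: imp_E)

text \<open>Besides zero, one is the only argument at which the recursor is evaluated: for indices
  with value 1 of \<open>a\<close> and for sums with one summand.\<close>

lemma eq_rec_one: "\<Gamma> \<turnstile> C cRec \<cdot> s \<cdot> t \<cdot> suc zero \<^bold>= t \<cdot> zero \<cdot> s"
  by (rule eq_trans[OF eq_rec_suc[OF nat_zero_mem] eq_app_right[OF eq_rec_zero]])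

section \<open>Real numbers\<close>

lemma real_instance_2:
  assumes "real_axiom (\<^bold>\<forall>x\<^bold>\<in>Real. \<^bold>\<forall>y\<^bold>\<in>Real. \<phi>)" "quantifier_free \<phi>" "x \<noteq> y"
    and "\<Gamma> \<turnstile> s \<^bold>\<in> Real" "\<Gamma> \<turnstile> t \<^bold>\<in> Real"
  shows "\<Gamma> \<turnstile> psubst (V(x := s, y := t)) \<phi>"
proof -
  have "{} \<turnstile> V x \<^bold>\<in> Real \<^bold>\<longrightarrow> V y \<^bold>\<in> Real \<^bold>\<longrightarrow> \<phi>"
    by (intro imp_I all_in_matrix ax real assms(1))
  moreover obtain z where "z \<notin> {x, y}"
    using fresh_name[of "{x, y}"] by auto
  ultimately show ?thesis
    using simultaneous_instance[of _ x y z \<Gamma> s t "V z"] assms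
    by (fastforce simp add: fun_upd_idem intro: imp_E)
qed

lemma real_instance_3:
  assumes "real_axiom (\<^bold>\<forall>x\<^bold>\<in>Real. \<^bold>\<forall>y\<^bold>\<in>Real. \<^bold>\<forall>z\<^bold>\<in>Real. \<phi>)" "quantifier_free \<phi>" "distinct [x, y, z]"
    and "\<Gamma> \<turnstile> s \<^bold>\<in> Real" "\<Gamma> \<turnstile> t \<^bold>\<in> Real" "\<Gamma> \<turnstile> u \<^bold>\<in> Real"
  shows "\<Gamma> \<turnstile> psubst (V(x := s, y := t, z := u)) \<phi>"
proof -
  have "{} \<turnstile> V x \<^bold>\<in> Real \<^bold>\<longrightarrow> V y \<^bold>\<in> Real \<^bold>\<longrightarrow> V z \<^bold>\<in> Real \<^bold>\<longrightarrow> \<phi>"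
    by (intro imp_I all_in_matrix ax real assms(1))
  from simultaneous_instance[OF this, of x y z \<Gamma> s t u] show ?thesis
    using assms by (fastforce intro: imp_E)
qed

lemma real_instance_1:
  assumes "real_axiom (\<^bold>\<forall>x\<^bold>\<in>Real. \<phi>)" "quantifier_free \<phi>" "\<Gamma> \<turnstile> s \<^bold>\<in> Real"
  shows "\<Gamma> \<turnstile> subst x s \<phi>"
  by (rule all_in_E[OF ax[OF real[OF assms(1)]] assms(3)]) (simp add: assms(2))

context
  fixes \<Gamma> s
  assumes s: "\<Gamma> \<turnstile> s \<^bold>\<in> Real"
begin

lemma rneg_mem: "\<Gamma> \<turnstile> \<ominus> s \<^bold>\<in> Real"
  using real_instance_1[OF real_axiom.intros(3) _ s] by simp

lemma radd_zero: "\<Gamma> \<turnstile> s \<oplus> \<zero> \<^bold>\<simeq> s"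
  using real_instance_1[OF real_axiom.intros(12) _ s] by simp

lemma radd_neg: "\<Gamma> \<turnstile> s \<oplus> \<ominus> s \<^bold>\<simeq> \<zero>"
  using real_instance_1[OF real_axiom.intros(13) _ s] by simp

lemma rmul_one: "\<Gamma> \<turnstile> s \<otimes> \<one> \<^bold>\<simeq> s"
  using real_instance_1[OF real_axiom.intros(16) _ s] by simp

context
  fixes t
  assumes t: "\<Gamma> \<turnstile> t \<^bold>\<in> Real"
begin

lemma radd_mem: "\<Gamma> \<turnstile> s \<oplus> t \<^bold>\<in> Real"
  using real_instance_2[OF real_axiom.intros(4) _ _ s t] by simp

lemma rmul_mem: "\<Gamma> \<turnstile> s \<otimes> t \<^bold>\<in> Real"
  using real_instance_2[OF real_axiom.intros(5) _ _ s t] by simp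

lemma rmax_mem: "\<Gamma> \<turnstile> rmax s t \<^bold>\<in> Real"
  using real_instance_2[OF real_axiom.intros(6) _ _ s t] by simp

lemma rneg_cong': "\<Gamma> \<turnstile> s \<^bold>\<simeq> t \<^bold>\<longrightarrow> \<ominus> s \<^bold>\<simeq> \<ominus> t"
  using real_instance_2[OF real_axiom.intros(7) _ _ s t] by simp

lemma radd_comm: "\<Gamma> \<turnstile> s \<oplus> t \<^bold>\<simeq> t \<oplus> s"
  using real_instance_2[OF real_axiom.intros(10) _ _ s t] by simp

lemma rmul_comm: "\<Gamma> \<turnstile> s \<otimes> t \<^bold>\<simeq> t \<otimes> s"
  using real_instance_2[OF real_axiom.intros(14) _ _ s t] by simp

lemma less_asym': "\<Gamma> \<turnstile> \<^bold>\<not> (s \<^bold>< t \<^bold>\<and> t \<^bold>< s)"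
  using real_instance_2[OF real_axiom.intros(20) _ _ s t] by simp

lemma rmul_pos': "\<Gamma> \<turnstile> \<zero> \<^bold>< s \<^bold>\<and> \<zero> \<^bold>< t \<^bold>\<longrightarrow> \<zero> \<^bold>< s \<otimes> t"
  using real_instance_2[OF real_axiom.intros(23) _ _ s t] by simp

lemma le_rmax': "\<Gamma> \<turnstile> s \<^bold>\<le> rmax s t \<^bold>\<and> t \<^bold>\<le> rmax s t"
  using real_instance_2[OF real_axiom.intros(24) _ _ s t] by simp

context
  fixes u
  assumes u: "\<Gamma> \<turnstile> u \<^bold>\<in> Real"
begin

lemma radd_cong': "\<Gamma> \<turnstile> s \<^bold>\<simeq> t \<^bold>\<longrightarrow> s \<oplus> u \<^bold>\<simeq> t \<oplus> u"
  using real_instance_3[OF real_axiom.intros(8) _ _ s t u] by simp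

lemma rmul_cong': "\<Gamma> \<turnstile> s \<^bold>\<simeq> t \<^bold>\<longrightarrow> s \<otimes> u \<^bold>\<simeq> t \<otimes> u"
  using real_instance_3[OF real_axiom.intros(9) _ _ s t u] by simp

lemma radd_assoc: "\<Gamma> \<turnstile> (s \<oplus> t) \<oplus> u \<^bold>\<simeq> s \<oplus> (t \<oplus> u)"
  using real_instance_3[OF real_axiom.intros(11) _ _ s t u] by simp

lemma rmul_assoc: "\<Gamma> \<turnstile> (s \<otimes> t) \<otimes> u \<^bold>\<simeq> s \<otimes> (t \<otimes> u)"
  using real_instance_3[OF real_axiom.intros(15) _ _ s t u] by simp

lemma rmul_add: "\<Gamma> \<turnstile> s \<otimes> (t \<oplus> u) \<^bold>\<simeq> s \<otimes> t \<oplus> s \<otimes> u"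
  using real_instance_3[OF real_axiom.intros(17) _ _ s t u] by simp

lemma less_cotrans': "\<Gamma> \<turnstile> s \<^bold>< t \<^bold>\<longrightarrow> s \<^bold>< u \<^bold>\<or> u \<^bold>< t"
  using real_instance_3[OF real_axiom.intros(21) _ _ s t u] by simp

lemma radd_less': "\<Gamma> \<turnstile> s \<^bold>< t \<^bold>\<longrightarrow> s \<oplus> u \<^bold>< t \<oplus> u"
  using real_instance_3[OF real_axiom.intros(22) _ _ s t u] by simp

lemma less_rmax': "\<Gamma> \<turnstile> u \<^bold>< rmax s t \<^bold>\<longrightarrow> u \<^bold>< s \<^bold>\<or> u \<^bold>< t"
  using real_instance_3[OF real_axiom.intros(25) _ _ s t u] by simp

end

end

end

lemma rzero_mem: "\<Gamma> \<turnstile> \<zero> \<^bold>\<in> Real"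
  by (rule ax[OF real[OF real_axiom.intros(1)]])

lemma rone_mem: "\<Gamma> \<turnstile> \<one> \<^bold>\<in> Real"
  by (rule ax[OF real[OF real_axiom.intros(2)]])

lemmas real_mem = rzero_mem rone_mem rneg_mem radd_mem rmul_mem rmax_mem

text \<open>
  Order and equality bundled with membership in \<open>Real\<close>, so that they are transitive without side
  conditions.
\<close>

definition rless_in :: "fm set \<Rightarrow> tm \<Rightarrow> tm \<Rightarrow> bool" where
  "rless_in \<Gamma> s t \<longleftrightarrow> (\<Gamma> \<turnstile> s \<^bold>\<in> Real) \<and> (\<Gamma> \<turnstile> t \<^bold>\<in> Real) \<and> (\<Gamma> \<turnstile> s \<^bold>< t)"

definition rle_in :: "fm set \<Rightarrow> tm \<Rightarrow> tm \<Rightarrow> bool" where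
  "rle_in \<Gamma> s t \<longleftrightarrow> (\<Gamma> \<turnstile> s \<^bold>\<in> Real) \<and> (\<Gamma> \<turnstile> t \<^bold>\<in> Real) \<and> (\<Gamma> \<turnstile> s \<^bold>\<le> t)"

definition req_in :: "fm set \<Rightarrow> tm \<Rightarrow> tm \<Rightarrow> bool" where
  "req_in \<Gamma> s t \<longleftrightarrow> rle_in \<Gamma> s t \<and> rle_in \<Gamma> t s"

lemma req_in_iff:
  "req_in \<Gamma> s t \<longleftrightarrow> (\<Gamma> \<turnstile> s \<^bold>\<in> Real) \<and> (\<Gamma> \<turnstile> t \<^bold>\<in> Real) \<and> (\<Gamma> \<turnstile> s \<^bold>\<simeq> t)"
  unfolding req_in_def rle_in_def by (meson conj_E1 conj_E2 conj_I)

lemma rless_in_weaken: "rless_in \<Gamma> s t \<Longrightarrow> \<Gamma> \<subseteq> \<Delta> \<Longrightarrow> rless_in \<Delta> s t"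
  unfolding rless_in_def by (auto intro: weaken)

lemma rle_in_weaken: "rle_in \<Gamma> s t \<Longrightarrow> \<Gamma> \<subseteq> \<Delta> \<Longrightarrow> rle_in \<Delta> s t"
  unfolding rle_in_def by (auto intro: weaken)

lemma req_in_weaken: "req_in \<Gamma> s t \<Longrightarrow> \<Gamma> \<subseteq> \<Delta> \<Longrightarrow> req_in \<Delta> s t"
  unfolding req_in_def by (auto intro: rle_in_weaken)

section \<open>Order laws derived from asymmetry and cotransitivity\<close>

lemma rle_I:
  assumes "\<Gamma> \<turnstile> s \<^bold>\<in> Real" "\<Gamma> \<turnstile> t \<^bold>\<in> Real"
    and "\<And>\<Delta>. \<Gamma> \<subseteq> \<Delta> \<Longrightarrow> rless_in \<Delta> t s \<Longrightarrow> \<Delta> \<turnstile> \<^bold>\<bottom>"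
  shows "rle_in \<Gamma> s t"
  using assms unfolding rle_in_def rless_in_def by (auto intro!: imp_cases intro: weaken)

lemma rle_less_false: "rle_in \<Gamma> s t \<Longrightarrow> rless_in \<Gamma> t s \<Longrightarrow> \<Gamma> \<turnstile> \<^bold>\<bottom>"
  unfolding rle_in_def rless_in_def by (auto intro: imp_E)

lemma rless_asym: "rless_in \<Gamma> s t \<Longrightarrow> rless_in \<Gamma> t s \<Longrightarrow> \<Gamma> \<turnstile> \<phi>"
  unfolding rless_in_def by (meson conj_I falsum_E imp_E less_asym')

text \<open>The constructive substitute for trichotomy: comparison with a gap \<open>s < t\<close>
  instead of comparison with a point.\<close>

lemma rless_cotrans:
  assumes "rless_in \<Gamma> s t" "\<Gamma> \<turnstile> u \<^bold>\<in> Real"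
    and "\<And>\<Delta>. \<Gamma> \<subseteq> \<Delta> \<Longrightarrow> rless_in \<Delta> s u \<Longrightarrow> \<Delta> \<turnstile> \<phi>"
    and "\<And>\<Delta>. \<Gamma> \<subseteq> \<Delta> \<Longrightarrow> rless_in \<Delta> u t \<Longrightarrow> \<Delta> \<turnstile> \<phi>"
  shows "\<Gamma> \<turnstile> \<phi>"
proof -
  have "\<Gamma> \<turnstile> s \<^bold>< u \<^bold>\<or> u \<^bold>< t"
    using assms(1,2) unfolding rless_in_def by (meson imp_E less_cotrans')
  then show ?thesis
  proof (rule disj_cases)
    fix \<Delta> assume "\<Gamma> \<subseteq> \<Delta>" "\<Delta> \<turnstile> s \<^bold>< u"
    then show "\<Delta> \<turnstile> \<phi>"
      using assms(1,2) by (intro assms(3)) (auto simp: rless_in_def intro: weaken)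
  next
    fix \<Delta> assume "\<Gamma> \<subseteq> \<Delta>" "\<Delta> \<turnstile> u \<^bold>< t"
    then show "\<Delta> \<turnstile> \<phi>"
      using assms(1,2) by (intro assms(4)) (auto simp: rless_in_def intro: weaken)
  qed
qed

lemma rless_imp_rle:
  assumes "rless_in \<Gamma> s t"
  shows "rle_in \<Gamma> s t"
proof (rule rle_I)
  fix \<Delta> assume "\<Gamma> \<subseteq> \<Delta>" "rless_in \<Delta> t s"
  then show "\<Delta> \<turnstile> \<^bold>\<bottom>"
    using assms rless_asym rless_in_weaken by blast
qed (use assms in \<open>simp_all add: rless_in_def\<close>)

text \<open>Place \<open>u\<close> relative to the gap \<open>s < t\<close>: the case
  \<open>u < t\<close> contradicts the second hypothesis, the other case is the goal. Transitivity
  is not among the axioms and is obtained in this way.\<close>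

lemma rless_rle_trans [trans]:
  assumes "rless_in \<Gamma> s t" "rle_in \<Gamma> t u"
  shows "rless_in \<Gamma> s u"
proof -
  have mem: "\<Gamma> \<turnstile> s \<^bold>\<in> Real" "\<Gamma> \<turnstile> u \<^bold>\<in> Real"
    using assms by (simp_all add: rless_in_def rle_in_def)
  have "\<Gamma> \<turnstile> s \<^bold>< u"
    using assms(1) mem(2)
  proof (rule rless_cotrans)
    fix \<Delta> assume "\<Gamma> \<subseteq> \<Delta>" "rless_in \<Delta> u t"
    then show "\<Delta> \<turnstile> s \<^bold>< u"
      using rle_less_false[OF rle_in_weaken[OF assms(2)]] falsum_E by blast
  qed (simp add: rless_in_def)
  then show ?thesis
    using mem by (simp add: rless_in_def)
qed

lemma rle_rless_trans [trans]:
  assumes "rle_in \<Gamma> s t" "rless_in \<Gamma> t u"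
  shows "rless_in \<Gamma> s u"
proof -
  have mem: "\<Gamma> \<turnstile> s \<^bold>\<in> Real" "\<Gamma> \<turnstile> u \<^bold>\<in> Real"
    using assms by (simp_all add: rless_in_def rle_in_def)
  have "\<Gamma> \<turnstile> s \<^bold>< u"
    using assms(2) mem(1)
  proof (rule rless_cotrans)
    fix \<Delta> assume "\<Gamma> \<subseteq> \<Delta>" "rless_in \<Delta> t s"
    then show "\<Delta> \<turnstile> s \<^bold>< u"
      using rle_less_false[OF rle_in_weaken[OF assms(1)]] falsum_E by blast
  qed (simp add: rless_in_def)
  then show ?thesis
    using mem by (simp add: rless_in_def)
qed

lemma rless_trans [trans]: "rless_in \<Gamma> s t \<Longrightarrow> rless_in \<Gamma> t u \<Longrightarrow> rless_in \<Gamma> s u"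
  using rless_rle_trans rless_imp_rle by blast

lemma rle_trans [trans]:
  assumes "rle_in \<Gamma> s t" "rle_in \<Gamma> t u"
  shows "rle_in \<Gamma> s u"
proof (rule rle_I)
  fix \<Delta> assume \<Delta>: "\<Gamma> \<subseteq> \<Delta>" and "rless_in \<Delta> u s"
  then have "rless_in \<Delta> u t"
    using rless_rle_trans rle_in_weaken assms(1) by blast
  then show "\<Delta> \<turnstile> \<^bold>\<bottom>"
    using rle_less_false rle_in_weaken assms(2) \<Delta> by blast
qed (use assms in \<open>auto simp: rle_in_def\<close>)

lemma rle_refl: "\<Gamma> \<turnstile> s \<^bold>\<in> Real \<Longrightarrow> rle_in \<Gamma> s s"
  by (rule rle_I) (blast intro: rless_asym)+

lemma req_refl: "\<Gamma> \<turnstile> s \<^bold>\<in> Real \<Longrightarrow> req_in \<Gamma> s s"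
  by (simp add: req_in_def rle_refl)

lemma req_sym: "req_in \<Gamma> s t \<Longrightarrow> req_in \<Gamma> t s"
  by (simp add: req_in_def)

lemma req_trans [trans]: "req_in \<Gamma> s t \<Longrightarrow> req_in \<Gamma> t u \<Longrightarrow> req_in \<Gamma> s u"
  using rle_trans by (auto simp: req_in_def)

lemma req_rle_trans [trans]: "req_in \<Gamma> s t \<Longrightarrow> rle_in \<Gamma> t u \<Longrightarrow> rle_in \<Gamma> s u"
  using rle_trans by (auto simp: req_in_def)

lemma rle_req_trans [trans]: "rle_in \<Gamma> s t \<Longrightarrow> req_in \<Gamma> t u \<Longrightarrow> rle_in \<Gamma> s u"
  using rle_trans by (auto simp: req_in_def)

lemma req_rless_trans [trans]: "req_in \<Gamma> s t \<Longrightarrow> rless_in \<Gamma> t u \<Longrightarrow> rless_in \<Gamma> s u"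
  using rle_rless_trans by (auto simp: req_in_def)

lemma rless_req_trans [trans]: "rless_in \<Gamma> s t \<Longrightarrow> req_in \<Gamma> t u \<Longrightarrow> rless_in \<Gamma> s u"
  using rless_rle_trans by (auto simp: req_in_def)

text \<open>The bridge from computation to arithmetic: identities of terms obtained by reduction
  become real equalities, and membership in \<open>Real\<close> passes from the reduct back to the
  original term.\<close>

lemma eq_req:
  assumes "\<Gamma> \<turnstile> s \<^bold>= t" "\<Gamma> \<turnstile> t \<^bold>\<in> Real"
  shows "req_in \<Gamma> s t"
proof -
  obtain x where x: "x \<notin> fv_tm t"
    using fresh_name[of "fv_tm t"] by auto
  have "\<Gamma> \<turnstile> t \<^bold>\<simeq> t"
    using req_refl[OF assms(2)] by (simp add: req_in_iff)
  then have "\<Gamma> \<turnstile> s \<^bold>\<simeq> t"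
    using eq_subst[OF eq_sym[OF assms(1)], of x "V x \<^bold>\<simeq> t"] x by simp
  then show ?thesis
    using assms eq_mem[OF assms] by (simp add: req_in_iff)
qed

section \<open>Ring arithmetic and its compatibility with the order\<close>

lemma radd_cong_left: "req_in \<Gamma> s t \<Longrightarrow> \<Gamma> \<turnstile> u \<^bold>\<in> Real \<Longrightarrow> req_in \<Gamma> (s \<oplus> u) (t \<oplus> u)"
  unfolding req_in_iff by (meson imp_E radd_cong' radd_mem)

lemma rmul_cong_left: "req_in \<Gamma> s t \<Longrightarrow> \<Gamma> \<turnstile> u \<^bold>\<in> Real \<Longrightarrow> req_in \<Gamma> (s \<otimes> u) (t \<otimes> u)"
  unfolding req_in_iff by (meson imp_E rmul_cong' rmul_mem)

lemma rneg_cong: "req_in \<Gamma> s t \<Longrightarrow> req_in \<Gamma> (\<ominus> s) (\<ominus> t)"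
  unfolding req_in_iff by (meson imp_E rneg_cong' rneg_mem)

lemma radd_comm_in: "\<Gamma> \<turnstile> s \<^bold>\<in> Real \<Longrightarrow> \<Gamma> \<turnstile> t \<^bold>\<in> Real \<Longrightarrow> req_in \<Gamma> (s \<oplus> t) (t \<oplus> s)"
  unfolding req_in_iff by (simp add: radd_comm radd_mem)

lemma rmul_comm_in: "\<Gamma> \<turnstile> s \<^bold>\<in> Real \<Longrightarrow> \<Gamma> \<turnstile> t \<^bold>\<in> Real \<Longrightarrow> req_in \<Gamma> (s \<otimes> t) (t \<otimes> s)"
  unfolding req_in_iff by (simp add: rmul_comm rmul_mem)

lemma radd_assoc_in:
  "\<Gamma> \<turnstile> s \<^bold>\<in> Real \<Longrightarrow> \<Gamma> \<turnstile> t \<^bold>\<in> Real \<Longrightarrow> \<Gamma> \<turnstile> u \<^bold>\<in> Real \<Longrightarrow>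
    req_in \<Gamma> (s \<oplus> t \<oplus> u) (s \<oplus> (t \<oplus> u))"
  unfolding req_in_iff by (simp add: radd_assoc radd_mem)

lemma radd_zero_in: "\<Gamma> \<turnstile> s \<^bold>\<in> Real \<Longrightarrow> req_in \<Gamma> (s \<oplus> \<zero>) s"
  unfolding req_in_iff by (simp add: radd_zero real_mem)

lemma radd_neg_in: "\<Gamma> \<turnstile> s \<^bold>\<in> Real \<Longrightarrow> req_in \<Gamma> (s \<oplus> \<ominus> s) \<zero>"
  unfolding req_in_iff by (simp add: radd_neg real_mem)

lemma rmul_one_in: "\<Gamma> \<turnstile> s \<^bold>\<in> Real \<Longrightarrow> req_in \<Gamma> (s \<otimes> \<one>) s"
  unfolding req_in_iff by (simp add: rmul_one real_mem)

lemma rmul_assoc_in: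
  "\<Gamma> \<turnstile> s \<^bold>\<in> Real \<Longrightarrow> \<Gamma> \<turnstile> t \<^bold>\<in> Real \<Longrightarrow> \<Gamma> \<turnstile> u \<^bold>\<in> Real \<Longrightarrow>
    req_in \<Gamma> (s \<otimes> t \<otimes> u) (s \<otimes> (t \<otimes> u))"
  unfolding req_in_iff by (simp add: rmul_assoc rmul_mem)

lemma rmul_add_in:
  "\<Gamma> \<turnstile> s \<^bold>\<in> Real \<Longrightarrow> \<Gamma> \<turnstile> t \<^bold>\<in> Real \<Longrightarrow> \<Gamma> \<turnstile> u \<^bold>\<in> Real \<Longrightarrow>
    req_in \<Gamma> (s \<otimes> (t \<oplus> u)) (s \<otimes> t \<oplus> s \<otimes> u)"
  unfolding req_in_iff by (simp add: rmul_add real_mem)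

lemma req_memD: "req_in \<Gamma> s t \<Longrightarrow> \<Gamma> \<turnstile> s \<^bold>\<in> Real" "req_in \<Gamma> s t \<Longrightarrow> \<Gamma> \<turnstile> t \<^bold>\<in> Real"
  by (simp_all add: req_in_iff)

text \<open>The axiom replaces only the left argument; commutativity brings the right one into that
  position.\<close>

lemma radd_cong:
  assumes "req_in \<Gamma> s s'" "req_in \<Gamma> t t'"
  shows "req_in \<Gamma> (s \<oplus> t) (s' \<oplus> t')"
proof -
  note mem = req_memD[OF assms(1)] req_memD[OF assms(2)]
  have "req_in \<Gamma> (s \<oplus> t) (s' \<oplus> t)"
    using assms(1) mem(3) by (rule radd_cong_left)
  also have "req_in \<Gamma> \<dots> (t \<oplus> s')"
    by (intro radd_comm_in mem)
  also have "req_in \<Gamma> \<dots> (t' \<oplus> s')"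
    using assms(2) mem(2) by (rule radd_cong_left)
  also have "req_in \<Gamma> \<dots> (s' \<oplus> t')"
    by (intro radd_comm_in mem)
  finally show ?thesis .
qed

lemma rmul_cong:
  assumes "req_in \<Gamma> s s'" "req_in \<Gamma> t t'"
  shows "req_in \<Gamma> (s \<otimes> t) (s' \<otimes> t')"
proof -
  note mem = req_memD[OF assms(1)] req_memD[OF assms(2)]
  have "req_in \<Gamma> (s \<otimes> t) (s' \<otimes> t)"
    using assms(1) mem(3) by (rule rmul_cong_left)
  also have "req_in \<Gamma> \<dots> (t \<otimes> s')"
    by (intro rmul_comm_in mem)
  also have "req_in \<Gamma> \<dots> (t' \<otimes> s')"
    using assms(2) mem(2) by (rule rmul_cong_left)
  also have "req_in \<Gamma> \<dots> (s' \<otimes> t')"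
    by (intro rmul_comm_in mem)
  finally show ?thesis .
qed

lemma radd_less_left: "rless_in \<Gamma> s t \<Longrightarrow> \<Gamma> \<turnstile> u \<^bold>\<in> Real \<Longrightarrow> rless_in \<Gamma> (s \<oplus> u) (t \<oplus> u)"
  unfolding rless_in_def by (meson imp_E radd_less' radd_mem)

lemma rmul_pos: "rless_in \<Gamma> \<zero> s \<Longrightarrow> rless_in \<Gamma> \<zero> t \<Longrightarrow> rless_in \<Gamma> \<zero> (s \<otimes> t)"
  unfolding rless_in_def by (meson imp_E rmul_pos' conj_I rmul_mem)

lemma radd_neg_cancel:
  assumes "\<Gamma> \<turnstile> s \<^bold>\<in> Real" "\<Gamma> \<turnstile> t \<^bold>\<in> Real"
  shows "req_in \<Gamma> (s \<oplus> t \<oplus> \<ominus> t) s"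
proof -
  have "req_in \<Gamma> (s \<oplus> t \<oplus> \<ominus> t) (s \<oplus> (t \<oplus> \<ominus> t))"
    by (intro radd_assoc_in assms real_mem)
  also have "req_in \<Gamma> \<dots> (s \<oplus> \<zero>)"
    by (intro radd_cong req_refl radd_neg_in assms)
  also have "req_in \<Gamma> \<dots> s"
    by (intro radd_zero_in assms)
  finally show ?thesis .
qed

lemma radd_less_cancel:
  assumes "rless_in \<Gamma> (s \<oplus> u) (t \<oplus> u)" "\<Gamma> \<turnstile> s \<^bold>\<in> Real" "\<Gamma> \<turnstile> t \<^bold>\<in> Real" "\<Gamma> \<turnstile> u \<^bold>\<in> Real"
  shows "rless_in \<Gamma> s t"
proof -
  have "req_in \<Gamma> s (s \<oplus> u \<oplus> \<ominus> u)"
    by (intro req_sym[OF radd_neg_cancel] assms)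
  also have "rless_in \<Gamma> \<dots> (t \<oplus> u \<oplus> \<ominus> u)"
    by (intro radd_less_left assms real_mem)
  also have "req_in \<Gamma> \<dots> t"
    by (intro radd_neg_cancel assms)
  finally show ?thesis .
qed

lemma radd_le_left:
  assumes "rle_in \<Gamma> s t" "\<Gamma> \<turnstile> u \<^bold>\<in> Real"
  shows "rle_in \<Gamma> (s \<oplus> u) (t \<oplus> u)"
proof (rule rle_I)
  have mem: "\<Gamma> \<turnstile> s \<^bold>\<in> Real" "\<Gamma> \<turnstile> t \<^bold>\<in> Real"
    using assms by (simp_all add: rle_in_def)
  then show "\<Gamma> \<turnstile> s \<oplus> u \<^bold>\<in> Real" "\<Gamma> \<turnstile> t \<oplus> u \<^bold>\<in> Real"
    using assms by (simp_all add: real_mem)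
  fix \<Delta> assume \<Delta>: "\<Gamma> \<subseteq> \<Delta>" and "rless_in \<Delta> (t \<oplus> u) (s \<oplus> u)"
  then have "rless_in \<Delta> t s"
    using assms mem by (blast intro: radd_less_cancel weaken)
  then show "\<Delta> \<turnstile> \<^bold>\<bottom>"
    using rle_less_false rle_in_weaken[OF assms(1) \<Delta>] by blast
qed

lemma radd_le_mono:
  assumes "rle_in \<Gamma> s s'" "rle_in \<Gamma> t t'"
  shows "rle_in \<Gamma> (s \<oplus> t) (s' \<oplus> t')"
proof -
  have mem: "\<Gamma> \<turnstile> s \<^bold>\<in> Real" "\<Gamma> \<turnstile> s' \<^bold>\<in> Real" "\<Gamma> \<turnstile> t \<^bold>\<in> Real" "\<Gamma> \<turnstile> t' \<^bold>\<in> Real"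
    using assms by (simp_all add: rle_in_def)
  have "rle_in \<Gamma> (s \<oplus> t) (s' \<oplus> t)"
    using assms(1) mem(3) by (rule radd_le_left)
  also have "req_in \<Gamma> \<dots> (t \<oplus> s')"
    by (intro radd_comm_in mem)
  also have "rle_in \<Gamma> \<dots> (t' \<oplus> s')"
    using assms(2) mem(2) by (rule radd_le_left)
  also have "req_in \<Gamma> \<dots> (s' \<oplus> t')"
    by (intro radd_comm_in mem)
  finally show ?thesis .
qed

lemma radd_zero_left:
  assumes "\<Gamma> \<turnstile> s \<^bold>\<in> Real"
  shows "req_in \<Gamma> (\<zero> \<oplus> s) s"
  by (rule req_trans[OF radd_comm_in radd_zero_in]) (intro assms real_mem)+

lemma radd_swap:
  assumes "\<Gamma> \<turnstile> s \<^bold>\<in> Real" "\<Gamma> \<turnstile> t \<^bold>\<in> Real" "\<Gamma> \<turnstile> u \<^bold>\<in> Real" "\<Gamma> \<turnstile> v \<^bold>\<in> Real"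
  shows "req_in \<Gamma> (s \<oplus> t \<oplus> (u \<oplus> v)) (s \<oplus> u \<oplus> (t \<oplus> v))"
proof -
  have "req_in \<Gamma> (s \<oplus> t \<oplus> (u \<oplus> v)) (s \<oplus> (t \<oplus> (u \<oplus> v)))"
    by (intro radd_assoc_in assms real_mem)
  also have "req_in \<Gamma> \<dots> (s \<oplus> (t \<oplus> u \<oplus> v))"
    by (intro radd_cong req_refl req_sym[OF radd_assoc_in] assms)
  also have "req_in \<Gamma> \<dots> (s \<oplus> (u \<oplus> t \<oplus> v))"
    by (intro radd_cong req_refl radd_comm_in assms)
  also have "req_in \<Gamma> \<dots> (s \<oplus> (u \<oplus> (t \<oplus> v)))"
    by (intro radd_cong req_refl radd_assoc_in assms)
  also have "req_in \<Gamma> \<dots> (s \<oplus> u \<oplus> (t \<oplus> v))"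
    by (intro req_sym[OF radd_assoc_in] assms real_mem)
  finally show ?thesis .
qed

text \<open>The source of the sign rules below: a term is recognised as a negation by computing a
  single sum.\<close>

lemma rneg_unique:
  assumes "req_in \<Gamma> (s \<oplus> t) \<zero>" "\<Gamma> \<turnstile> s \<^bold>\<in> Real" "\<Gamma> \<turnstile> t \<^bold>\<in> Real"
  shows "req_in \<Gamma> s (\<ominus> t)"
proof -
  have "req_in \<Gamma> s (s \<oplus> t \<oplus> \<ominus> t)"
    by (intro req_sym[OF radd_neg_cancel] assms)
  also have "req_in \<Gamma> \<dots> (\<zero> \<oplus> \<ominus> t)"
    by (intro radd_cong req_refl assms real_mem)
  also have "req_in \<Gamma> \<dots> (\<ominus> t)"
    by (intro radd_zero_left assms real_mem)
  finally show ?thesis .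
qed

lemma rneg_neg:
  assumes "\<Gamma> \<turnstile> s \<^bold>\<in> Real"
  shows "req_in \<Gamma> (\<ominus> (\<ominus> s)) s"
  by (intro req_sym[OF rneg_unique] radd_neg_in assms real_mem)

lemma rneg_zero: "req_in \<Gamma> (\<ominus> \<zero>) \<zero>"
  by (intro req_sym[OF rneg_unique] radd_zero_in real_mem)

lemma rneg_add:
  assumes "\<Gamma> \<turnstile> s \<^bold>\<in> Real" "\<Gamma> \<turnstile> t \<^bold>\<in> Real"
  shows "req_in \<Gamma> (\<ominus> (s \<oplus> t)) (\<ominus> s \<oplus> \<ominus> t)"
proof (rule req_sym[OF rneg_unique])
  have "req_in \<Gamma> (\<ominus> s \<oplus> \<ominus> t \<oplus> (s \<oplus> t)) (s \<oplus> t \<oplus> (\<ominus> s \<oplus> \<ominus> t))"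
    by (intro radd_comm_in assms real_mem)
  also have "req_in \<Gamma> \<dots> (s \<oplus> \<ominus> s \<oplus> (t \<oplus> \<ominus> t))"
    by (intro radd_swap assms real_mem)
  also have "req_in \<Gamma> \<dots> (\<zero> \<oplus> \<zero>)"
    by (intro radd_cong radd_neg_in assms)
  also have "req_in \<Gamma> \<dots> \<zero>"
    by (intro radd_zero_in real_mem)
  finally show "req_in \<Gamma> (\<ominus> s \<oplus> \<ominus> t \<oplus> (s \<oplus> t)) \<zero>" .
qed (intro assms real_mem)+

lemma rmul_zero:
  assumes "\<Gamma> \<turnstile> s \<^bold>\<in> Real"
  shows "req_in \<Gamma> (s \<otimes> \<zero>) \<zero>"
proof -
  have "req_in \<Gamma> (s \<otimes> \<zero>) (s \<otimes> \<zero> \<oplus> s \<otimes> \<zero> \<oplus> \<ominus> (s \<otimes> \<zero>))"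
    by (intro req_sym[OF radd_neg_cancel] assms real_mem)
  also have "req_in \<Gamma> \<dots> (s \<otimes> (\<zero> \<oplus> \<zero>) \<oplus> \<ominus> (s \<otimes> \<zero>))"
    by (intro radd_cong req_sym[OF rmul_add_in] req_refl assms real_mem)
  also have "req_in \<Gamma> \<dots> (s \<otimes> \<zero> \<oplus> \<ominus> (s \<otimes> \<zero>))"
    by (intro radd_cong rmul_cong radd_zero_in req_refl assms real_mem)
  also have "req_in \<Gamma> \<dots> \<zero>"
    by (intro radd_neg_in assms real_mem)
  finally show ?thesis .
qed

lemma rmul_neg:
  assumes "\<Gamma> \<turnstile> s \<^bold>\<in> Real" "\<Gamma> \<turnstile> t \<^bold>\<in> Real"
  shows "req_in \<Gamma> (s \<otimes> \<ominus> t) (\<ominus> (s \<otimes> t))"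
proof (rule rneg_unique)
  have "req_in \<Gamma> (s \<otimes> \<ominus> t \<oplus> s \<otimes> t) (s \<otimes> (\<ominus> t \<oplus> t))"
    by (intro req_sym[OF rmul_add_in] assms real_mem)
  also have "req_in \<Gamma> \<dots> (s \<otimes> \<zero>)"
    by (intro rmul_cong req_refl req_trans[OF radd_comm_in radd_neg_in] assms real_mem)
  also have "req_in \<Gamma> \<dots> \<zero>"
    by (intro rmul_zero assms)
  finally show "req_in \<Gamma> (s \<otimes> \<ominus> t \<oplus> s \<otimes> t) \<zero>" .
qed (intro assms real_mem)+

lemma rneg_mul:
  assumes "\<Gamma> \<turnstile> s \<^bold>\<in> Real" "\<Gamma> \<turnstile> t \<^bold>\<in> Real"
  shows "req_in \<Gamma> (\<ominus> s \<otimes> t) (\<ominus> (s \<otimes> t))"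
proof -
  have "req_in \<Gamma> (\<ominus> s \<otimes> t) (t \<otimes> \<ominus> s)"
    by (intro rmul_comm_in assms real_mem)
  also have "req_in \<Gamma> \<dots> (\<ominus> (t \<otimes> s))"
    by (intro rmul_neg assms)
  also have "req_in \<Gamma> \<dots> (\<ominus> (s \<otimes> t))"
    by (intro rneg_cong rmul_comm_in assms)
  finally show ?thesis .
qed

text \<open>Adding \<open>s \<oplus> t\<close> to both sides turns the claim into the
  hypothesis.\<close>

lemma rneg_less:
  assumes "rless_in \<Gamma> s t"
  shows "rless_in \<Gamma> (\<ominus> t) (\<ominus> s)"
proof (rule radd_less_cancel)
  have mem: "\<Gamma> \<turnstile> s \<^bold>\<in> Real" "\<Gamma> \<turnstile> t \<^bold>\<in> Real"
    using assms by (simp_all add: rless_in_def)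
  then show "\<Gamma> \<turnstile> \<ominus> t \<^bold>\<in> Real" "\<Gamma> \<turnstile> \<ominus> s \<^bold>\<in> Real" "\<Gamma> \<turnstile> s \<oplus> t \<^bold>\<in> Real"
    by (simp_all add: real_mem)
  have "req_in \<Gamma> (\<ominus> t \<oplus> (s \<oplus> t)) (s \<oplus> t \<oplus> \<ominus> t)"
    by (intro radd_comm_in mem real_mem)
  also have "req_in \<Gamma> \<dots> s"
    by (intro radd_neg_cancel mem)
  also note assms
  also have "req_in \<Gamma> t (t \<oplus> s \<oplus> \<ominus> s)"
    by (intro req_sym[OF radd_neg_cancel] mem)
  also have "req_in \<Gamma> \<dots> (\<ominus> s \<oplus> (t \<oplus> s))"
    by (intro radd_comm_in mem real_mem)
  also have "req_in \<Gamma> \<dots> (\<ominus> s \<oplus> (s \<oplus> t))"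
    by (intro radd_cong req_refl radd_comm_in mem real_mem)
  finally show "rless_in \<Gamma> (\<ominus> t \<oplus> (s \<oplus> t)) (\<ominus> s \<oplus> (s \<oplus> t))" .
qed

lemma rneg_le:
  assumes "rle_in \<Gamma> s t"
  shows "rle_in \<Gamma> (\<ominus> t) (\<ominus> s)"
proof (rule rle_I)
  have mem: "\<Gamma> \<turnstile> s \<^bold>\<in> Real" "\<Gamma> \<turnstile> t \<^bold>\<in> Real"
    using assms by (simp_all add: rle_in_def)
  then show "\<Gamma> \<turnstile> \<ominus> t \<^bold>\<in> Real" "\<Gamma> \<turnstile> \<ominus> s \<^bold>\<in> Real"
    by (simp_all add: real_mem)
  fix \<Delta> assume \<Delta>: "\<Gamma> \<subseteq> \<Delta>" and *: "rless_in \<Delta> (\<ominus> s) (\<ominus> t)"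
  have mem': "\<Delta> \<turnstile> s \<^bold>\<in> Real" "\<Delta> \<turnstile> t \<^bold>\<in> Real"
    using mem \<Delta> by (auto intro: weaken)
  have "req_in \<Delta> t (\<ominus> (\<ominus> t))"
    by (intro req_sym[OF rneg_neg] mem')
  also have "rless_in \<Delta> \<dots> (\<ominus> (\<ominus> s))"
    using * by (rule rneg_less)
  also have "req_in \<Delta> \<dots> s"
    by (intro rneg_neg mem')
  finally show "\<Delta> \<turnstile> \<^bold>\<bottom>"
    using rle_less_false rle_in_weaken[OF assms \<Delta>] by blast
qed

section \<open>Classical case distinctions for the goal falsum, and their consequences\<close>

text \<open>If \<open>s < t\<close> is refuted, its negation is \<open>t \<le> s\<close>, which
  together with the hypothesis is equality by definition.\<close>

lemma rle_cases_false:
  assumes "rle_in \<Gamma> s t"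
    and "\<And>\<Delta>. \<Gamma> \<subseteq> \<Delta> \<Longrightarrow> rless_in \<Delta> s t \<Longrightarrow> \<Delta> \<turnstile> \<^bold>\<bottom>"
    and "\<And>\<Delta>. \<Gamma> \<subseteq> \<Delta> \<Longrightarrow> req_in \<Delta> s t \<Longrightarrow> \<Delta> \<turnstile> \<^bold>\<bottom>"
  shows "\<Gamma> \<turnstile> \<^bold>\<bottom>"
proof (rule classical_cases)
  fix \<Delta> assume \<Delta>: "\<Gamma> \<subseteq> \<Delta>"
  then have le: "rle_in \<Delta> s t"
    using rle_in_weaken assms(1) by blast
  show "\<Delta> \<turnstile> \<^bold>\<bottom>" if "\<Delta> \<turnstile> s \<^bold>< t"
    using le that by (intro assms(2) \<Delta>) (simp add: rle_in_def rless_in_def)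
  show "\<Delta> \<turnstile> \<^bold>\<bottom>" if "\<Delta> \<turnstile> \<^bold>\<not> (s \<^bold>< t)"
    using le that by (intro assms(3) \<Delta>) (simp add: rle_in_def req_in_def)
qed

text \<open>Linearity of the order is not provable constructively, but for the goal falsum one may
  decide \<open>t < s\<close>, whose negation is by definition \<open>s \<le> t\<close>.\<close>

lemma rle_linear_false:
  assumes "\<Gamma> \<turnstile> s \<^bold>\<in> Real" "\<Gamma> \<turnstile> t \<^bold>\<in> Real"
    and "\<And>\<Delta>. \<Gamma> \<subseteq> \<Delta> \<Longrightarrow> rle_in \<Delta> s t \<Longrightarrow> \<Delta> \<turnstile> \<^bold>\<bottom>"
    and "\<And>\<Delta>. \<Gamma> \<subseteq> \<Delta> \<Longrightarrow> rle_in \<Delta> t s \<Longrightarrow> \<Delta> \<turnstile> \<^bold>\<bottom>"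
  shows "\<Gamma> \<turnstile> \<^bold>\<bottom>"
proof (rule classical_cases)
  fix \<Delta> assume \<Delta>: "\<Gamma> \<subseteq> \<Delta>"
  have mem: "\<Delta> \<turnstile> s \<^bold>\<in> Real" "\<Delta> \<turnstile> t \<^bold>\<in> Real"
    using assms(1,2) weaken[OF _ \<Delta>] by blast+
  show "\<Delta> \<turnstile> \<^bold>\<bottom>" if "\<Delta> \<turnstile> t \<^bold>< s"
    using mem that by (intro assms(4) \<Delta> rless_imp_rle) (simp add: rless_in_def)
  show "\<Delta> \<turnstile> \<^bold>\<bottom>" if "\<Delta> \<turnstile> \<^bold>\<not> (t \<^bold>< s)"
    using mem that by (intro assms(3) \<Delta>) (simp add: rle_in_def)
qed

text \<open>Equality is a pair of negated strict inequalities, so after assuming one of them the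
  goal is falsum and \<open>rle_linear_false\<close> applies.\<close>

lemma req_linear_cases:
  assumes "\<Gamma> \<turnstile> s \<^bold>\<in> Real" "\<Gamma> \<turnstile> t \<^bold>\<in> Real" "\<Gamma> \<turnstile> u \<^bold>\<in> Real" "\<Gamma> \<turnstile> v \<^bold>\<in> Real"
    and "\<And>\<Delta>. \<Gamma> \<subseteq> \<Delta> \<Longrightarrow> rle_in \<Delta> s t \<Longrightarrow> req_in \<Delta> u v"
    and "\<And>\<Delta>. \<Gamma> \<subseteq> \<Delta> \<Longrightarrow> rle_in \<Delta> t s \<Longrightarrow> req_in \<Delta> u v"
  shows "req_in \<Gamma> u v"
proof -
  have *: "\<Delta> \<turnstile> \<^bold>\<bottom>" if \<Delta>: "\<Gamma> \<subseteq> \<Delta>" and less: "rless_in \<Delta> u v \<or> rless_in \<Delta> v u" for \<Delta>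
  proof (rule rle_linear_false[of \<Delta> s t])
    have false: "\<Theta> \<turnstile> \<^bold>\<bottom>" if "\<Delta> \<subseteq> \<Theta>" "req_in \<Theta> u v" for \<Theta>
      using that less rless_in_weaken rle_less_false unfolding req_in_def by blast
    show "\<Theta> \<turnstile> \<^bold>\<bottom>" if "\<Delta> \<subseteq> \<Theta>" "rle_in \<Theta> s t" for \<Theta>
      using that \<Delta> by (intro false assms(5)) auto
    show "\<Theta> \<turnstile> \<^bold>\<bottom>" if "\<Delta> \<subseteq> \<Theta>" "rle_in \<Theta> t s" for \<Theta>
      using that \<Delta> by (intro false assms(6)) auto
  qed (use assms(1,2) weaken[OF _ \<Delta>] in blast)+
  have "rle_in \<Gamma> u v"
    by (rule rle_I[OF assms(3,4)]) (simp add: *)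
  moreover have "rle_in \<Gamma> v u"
    by (rule rle_I[OF assms(4,3)]) (simp add: *)
  ultimately show ?thesis
    by (simp add: req_in_def)
qed

lemma rle_memD: "rle_in \<Gamma> s t \<Longrightarrow> \<Gamma> \<turnstile> s \<^bold>\<in> Real" "rle_in \<Gamma> s t \<Longrightarrow> \<Gamma> \<turnstile> t \<^bold>\<in> Real"
  by (simp_all add: rle_in_def)

lemma rmul_zero_left:
  assumes "\<Gamma> \<turnstile> s \<^bold>\<in> Real"
  shows "req_in \<Gamma> (\<zero> \<otimes> s) \<zero>"
  by (rule req_trans[OF rmul_comm_in rmul_zero]) (intro assms real_mem)+

text \<open>The axiom covers positive factors only. As the claim is a negation, each factor may be
  taken to be positive or equal to zero; in the latter case the product vanishes.\<close>

lemma rmul_nonneg: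
  assumes "rle_in \<Gamma> \<zero> s" "rle_in \<Gamma> \<zero> t"
  shows "rle_in \<Gamma> \<zero> (s \<otimes> t)"
proof (rule rle_I)
  note mem = rle_memD[OF assms(1)] rle_memD[OF assms(2)]
  then show "\<Gamma> \<turnstile> \<zero> \<^bold>\<in> Real" "\<Gamma> \<turnstile> s \<otimes> t \<^bold>\<in> Real"
    by (simp_all add: real_mem)
  fix \<Delta> assume \<Delta>: "\<Gamma> \<subseteq> \<Delta>" and neg: "rless_in \<Delta> (s \<otimes> t) \<zero>"
  have nonneg: "rle_in \<Theta> \<zero> s" "rle_in \<Theta> \<zero> t" if "\<Delta> \<subseteq> \<Theta>" for \<Theta>
    using assms \<Delta> that by (meson rle_in_weaken)+
  note mem = rle_memD(2)[OF nonneg(1)] rle_memD(2)[OF nonneg(2)]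
  have *: "\<Theta> \<turnstile> \<^bold>\<bottom>" if "\<Delta> \<subseteq> \<Theta>" "rle_in \<Theta> \<zero> (s \<otimes> t)" for \<Theta>
    using that neg rle_less_false rless_in_weaken by blast
  show "\<Delta> \<turnstile> \<^bold>\<bottom>"
  proof (rule rle_cases_false[OF nonneg(1)[OF order_refl]])
    fix \<Delta>' assume \<Delta>': "\<Delta> \<subseteq> \<Delta>'" and s: "rless_in \<Delta>' \<zero> s"
    show "\<Delta>' \<turnstile> \<^bold>\<bottom>"
    proof (rule rle_cases_false[OF nonneg(2)[OF \<Delta>']])
      fix \<Theta> assume \<Theta>: "\<Delta>' \<subseteq> \<Theta>" and t: "rless_in \<Theta> \<zero> t"
      show "\<Theta> \<turnstile> \<^bold>\<bottom>"
        using \<Delta>' \<Theta> t rless_in_weaken[OF s \<Theta>] by (intro * rless_imp_rle rmul_pos) auto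
    next
      fix \<Theta> assume \<Theta>: "\<Delta>' \<subseteq> \<Theta>" and t: "req_in \<Theta> \<zero> t"
      have sub: "\<Delta> \<subseteq> \<Theta>"
        using \<Delta>' \<Theta> by simp
      have "req_in \<Theta> \<zero> (s \<otimes> \<zero>)"
        by (intro req_sym[OF rmul_zero] mem sub)
      also have "req_in \<Theta> \<dots> (s \<otimes> t)"
        by (intro rmul_cong req_refl t mem sub)
      finally show "\<Theta> \<turnstile> \<^bold>\<bottom>"
        using *[OF sub] by (simp add: req_in_def)
    qed
  next
    fix \<Theta> assume \<Theta>: "\<Delta> \<subseteq> \<Theta>" and s: "req_in \<Theta> \<zero> s"
    have "req_in \<Theta> \<zero> (\<zero> \<otimes> t)"
      by (intro req_sym[OF rmul_zero_left] mem \<Theta>)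
    also have "req_in \<Theta> \<dots> (s \<otimes> t)"
      by (intro rmul_cong req_refl s mem \<Theta>)
    finally show "\<Theta> \<turnstile> \<^bold>\<bottom>"
      using *[OF \<Theta>] by (simp add: req_in_def)
  qed
qed

section \<open>Maximum and absolute value\<close>

lemma rle_rmax1: "\<Gamma> \<turnstile> s \<^bold>\<in> Real \<Longrightarrow> \<Gamma> \<turnstile> t \<^bold>\<in> Real \<Longrightarrow> rle_in \<Gamma> s (rmax s t)"
  unfolding rle_in_def by (auto intro: real_mem conj_E1[OF le_rmax'])

lemma rle_rmax2: "\<Gamma> \<turnstile> s \<^bold>\<in> Real \<Longrightarrow> \<Gamma> \<turnstile> t \<^bold>\<in> Real \<Longrightarrow> rle_in \<Gamma> t (rmax s t)"
  unfolding rle_in_def by (auto intro: real_mem conj_E2[OF le_rmax'])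

text \<open>Anything strictly below a maximum is below one of its arguments, and here both
  alternatives contradict a hypothesis.\<close>

lemma rmax_least:
  assumes "rle_in \<Gamma> s u" "rle_in \<Gamma> t u"
  shows "rle_in \<Gamma> (rmax s t) u"
proof (rule rle_I)
  note mem = rle_memD[OF assms(1)] rle_memD[OF assms(2)]
  then show "\<Gamma> \<turnstile> rmax s t \<^bold>\<in> Real" "\<Gamma> \<turnstile> u \<^bold>\<in> Real"
    by (simp_all add: real_mem)
  fix \<Delta> assume \<Delta>: "\<Gamma> \<subseteq> \<Delta>" and less: "rless_in \<Delta> u (rmax s t)"
  have mem': "\<Delta> \<turnstile> s \<^bold>\<in> Real" "\<Delta> \<turnstile> t \<^bold>\<in> Real" "\<Delta> \<turnstile> u \<^bold>\<in> Real"
    using mem weaken[OF _ \<Delta>] by blast+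
  have "\<Delta> \<turnstile> u \<^bold>< s \<^bold>\<or> u \<^bold>< t"
    using less_rmax'[OF mem'] less by (auto simp: rless_in_def intro: imp_E)
  then show "\<Delta> \<turnstile> \<^bold>\<bottom>"
  proof (rule disj_cases)
    fix \<Theta> assume \<Theta>: "\<Delta> \<subseteq> \<Theta>"
    then have le: "rle_in \<Theta> s u" "rle_in \<Theta> t u"
      using assms \<Delta> by (meson rle_in_weaken)+
    show "\<Theta> \<turnstile> \<^bold>\<bottom>" if "\<Theta> \<turnstile> u \<^bold>< s"
      using rle_less_false[OF le(1)] rle_memD[OF le(1)] that by (simp add: rless_in_def)
    show "\<Theta> \<turnstile> \<^bold>\<bottom>" if "\<Theta> \<turnstile> u \<^bold>< t"
      using rle_less_false[OF le(2)] rle_memD[OF le(2)] that by (simp add: rless_in_def)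
  qed
qed

lemma rabs_mem: "\<Gamma> \<turnstile> s \<^bold>\<in> Real \<Longrightarrow> \<Gamma> \<turnstile> rabs s \<^bold>\<in> Real"
  by (simp add: real_mem)

lemma rle_rabs: "\<Gamma> \<turnstile> s \<^bold>\<in> Real \<Longrightarrow> rle_in \<Gamma> s (rabs s)"
  by (intro rle_rmax1 real_mem)

lemma rneg_le_rabs: "\<Gamma> \<turnstile> s \<^bold>\<in> Real \<Longrightarrow> rle_in \<Gamma> (\<ominus> s) (rabs s)"
  by (intro rle_rmax2 real_mem)

lemma rabs_of_nonneg:
  assumes "rle_in \<Gamma> \<zero> s"
  shows "req_in \<Gamma> (rabs s) s"
proof -
  note mem = rle_memD(2)[OF assms]
  have "rle_in \<Gamma> (\<ominus> s) (\<ominus> \<zero>)"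
    using assms by (rule rneg_le)
  also have "req_in \<Gamma> \<dots> \<zero>"
    by (rule rneg_zero)
  also note assms
  finally show ?thesis
    using mem by (simp add: req_in_def rmax_least rle_refl rle_rabs)
qed

lemma rabs_neg:
  assumes "\<Gamma> \<turnstile> s \<^bold>\<in> Real"
  shows "req_in \<Gamma> (rabs (\<ominus> s)) (rabs s)"
proof -
  have "rle_in \<Gamma> (\<ominus> (\<ominus> s)) (rabs s)"
    by (rule req_rle_trans[OF rneg_neg rle_rabs]) fact+
  moreover have "rle_in \<Gamma> s (rabs (\<ominus> s))"
    by (rule req_rle_trans[OF req_sym[OF rneg_neg] rneg_le_rabs]) (intro assms real_mem)+
  ultimately show ?thesis
    using assms by (simp add: req_in_def rmax_least rneg_le_rabs rle_rabs real_mem)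
qed

text \<open>The sign of \<open>s\<close> stays undecided: if \<open>rabs s\<close> were negative, so
  would be \<open>s\<close>, whence \<open>\<ominus> s\<close> is positive although it is at most
  \<open>rabs s\<close>.\<close>

lemma rabs_nonneg:
  assumes "\<Gamma> \<turnstile> s \<^bold>\<in> Real"
  shows "rle_in \<Gamma> \<zero> (rabs s)"
proof (rule rle_I)
  fix \<Delta> assume \<Delta>: "\<Gamma> \<subseteq> \<Delta>" and less: "rless_in \<Delta> (rabs s) \<zero>"
  have mem: "\<Delta> \<turnstile> s \<^bold>\<in> Real"
    using assms \<Delta> by (rule weaken)
  have "req_in \<Delta> \<zero> (\<ominus> \<zero>)"
    by (rule req_sym[OF rneg_zero])
  also have "rless_in \<Delta> \<dots> (\<ominus> s)"
    using rle_rabs[OF mem] less by (intro rneg_less) (rule rle_rless_trans)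
  also have "rle_in \<Delta> \<dots> (rabs s)"
    using mem by (rule rneg_le_rabs)
  also note less
  finally show "\<Delta> \<turnstile> \<^bold>\<bottom>"
    using rless_asym by blast
qed (intro assms rabs_mem real_mem)+

lemma rabs_cong:
  assumes "req_in \<Gamma> s t"
  shows "req_in \<Gamma> (rabs s) (rabs t)"
proof -
  have *: "rle_in \<Gamma> (rabs s) (rabs t)" if st: "req_in \<Gamma> s t" for s t
    by (intro rmax_least req_rle_trans[OF st rle_rabs] req_rle_trans[OF rneg_cong[OF st] rneg_le_rabs]
        req_memD[OF st])
  then show ?thesis
    using *[OF assms] *[OF req_sym[OF assms]] by (simp add: req_in_def)
qed

lemma rabs_triangle:
  assumes "\<Gamma> \<turnstile> s \<^bold>\<in> Real" "\<Gamma> \<turnstile> t \<^bold>\<in> Real"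
  shows "rle_in \<Gamma> (rabs (s \<oplus> t)) (rabs s \<oplus> rabs t)"
  by (intro rmax_least radd_le_mono rle_rabs req_rle_trans[OF rneg_add] rneg_le_rabs assms)

lemma rabs_mul_nonneg:
  assumes "rle_in \<Gamma> \<zero> s" "rle_in \<Gamma> \<zero> t"
  shows "req_in \<Gamma> (rabs (s \<otimes> t)) (rabs s \<otimes> rabs t)"
  by (intro req_trans[OF rabs_of_nonneg] rmul_nonneg rmul_cong req_sym[OF rabs_of_nonneg] assms)

lemma rneg_nonneg: "rle_in \<Gamma> s \<zero> \<Longrightarrow> rle_in \<Gamma> \<zero> (\<ominus> s)"
  using req_rle_trans[OF req_sym[OF rneg_zero] rneg_le] .

text \<open>First of two sign reductions: a nonpositive \<open>t\<close> is replaced by its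
  negation, which changes neither absolute value. \<open>rabs_mul\<close> then treats
  \<open>s\<close> in the same way.\<close>

lemma rabs_mul_nonneg_left:
  assumes "rle_in \<Gamma> \<zero> s" "\<Gamma> \<turnstile> t \<^bold>\<in> Real"
  shows "req_in \<Gamma> (rabs (s \<otimes> t)) (rabs s \<otimes> rabs t)"
proof (rule req_linear_cases[of \<Gamma> \<zero> t])
  show "\<Gamma> \<turnstile> rabs (s \<otimes> t) \<^bold>\<in> Real" "\<Gamma> \<turnstile> rabs s \<otimes> rabs t \<^bold>\<in> Real" "\<Gamma> \<turnstile> \<zero> \<^bold>\<in> Real"
    by (intro real_mem assms rle_memD(2)[OF assms(1)])+
  fix \<Delta> assume \<Delta>: "\<Gamma> \<subseteq> \<Delta>"
  have s: "rle_in \<Delta> \<zero> s" and t: "\<Delta> \<turnstile> t \<^bold>\<in> Real"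
    using assms rle_in_weaken weaken \<Delta> by blast+
  note mem = rle_memD(2)[OF s] t
  show "req_in \<Delta> (rabs (s \<otimes> t)) (rabs s \<otimes> rabs t)" if "rle_in \<Delta> \<zero> t"
    using s that by (rule rabs_mul_nonneg)
  show "req_in \<Delta> (rabs (s \<otimes> t)) (rabs s \<otimes> rabs t)" if "rle_in \<Delta> t \<zero>"
  proof -
    have "req_in \<Delta> (rabs (s \<otimes> t)) (rabs (\<ominus> (s \<otimes> t)))"
      by (intro req_sym[OF rabs_neg] mem real_mem)
    also have "req_in \<Delta> \<dots> (rabs (s \<otimes> \<ominus> t))"
      by (intro rabs_cong req_sym[OF rmul_neg] mem)
    also have "req_in \<Delta> \<dots> (rabs s \<otimes> rabs (\<ominus> t))"
      by (intro rabs_mul_nonneg s rneg_nonneg that)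
    also have "req_in \<Delta> \<dots> (rabs s \<otimes> rabs t)"
      by (intro rmul_cong req_refl rabs_neg mem rabs_mem)
    finally show ?thesis .
  qed
qed fact

lemma rabs_mul:
  assumes "\<Gamma> \<turnstile> s \<^bold>\<in> Real" "\<Gamma> \<turnstile> t \<^bold>\<in> Real"
  shows "req_in \<Gamma> (rabs (s \<otimes> t)) (rabs s \<otimes> rabs t)"
proof (rule req_linear_cases[of \<Gamma> \<zero> s])
  show "\<Gamma> \<turnstile> rabs (s \<otimes> t) \<^bold>\<in> Real" "\<Gamma> \<turnstile> rabs s \<otimes> rabs t \<^bold>\<in> Real" "\<Gamma> \<turnstile> \<zero> \<^bold>\<in> Real"
    by (intro real_mem assms)+
  fix \<Delta> assume \<Delta>: "\<Gamma> \<subseteq> \<Delta>"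
  have mem: "\<Delta> \<turnstile> s \<^bold>\<in> Real" "\<Delta> \<turnstile> t \<^bold>\<in> Real"
    using assms weaken \<Delta> by blast+
  show "req_in \<Delta> (rabs (s \<otimes> t)) (rabs s \<otimes> rabs t)" if "rle_in \<Delta> \<zero> s"
    using that mem(2) by (rule rabs_mul_nonneg_left)
  show "req_in \<Delta> (rabs (s \<otimes> t)) (rabs s \<otimes> rabs t)" if "rle_in \<Delta> s \<zero>"
  proof -
    have "req_in \<Delta> (rabs (s \<otimes> t)) (rabs (\<ominus> (s \<otimes> t)))"
      by (intro req_sym[OF rabs_neg] mem real_mem)
    also have "req_in \<Delta> \<dots> (rabs (\<ominus> s \<otimes> t))"
      by (intro rabs_cong req_sym[OF rneg_mul] mem)
    also have "req_in \<Delta> \<dots> (rabs (\<ominus> s) \<otimes> rabs t)"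
      by (intro rabs_mul_nonneg_left mem rneg_nonneg that)
    also have "req_in \<Delta> \<dots> (rabs s \<otimes> rabs t)"
      by (intro rmul_cong req_refl rabs_neg mem rabs_mem)
    finally show ?thesis .
  qed
qed fact

lemma rabs_eq_zero:
  assumes "rle_in \<Gamma> (rabs s) \<zero>" "\<Gamma> \<turnstile> s \<^bold>\<in> Real"
  shows "req_in \<Gamma> s \<zero>"
proof -
  have "rle_in \<Gamma> s \<zero>"
    using rle_rabs[OF assms(2)] assms(1) by (rule rle_trans)
  moreover have "rle_in \<Gamma> (\<ominus> s) \<zero>"
    using rneg_le_rabs[OF assms(2)] assms(1) by (rule rle_trans)
  then have "rle_in \<Gamma> \<zero> (\<ominus> (\<ominus> s))"
    by (rule rneg_nonneg)
  then have "rle_in \<Gamma> \<zero> s"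
    using rneg_neg[OF assms(2)] by (rule rle_req_trans)
  ultimately show ?thesis
    by (simp add: req_in_def)
qed

lemma rle_add_nonneg:
  assumes "rle_in \<Gamma> \<zero> t" "\<Gamma> \<turnstile> s \<^bold>\<in> Real"
  shows "rle_in \<Gamma> s (s \<oplus> t)"
  by (rule req_rle_trans[OF req_sym[OF radd_zero_in] radd_le_mono[OF rle_refl assms(1)]]) fact+

lemma rmul_one_left: "\<Gamma> \<turnstile> s \<^bold>\<in> Real \<Longrightarrow> req_in \<Gamma> (\<one> \<otimes> s) s"
  by (rule req_trans[OF rmul_comm_in rmul_one_in]) (simp_all add: real_mem)

lemma rmul_add_left:
  assumes "\<Gamma> \<turnstile> s \<^bold>\<in> Real" "\<Gamma> \<turnstile> t \<^bold>\<in> Real" "\<Gamma> \<turnstile> u \<^bold>\<in> Real"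
  shows "req_in \<Gamma> ((s \<oplus> t) \<otimes> u) (s \<otimes> u \<oplus> t \<otimes> u)"
proof -
  have "req_in \<Gamma> ((s \<oplus> t) \<otimes> u) (u \<otimes> (s \<oplus> t))"
    by (intro rmul_comm_in real_mem assms)
  also have "req_in \<Gamma> \<dots> (u \<otimes> s \<oplus> u \<otimes> t)"
    by (intro rmul_add_in assms)
  also have "req_in \<Gamma> \<dots> (s \<otimes> u \<oplus> t \<otimes> u)"
    by (intro radd_cong rmul_comm_in assms)
  finally show ?thesis .
qed

lemma rabs_zero: "req_in \<Gamma> s \<zero> \<Longrightarrow> req_in \<Gamma> (rabs s) \<zero>"
  by (rule req_trans[OF rabs_cong rabs_of_nonneg]) (simp_all add: rle_refl rzero_mem)

lemma req_of_diff:
  assumes "req_in \<Gamma> (s \<oplus> \<ominus> t) \<zero>" "\<Gamma> \<turnstile> s \<^bold>\<in> Real" "\<Gamma> \<turnstile> t \<^bold>\<in> Real"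
  shows "req_in \<Gamma> s t"
  by (rule req_trans[OF rneg_unique rneg_neg]) (simp_all add: assms real_mem)

lemma diff_of_req: "req_in \<Gamma> s t \<Longrightarrow> req_in \<Gamma> (s \<oplus> \<ominus> t) \<zero>"
  by (rule req_trans[OF radd_cong_left radd_neg_in]) (simp_all add: req_memD real_mem)

lemma req_of: "req_in \<Gamma> s t \<Longrightarrow> \<Gamma> \<turnstile> s \<^bold>\<simeq> t"
  by (simp add: req_in_iff)

lemma rle_of: "rle_in \<Gamma> s t \<Longrightarrow> \<Gamma> \<turnstile> s \<^bold>\<le> t"
  by (simp add: rle_in_def)

section \<open>The norms\<close>

text \<open>The norm with index \<open>i\<close> maps \<open>x\<close> to \<open>\<bar>x\<bar>\<close> if \<open>a\<^sub>i = 0\<close>, and to \<open>\<bar>x\<bar> + \<bar>x\<bar>\<close> if \<open>a\<^sub>i = 1\<close>.\<close>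

definition qn :: tm where
  "qn = lam ''i'' (lam ''x'' (C cRec \<cdot> rabs (V ''x'') \<cdot>
     (C cK \<cdot> (C cK \<cdot> (rabs (V ''x'') \<oplus> rabs (V ''x'')))) \<cdot> (V ''a'' \<cdot> V ''i'')))"

lemma fv_qn [simp]: "fv_tm qn = {''a''}"
  by (auto simp: qn_def)

lemma psubst_tm_fresh: "(\<And>w. w \<in> fv_tm t \<Longrightarrow> \<sigma> w = V w) \<Longrightarrow> psubst_tm \<sigma> t = t"
  using psubst_tm_cong[of t \<sigma> V] by (simp add: psubst_tm_V)

text \<open>Both abstractions are first reduced at their own bound variables, where substitution is
  trivial, and the arguments are inserted afterwards. Direct reduction at a compound
  \<open>i\<close> would leave a substitution in front of the inner abstraction, with which it does
  not commute.\<close>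

lemma eq_qn:
  "\<Gamma> \<turnstile> qn \<cdot> i \<cdot> s \<^bold>= C cRec \<cdot> rabs s \<cdot> (C cK \<cdot> (C cK \<cdot> (rabs s \<oplus> rabs s))) \<cdot> (V ''a'' \<cdot> i)"
proof -
  let ?body = "\<lambda>i s. C cRec \<cdot> rabs s \<cdot> (C cK \<cdot> (C cK \<cdot> (rabs s \<oplus> rabs s))) \<cdot> (V ''a'' \<cdot> i)"
  have "{} \<turnstile> qn \<cdot> V ''i'' \<^bold>= lam ''x'' (?body (V ''i'') (V ''x''))"
    using eq_beta[of "{}" "''i''" _ "V ''i''"] unfolding qn_def subst_tm_self .
  then have "{} \<turnstile> qn \<cdot> V ''i'' \<cdot> V ''x'' \<^bold>= lam ''x'' (?body (V ''i'') (V ''x'')) \<cdot> V ''x''"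
    by (rule eq_app_left)
  also have "{} \<turnstile> lam ''x'' (?body (V ''i'') (V ''x'')) \<cdot> V ''x'' \<^bold>= ?body (V ''i'') (V ''x'')"
    using eq_beta[of "{}" "''x''" _ "V ''x''"] unfolding subst_tm_self .
  finally have "{} \<turnstile> qn \<cdot> V ''i'' \<cdot> V ''x'' \<^bold>= ?body (V ''i'') (V ''x'')" .
  \<comment> \<open>The third pair is a dummy. \<open>qn\<close> itself is unaffected, as its only
    variable is \<open>a\<close>.\<close>
  note simultaneous_instance[OF this, of "''i''" "''x''" "''y''" \<Gamma> i s zero]
  moreover have "psubst_tm (V(''i'' := i, ''x'' := s, ''y'' := zero)) qn = qn"
    by (rule psubst_tm_fresh) auto
  ultimately show ?thesis
    by simp
qed

lemma qn_single:
  assumes "\<Gamma> \<turnstile> V ''a'' \<cdot> i \<^bold>= zero" "\<Gamma> \<turnstile> s \<^bold>\<in> Real"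
  shows "req_in \<Gamma> (qn \<cdot> i \<cdot> s) (rabs s)"
  using eq_trans[OF eq_qn eq_trans[OF eq_app_right[OF assms(1)] eq_rec_zero]] rabs_mem[OF assms(2)]
  by (rule eq_req)

text \<open>The step function of the recursion is constant in both arguments, so a single step
  discards the initial value \<open>rabs s\<close> and returns the doubled one.\<close>

lemma qn_double:
  assumes "\<Gamma> \<turnstile> V ''a'' \<cdot> i \<^bold>= suc zero" "\<Gamma> \<turnstile> s \<^bold>\<in> Real"
  shows "req_in \<Gamma> (qn \<cdot> i \<cdot> s) (rabs s \<oplus> rabs s)"
proof (rule eq_req)
  have "\<Gamma> \<turnstile> qn \<cdot> i \<cdot> s \<^bold>= C cK \<cdot> (C cK \<cdot> (rabs s \<oplus> rabs s)) \<cdot> zero \<cdot> rabs s"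
    using eq_trans[OF eq_qn eq_trans[OF eq_app_right[OF assms(1)] eq_rec_one]] .
  also have "\<Gamma> \<turnstile> C cK \<cdot> (C cK \<cdot> (rabs s \<oplus> rabs s)) \<cdot> zero \<cdot> rabs s \<^bold>= C cK \<cdot> (rabs s \<oplus> rabs s) \<cdot> rabs s"
    by (rule eq_app_left[OF eq_K])
  also have "\<Gamma> \<turnstile> C cK \<cdot> (rabs s \<oplus> rabs s) \<cdot> rabs s \<^bold>= rabs s \<oplus> rabs s"
    by (rule eq_K)
  finally show "\<Gamma> \<turnstile> qn \<cdot> i \<cdot> s \<^bold>= rabs s \<oplus> rabs s" .
qed (intro real_mem assms)

text \<open>The two candidates for a norm, as meta-level functions on terms. The seminorm laws are
  proved for both and transferred to \<open>qn\<close>, whose branch is known only under a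
  hypothesis of the object theory.\<close>

definition gauge :: "(tm \<Rightarrow> tm) \<Rightarrow> bool" where
  "gauge g \<longleftrightarrow> g = (\<lambda>s. rabs s) \<or> g = (\<lambda>s. rabs s \<oplus> rabs s)"

lemma gauge_cong: "gauge g \<Longrightarrow> req_in \<Gamma> s t \<Longrightarrow> req_in \<Gamma> (g s) (g t)"
  unfolding gauge_def by (auto intro: rabs_cong radd_cong)

lemma rabs_le_gauge: "gauge g \<Longrightarrow> \<Gamma> \<turnstile> s \<^bold>\<in> Real \<Longrightarrow> rle_in \<Gamma> (rabs s) (g s)"
  unfolding gauge_def by (elim disjE) (simp_all add: rle_refl rabs_mem rle_add_nonneg rabs_nonneg)

lemma gauge_le: "gauge g \<Longrightarrow> \<Gamma> \<turnstile> s \<^bold>\<in> Real \<Longrightarrow> rle_in \<Gamma> (g s) (rabs s \<oplus> rabs s)"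
  unfolding gauge_def
  by (elim disjE) (simp_all add: rle_refl rabs_mem rle_add_nonneg rabs_nonneg radd_mem)

lemma gauge_triangle:
  assumes "gauge g" "\<Gamma> \<turnstile> s \<^bold>\<in> Real" "\<Gamma> \<turnstile> t \<^bold>\<in> Real"
  shows "rle_in \<Gamma> (g (s \<oplus> t)) (g s \<oplus> g t)"
  using assms(1) unfolding gauge_def
proof (elim disjE)
  have "rle_in \<Gamma> (rabs (s \<oplus> t) \<oplus> rabs (s \<oplus> t)) (rabs s \<oplus> rabs t \<oplus> (rabs s \<oplus> rabs t))"
    by (intro radd_le_mono rabs_triangle assms)
  also have "req_in \<Gamma> \<dots> (rabs s \<oplus> rabs s \<oplus> (rabs t \<oplus> rabs t))"
    by (intro radd_swap rabs_mem assms)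
  finally show ?thesis if "g = (\<lambda>s. rabs s \<oplus> rabs s)"
    using that by simp
qed (simp add: assms rabs_triangle)

lemma gauge_mul:
  assumes "gauge g" "\<Gamma> \<turnstile> s \<^bold>\<in> Real" "\<Gamma> \<turnstile> t \<^bold>\<in> Real"
  shows "req_in \<Gamma> (g (s \<otimes> t)) (rabs s \<otimes> g t)"
  using assms(1) unfolding gauge_def
proof (elim disjE)
  have "req_in \<Gamma> (rabs (s \<otimes> t) \<oplus> rabs (s \<otimes> t)) (rabs s \<otimes> rabs t \<oplus> rabs s \<otimes> rabs t)"
    by (intro radd_cong rabs_mul assms)
  also have "req_in \<Gamma> \<dots> (rabs s \<otimes> (rabs t \<oplus> rabs t))"
    by (intro req_sym[OF rmul_add_in] rabs_mem assms)
  finally show ?thesis if "g = (\<lambda>s. rabs s \<oplus> rabs s)"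
    using that by simp
qed (simp add: assms rabs_mul)

definition binary :: fm where
  "binary = (\<^bold>\<forall>''n''\<^bold>\<in>Nat. V ''a'' \<cdot> V ''n'' \<^bold>= zero \<^bold>\<or> V ''a'' \<cdot> V ''n'' \<^bold>= suc zero)"

lemma binary_disj:
  assumes "\<Gamma> \<turnstile> binary" "\<Gamma> \<turnstile> i \<^bold>\<in> Nat"
  shows "\<Gamma> \<turnstile> V ''a'' \<cdot> i \<^bold>= zero \<^bold>\<or> V ''a'' \<cdot> i \<^bold>= suc zero"
  using all_in_E[OF assms[unfolded binary_def]] by simp

context
  fixes \<Gamma> i
  assumes bin: "\<Gamma> \<turnstile> binary" and i: "\<Gamma> \<turnstile> i \<^bold>\<in> Nat"
begin

text \<open>In contrast to the case distinctions on reals this one is valid for every goal, because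
  \<open>binary\<close> is a genuine disjunction.\<close>

lemma gauge_cases:
  assumes "\<And>\<Delta> g. \<Gamma> \<subseteq> \<Delta> \<Longrightarrow> gauge g \<Longrightarrow> (\<And>s. \<Delta> \<turnstile> s \<^bold>\<in> Real \<Longrightarrow> req_in \<Delta> (qn \<cdot> i \<cdot> s) (g s)) \<Longrightarrow> \<Delta> \<turnstile> \<phi>"
  shows "\<Gamma> \<turnstile> \<phi>"
proof (rule disj_cases[OF binary_disj[OF bin i]])
  fix \<Delta> assume \<Delta>: "\<Gamma> \<subseteq> \<Delta>"
  show "\<Delta> \<turnstile> \<phi>" if "\<Delta> \<turnstile> V ''a'' \<cdot> i \<^bold>= zero"
    by (rule assms[OF \<Delta>, of "\<lambda>s. rabs s"]) (simp_all add: gauge_def qn_single that)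
  show "\<Delta> \<turnstile> \<phi>" if "\<Delta> \<turnstile> V ''a'' \<cdot> i \<^bold>= suc zero"
    by (rule assms[OF \<Delta>, of "\<lambda>s. rabs s \<oplus> rabs s"]) (simp_all add: gauge_def qn_double that)
qed

lemma gauge_rle_cases:
  assumes "\<Gamma> \<turnstile> u \<^bold>\<in> Real" "\<Gamma> \<turnstile> v \<^bold>\<in> Real"
    and "\<And>\<Delta> g. \<Gamma> \<subseteq> \<Delta> \<Longrightarrow> gauge g \<Longrightarrow> (\<And>s. \<Delta> \<turnstile> s \<^bold>\<in> Real \<Longrightarrow> req_in \<Delta> (qn \<cdot> i \<cdot> s) (g s)) \<Longrightarrow> rle_in \<Delta> u v"
  shows "rle_in \<Gamma> u v"
  unfolding rle_in_def using assms by (auto simp: rle_in_def intro: gauge_cases)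

lemma gauge_req_cases:
  assumes "\<Gamma> \<turnstile> u \<^bold>\<in> Real" "\<Gamma> \<turnstile> v \<^bold>\<in> Real"
    and "\<And>\<Delta> g. \<Gamma> \<subseteq> \<Delta> \<Longrightarrow> gauge g \<Longrightarrow> (\<And>s. \<Delta> \<turnstile> s \<^bold>\<in> Real \<Longrightarrow> req_in \<Delta> (qn \<cdot> i \<cdot> s) (g s)) \<Longrightarrow> req_in \<Delta> u v"
  shows "req_in \<Gamma> u v"
  unfolding req_in_def using assms by (auto simp: req_in_def intro: gauge_rle_cases)

context
  fixes s
  assumes s: "\<Gamma> \<turnstile> s \<^bold>\<in> Real"
begin

lemma qn_mem: "\<Gamma> \<turnstile> qn \<cdot> i \<cdot> s \<^bold>\<in> Real"
  by (rule gauge_cases) (blast dest: req_memD intro: weaken[OF s])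

text \<open>A lower bound independent of the index. It yields nonnegativity, the recovery of
  equality from one norm, and the positive norm required of a nonzero combination.\<close>

lemma rabs_le_qn: "rle_in \<Gamma> (rabs s) (qn \<cdot> i \<cdot> s)"
proof (rule gauge_rle_cases)
  fix \<Delta> g assume \<Delta>: "\<Gamma> \<subseteq> \<Delta>" and g: "gauge g"
    and eq: "\<And>s. \<Delta> \<turnstile> s \<^bold>\<in> Real \<Longrightarrow> req_in \<Delta> (qn \<cdot> i \<cdot> s) (g s)"
  show "rle_in \<Delta> (rabs s) (qn \<cdot> i \<cdot> s)"
    by (intro rle_req_trans[OF rabs_le_gauge[OF g] req_sym[OF eq]] weaken[OF s \<Delta>])
qed (intro qn_mem rabs_mem s)+

lemma qn_nonneg: "rle_in \<Gamma> \<zero> (qn \<cdot> i \<cdot> s)"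
  by (rule rle_trans[OF rabs_nonneg[OF s] rabs_le_qn])

text \<open>The bound is uniform in the index, which makes the family of norms of each element
  bounded.\<close>

lemma qn_le: "rle_in \<Gamma> (qn \<cdot> i \<cdot> s) (rabs s \<oplus> rabs s)"
proof (rule gauge_rle_cases)
  fix \<Delta> g assume \<Delta>: "\<Gamma> \<subseteq> \<Delta>" and g: "gauge g"
    and eq: "\<And>s. \<Delta> \<turnstile> s \<^bold>\<in> Real \<Longrightarrow> req_in \<Delta> (qn \<cdot> i \<cdot> s) (g s)"
  show "rle_in \<Delta> (qn \<cdot> i \<cdot> s) (rabs s \<oplus> rabs s)"
    by (intro req_rle_trans[OF eq gauge_le[OF g]] weaken[OF s \<Delta>])
qed (intro qn_mem real_mem s)+

end

lemma qn_cong: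
  assumes "req_in \<Gamma> s t"
  shows "req_in \<Gamma> (qn \<cdot> i \<cdot> s) (qn \<cdot> i \<cdot> t)"
proof (rule gauge_req_cases)
  fix \<Delta> g assume \<Delta>: "\<Gamma> \<subseteq> \<Delta>" and g: "gauge g"
    and eq: "\<And>s. \<Delta> \<turnstile> s \<^bold>\<in> Real \<Longrightarrow> req_in \<Delta> (qn \<cdot> i \<cdot> s) (g s)"
  note st = req_in_weaken[OF assms \<Delta>]
  show "req_in \<Delta> (qn \<cdot> i \<cdot> s) (qn \<cdot> i \<cdot> t)"
    by (rule req_trans[OF eq req_trans[OF gauge_cong[OF g st] req_sym[OF eq]]]) (rule req_memD[OF st])+
qed (intro qn_mem req_memD[OF assms])+

context
  fixes s t
  assumes s: "\<Gamma> \<turnstile> s \<^bold>\<in> Real" and t: "\<Gamma> \<turnstile> t \<^bold>\<in> Real"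
begin

lemma qn_triangle: "rle_in \<Gamma> (qn \<cdot> i \<cdot> (s \<oplus> t)) (qn \<cdot> i \<cdot> s \<oplus> qn \<cdot> i \<cdot> t)"
proof (rule gauge_rle_cases)
  fix \<Delta> g assume \<Delta>: "\<Gamma> \<subseteq> \<Delta>" and g: "gauge g"
    and eq: "\<And>s. \<Delta> \<turnstile> s \<^bold>\<in> Real \<Longrightarrow> req_in \<Delta> (qn \<cdot> i \<cdot> s) (g s)"
  note mem = weaken[OF s \<Delta>] weaken[OF t \<Delta>]
  have "req_in \<Delta> (qn \<cdot> i \<cdot> (s \<oplus> t)) (g (s \<oplus> t))"
    by (intro eq real_mem mem)
  also have "rle_in \<Delta> \<dots> (g s \<oplus> g t)"
    using g mem by (rule gauge_triangle)
  also have "req_in \<Delta> \<dots> (qn \<cdot> i \<cdot> s \<oplus> qn \<cdot> i \<cdot> t)"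
    by (intro radd_cong req_sym[OF eq] mem)
  finally show "rle_in \<Delta> (qn \<cdot> i \<cdot> (s \<oplus> t)) (qn \<cdot> i \<cdot> s \<oplus> qn \<cdot> i \<cdot> t)" .
qed (intro qn_mem real_mem s t)+

lemma qn_mul: "req_in \<Gamma> (qn \<cdot> i \<cdot> (s \<otimes> t)) (rabs s \<otimes> (qn \<cdot> i \<cdot> t))"
proof (rule gauge_req_cases)
  fix \<Delta> g assume \<Delta>: "\<Gamma> \<subseteq> \<Delta>" and g: "gauge g"
    and eq: "\<And>s. \<Delta> \<turnstile> s \<^bold>\<in> Real \<Longrightarrow> req_in \<Delta> (qn \<cdot> i \<cdot> s) (g s)"
  note mem = weaken[OF s \<Delta>] weaken[OF t \<Delta>]
  have "req_in \<Delta> (qn \<cdot> i \<cdot> (s \<otimes> t)) (g (s \<otimes> t))"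
    by (intro eq real_mem mem)
  also have "req_in \<Delta> \<dots> (rabs s \<otimes> g t)"
    using g mem by (rule gauge_mul)
  also have "req_in \<Delta> \<dots> (rabs s \<otimes> (qn \<cdot> i \<cdot> t))"
    by (intro rmul_cong req_refl rabs_mem req_sym[OF eq] mem)
  finally show "req_in \<Delta> (qn \<cdot> i \<cdot> (s \<otimes> t)) (rabs s \<otimes> (qn \<cdot> i \<cdot> t))" .
qed (intro qn_mem real_mem s t)+

end

end

lemma qn_zero:
  assumes "\<Gamma> \<turnstile> binary" "\<Gamma> \<turnstile> i \<^bold>\<in> Nat" "req_in \<Gamma> s \<zero>"
  shows "req_in \<Gamma> (qn \<cdot> i \<cdot> s) \<zero>"
proof -
  have s: "\<Gamma> \<turnstile> s \<^bold>\<in> Real"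
    using assms(3) by (rule req_memD)
  have "rle_in \<Gamma> (qn \<cdot> i \<cdot> s) (rabs s \<oplus> rabs s)"
    using assms(1,2) s by (rule qn_le)
  also have "req_in \<Gamma> \<dots> (\<zero> \<oplus> \<zero>)"
    by (intro radd_cong rabs_zero assms)
  also have "req_in \<Gamma> \<dots> \<zero>"
    by (intro radd_zero_in real_mem)
  finally show ?thesis
    using qn_nonneg[OF assms(1,2) s] by (simp add: req_in_def)
qed

lemma qn_separates:
  assumes "\<Gamma> \<turnstile> binary" "\<Gamma> \<turnstile> i \<^bold>\<in> Nat" "\<Gamma> \<turnstile> s \<^bold>\<in> Real" "\<Gamma> \<turnstile> qn \<cdot> i \<cdot> s \<^bold>\<simeq> \<zero>"
  shows "req_in \<Gamma> s \<zero>"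
proof (rule rabs_eq_zero)
  have "req_in \<Gamma> (qn \<cdot> i \<cdot> s) \<zero>"
    using assms by (simp add: req_in_iff qn_mem rzero_mem)
  then show "rle_in \<Gamma> (rabs s) \<zero>"
    using rabs_le_qn[OF assms(1-3)] rle_req_trans by blast
qed fact

section \<open>The space\<close>

text \<open>Comprehension defines a class through a single variable, so the relation takes its
  argument apart by projections. The class has no name in the language; \<open>E\<close> remains a
  variable governed by this hypothesis.\<close>

definition real_equality :: fm where
  "real_equality = (\<^bold>\<forall>''z''. V ''z'' \<^bold>\<in> CV ''E'' \<^bold>\<longleftrightarrow> C cFst \<cdot> V ''z'' \<^bold>\<simeq> C cSnd \<cdot> V ''z'')"

definition identity :: fm where
  "identity = (\<^bold>\<forall>''z''. V ''z'' \<^bold>\<in> CV ''J'' \<^bold>\<longleftrightarrow> C cFst \<cdot> V ''z'' \<^bold>= C cSnd \<cdot> V ''z'')"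

lemma eq_subst_req:
  assumes "\<Gamma> \<turnstile> s \<^bold>= s'" "\<Gamma> \<turnstile> t \<^bold>= t'" "\<Gamma> \<turnstile> s \<^bold>\<simeq> t"
  shows "\<Gamma> \<turnstile> s' \<^bold>\<simeq> t'"
proof -
  obtain x where "x \<notin> fv_tm t \<union> fv_tm s'"
    using fresh_name[of "fv_tm t \<union> fv_tm s'"] by auto
  then show ?thesis
    using eq_subst[OF assms(1), of x "V x \<^bold>\<simeq> t"] eq_subst[OF assms(2), of x "s' \<^bold>\<simeq> V x"] assms(3)
    by simp
qed

lemma real_equality_iff:
  assumes "\<Gamma> \<turnstile> real_equality"
  shows "(\<Gamma> \<turnstile> pr s t \<^bold>\<in> CV ''E'') \<longleftrightarrow> (\<Gamma> \<turnstile> s \<^bold>\<simeq> t)"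
proof -
  have "\<Gamma> \<turnstile> pr s t \<^bold>\<in> CV ''E'' \<^bold>\<longleftrightarrow> C cFst \<cdot> pr s t \<^bold>\<simeq> C cSnd \<cdot> pr s t"
    using all_E[OF assms[unfolded real_equality_def], of "pr s t"] by simp
  then have "(\<Gamma> \<turnstile> pr s t \<^bold>\<in> CV ''E'') \<longleftrightarrow> (\<Gamma> \<turnstile> C cFst \<cdot> pr s t \<^bold>\<simeq> C cSnd \<cdot> pr s t)"
    using iff_E1 iff_E2 by blast
  also have "\<dots> \<longleftrightarrow> (\<Gamma> \<turnstile> s \<^bold>\<simeq> t)"
    using eq_subst_req[OF eq_fst eq_snd] eq_subst_req[OF eq_sym[OF eq_fst] eq_sym[OF eq_snd]] by blast
  finally show ?thesis .
qed

lemma identity_iff: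
  assumes "\<Gamma> \<turnstile> identity"
  shows "(\<Gamma> \<turnstile> pr s t \<^bold>\<in> CV ''J'') \<longleftrightarrow> (\<Gamma> \<turnstile> s \<^bold>= t)"
proof -
  have "\<Gamma> \<turnstile> pr s t \<^bold>\<in> CV ''J'' \<^bold>\<longleftrightarrow> C cFst \<cdot> pr s t \<^bold>= C cSnd \<cdot> pr s t"
    using all_E[OF assms[unfolded identity_def], of "pr s t"] by simp
  then have "(\<Gamma> \<turnstile> pr s t \<^bold>\<in> CV ''J'') \<longleftrightarrow> (\<Gamma> \<turnstile> C cFst \<cdot> pr s t \<^bold>= C cSnd \<cdot> pr s t)"
    using iff_E1 iff_E2 by blast
  also have "\<dots> \<longleftrightarrow> (\<Gamma> \<turnstile> s \<^bold>= t)"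
    using eq_trans[OF eq_sym[OF eq_fst] eq_trans[OF _ eq_snd]]
      eq_trans[OF eq_fst eq_trans[OF _ eq_sym[OF eq_snd]]] by blast
  finally show ?thesis .
qed

text \<open>The classes \<open>E\<close> and \<open>J\<close> are instantiated by themselves; \<open>real_equality\<close> and \<open>identity\<close> fix them.\<close>

definition inst :: "fm \<Rightarrow> fm" where
  "inst \<phi> = subst ''norm'' qn (subst ''smul'' (C cRMul) (subst ''neg'' (C cRNeg)
     (subst ''add'' (C cRAdd) (subst ''zero'' \<zero> (substC ''I'' Nat (substC ''X'' Real \<phi>))))))"

abbreviation space_context :: "fm set" where
  "space_context \<equiv> {identity, real_equality, binary}"

lemma fv_space_context [simp]: "fv identity = {}" "fv real_equality = {}" "fv binary = {''a''}"
  by (auto simp: identity_def real_equality_def binary_def)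

text \<open>As a simplification rule, \<open>hyp\<close> itself would match every goal.\<close>

lemma mem_hyp: "V x \<^bold>\<in> A \<in> \<Gamma> \<Longrightarrow> \<Gamma> \<turnstile> V x \<^bold>\<in> A"
  by (rule hyp)

lemma req_hyp:
  assumes "pr s t \<^bold>\<in> CV ''E'' \<in> \<Gamma>" "real_equality \<in> \<Gamma>" "\<Gamma> \<turnstile> s \<^bold>\<in> Real" "\<Gamma> \<turnstile> t \<^bold>\<in> Real"
  shows "req_in \<Gamma> s t"
  using hyp[OF assms(1)] assms by (simp add: real_equality_iff[OF hyp] req_in_iff)

lemma real_equality_I: "real_equality \<in> \<Gamma> \<Longrightarrow> req_in \<Gamma> s t \<Longrightarrow> \<Gamma> \<turnstile> pr s t \<^bold>\<in> CV ''E''"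
  by (simp add: real_equality_iff[OF hyp] req_in_iff)

lemma inst_conj [simp]: "inst (\<phi> \<^bold>\<and> \<psi>) = (inst \<phi> \<^bold>\<and> inst \<psi>)"
  by (simp add: inst_def)

lemma inst_imp [simp]: "inst (\<phi> \<^bold>\<longrightarrow> \<psi>) = (inst \<phi> \<^bold>\<longrightarrow> inst \<psi>)"
  by (simp add: inst_def)

lemma fv_subst_tm:
  "fv_tm (subst_tm x u t) = (fv_tm t - {x}) \<union> (if x \<in> fv_tm t then fv_tm u else {})"
  by (induction t) auto

section \<open>The real line as a q-normed space\<close>

lemma equivalence_real: "space_context \<turnstile> inst (equivalence SpX veq)"
  apply (simp add: inst_def equivalence_def)
  apply (intro conj_I all_in_I imp_I conj_insert)
  apply (simp_all add: mem_hyp real_equality_I req_refl)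
  apply (rule real_equality_I[OF _ req_sym[OF req_hyp]])
  apply (simp_all add: mem_hyp)
  apply (rule real_equality_I[OF _ req_trans[OF req_hyp req_hyp, where t = "V ''y''"]])
  apply (simp_all add: mem_hyp)
  done

lemma linear_operations_real: "space_context \<turnstile> inst linear_operations"
  apply (simp add: inst_def linear_operations_def)
  apply (intro conj_I all_in_I imp_I conj_insert)
  apply (simp_all add: mem_hyp real_mem)
  subgoal
    by (intro real_equality_I radd_cong req_hyp) (simp_all add: mem_hyp)
  subgoal
    by (intro real_equality_I rneg_cong req_hyp) (simp_all add: mem_hyp)
  subgoal
    \<comment> \<open>Scalars are compared by real equality itself and not through \<open>E\<close>;
      \<open>conj_insert\<close> has split that hypothesis into two inequalities, which
      \<open>conj_I\<close> joins again.\<close>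
    by (rule real_equality_I[OF _ rmul_cong[OF _ req_hyp]])
      (simp_all add: mem_hyp req_in_iff conj_I[OF hyp hyp])
  done

lemma linear_space: "space_context \<turnstile> inst linear_space"
  apply (simp add: linear_space_def)
  apply (intro conj_I equivalence_real linear_operations_real; simp add: inst_def)
  apply (intro all_in_I real_equality_I radd_comm_in; simp add: mem_hyp)
  apply (intro all_in_I real_equality_I radd_assoc_in; simp add: mem_hyp)
  apply (intro all_in_I real_equality_I radd_zero_in; simp add: mem_hyp)
  apply (intro all_in_I real_equality_I radd_neg_in; simp add: mem_hyp)
  apply (intro all_in_I real_equality_I rmul_one_left; simp add: mem_hyp)
  apply (intro all_in_I real_equality_I req_sym[OF rmul_assoc_in]; simp add: mem_hyp)
  apply (intro all_in_I real_equality_I rmul_add_left; simp add: mem_hyp)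
  apply (intro all_in_I real_equality_I rmul_add_in; simp add: mem_hyp)
  done

lemma binary_hyp: "binary \<in> \<Gamma> \<Longrightarrow> \<Gamma> \<turnstile> binary"
  by (rule hyp)

lemma seminorm_family: "space_context \<turnstile> inst seminorm_family"
  apply (simp add: inst_def seminorm_family_def equivalence_def)
  apply (rule conj_I)
  subgoal
    apply (intro conj_I all_in_I imp_I conj_insert)
    apply (simp_all add: identity_iff[OF hyp] eq_refl)
    subgoal
      by (rule eq_sym) (simp add: identity_iff[OF hyp, symmetric] hyp)
    subgoal
      by (rule eq_trans[where t = "V ''y''"]) (simp_all add: identity_iff[OF hyp, symmetric] hyp)
    done
  apply (rule conj_I)
   apply (intro all_in_I qn_mem; simp add: mem_hyp binary_hyp)
  apply (rule conj_I)
  subgoal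
    apply (intro all_in_I imp_I conj_insert req_of)
        \<comment> \<open>Index and element are changed one at a time: equal indices are identical,
          so Leibniz's rule suffices, whereas equal elements require \<open>qn_cong\<close>.\<close>
        apply (rule req_trans[where t = "qn \<cdot> V ''j'' \<cdot> V ''x''"])
         apply (intro eq_req eq_app_left eq_app_right qn_mem)
            apply (simp_all add: identity_iff[OF hyp, symmetric] hyp)
    apply (intro qn_cong req_hyp; simp add: mem_hyp binary_hyp)
    done
  apply (rule conj_I)
   apply (intro all_in_I rle_of qn_nonneg; simp add: mem_hyp binary_hyp)
  apply (rule conj_I)
   apply (intro all_in_I rle_of qn_triangle; simp add: mem_hyp binary_hyp)
  apply (intro all_in_I req_of qn_mul; simp add: mem_hyp binary_hyp)
  done

lemma qnormed_space: "space_context \<turnstile> inst qnormed_space"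
  apply (simp add: qnormed_space_def)
  apply (intro conj_I linear_space seminorm_family; simp add: inst_def)
  subgoal
    apply (rule all_in_I)
     \<comment> \<open>The larger of the two possible norms of \<open>x\<close> bounds all of
       them.\<close>
     apply (rule ex_in_I[of _ _ "rabs (V ''x'') \<oplus> rabs (V ''x'')"])
       apply simp_all
      apply (intro all_in_I rle_of req_rle_trans[OF rabs_of_nonneg] qn_nonneg qn_le;
        simp add: mem_hyp binary_hyp)
     apply (simp add: mem_hyp real_mem)
    done
  subgoal
    apply (intro all_in_I conj_I)
    subgoal
      by (intro imp_I all_in_I req_of qn_zero diff_of_req req_hyp; simp add: mem_hyp binary_hyp)
    subgoal
      apply (rule imp_I)
      \<comment> \<open>All norms are assumed to vanish; as each dominates the absolute value, the
        one with index zero already gives equality.\<close>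
      apply (rule real_equality_I[OF _ req_of_diff[OF qn_separates[where i = zero]]])
            apply (simp_all add: mem_hyp binary_hyp real_mem)
      using all_in_E[OF hyp, of "''i''" Nat "qn \<cdot> V ''i'' \<cdot> (V ''x'' \<oplus> \<ominus> V ''y'') \<^bold>\<simeq> \<zero>" _ zero]
      apply simp
      done
     apply simp_all
    done
  done

section \<open>Finite dimensionality\<close>

text \<open>The index is replaced by the atomic term \<open>zero\<close>, so the substitution passes
  under the inner abstraction. The initial value of the recursion survives as a summand.\<close>

lemma eq_sum_one:
  assumes "''t'' \<notin> fv_tm u"
  shows "\<Gamma> \<turnstile> C cRec \<cdot> \<zero> \<cdot> lam ''k'' (lam ''t'' (V ''t'' \<oplus> u)) \<cdot> suc zero
    \<^bold>= \<zero> \<oplus> subst_tm ''k'' zero u"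
proof -
  have "\<Gamma> \<turnstile> lam ''k'' (lam ''t'' (V ''t'' \<oplus> u)) \<cdot> zero \<^bold>= lam ''t'' (V ''t'' \<oplus> subst_tm ''k'' zero u)"
    using eq_beta[of \<Gamma> "''k''" "lam ''t'' (V ''t'' \<oplus> u)" zero] by (simp add: subst_lam del: lam.simps)
  from eq_app_left[OF this, of \<zero>]
  have "\<Gamma> \<turnstile> lam ''k'' (lam ''t'' (V ''t'' \<oplus> u)) \<cdot> zero \<cdot> \<zero> \<^bold>= \<zero> \<oplus> subst_tm ''k'' zero u"
    by (rule eq_trans)
      (use eq_beta[of \<Gamma> "''t''" "V ''t'' \<oplus> subst_tm ''k'' zero u" \<zero>] assms in
        \<open>simp add: fv_subst_tm del: lam.simps\<close>)
  then show ?thesis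
    by (rule eq_trans[OF eq_rec_one])
qed

text \<open>
  The compound coefficients and basis can be inserted only after the sum has been evaluated for
  variables \<open>l\<close> and \<open>b\<close>, see \<open>subst_lam\<close>.
\<close>

abbreviation comb :: tm where
  "comb \<equiv> C cRec \<cdot> \<zero> \<cdot>
     lam ''k'' (lam ''t'' (V ''t'' \<oplus> V ''l'' \<cdot> V ''k'' \<otimes> V ''b'' \<cdot> V ''k'')) \<cdot> suc zero"

lemma eq_comb_b:
  "{} \<turnstile> subst_tm ''b'' (C cK \<cdot> \<one>) comb \<^bold>= \<zero> \<oplus> V ''l'' \<cdot> zero \<otimes> (C cK \<cdot> \<one> \<cdot> zero)"
proof -
  have "{} \<turnstile> comb \<^bold>= \<zero> \<oplus> V ''l'' \<cdot> zero \<otimes> V ''b'' \<cdot> zero"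
    using eq_sum_one[of "V ''l'' \<cdot> V ''k'' \<otimes> V ''b'' \<cdot> V ''k''" "{}"] by (simp del: lam.simps)
  from derivable_subst[OF this, of "C cK \<cdot> \<one>" "''b''"] show ?thesis
    by (simp del: lam.simps)
qed

lemma eq_comb:
  "{} \<turnstile> subst_tm ''l'' (C cK \<cdot> V ''x'') (subst_tm ''b'' (C cK \<cdot> \<one>) comb)
    \<^bold>= \<zero> \<oplus> C cK \<cdot> V ''x'' \<cdot> zero \<otimes> (C cK \<cdot> \<one> \<cdot> zero)"
  using derivable_subst[OF eq_comb_b, of "C cK \<cdot> V ''x''" "''l''"] by (simp del: lam.simps)

lemma rless_zero_one: "rless_in \<Gamma> \<zero> \<one>"
  by (simp add: rless_in_def real_mem ax[OF real[OF real_axiom.intros(19)]])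

lemma K_mem: "\<Gamma> \<turnstile> s \<^bold>\<in> A \<Longrightarrow> \<Gamma> \<turnstile> C cK \<cdot> s \<cdot> t \<^bold>\<in> A"
  by (rule eq_mem[OF eq_K])

text \<open>With the basis consisting of 1, a combination equals its only coefficient, here called
  \<open>s\<close>.\<close>

lemma combination_one:
  assumes "\<Gamma> \<turnstile> s \<^bold>\<in> Real" "\<Gamma> \<turnstile> t \<^bold>= \<zero> \<oplus> s \<otimes> (C cK \<cdot> \<one> \<cdot> zero)"
  shows "req_in \<Gamma> t s"
proof -
  have "req_in \<Gamma> t (\<zero> \<oplus> s \<otimes> (C cK \<cdot> \<one> \<cdot> zero))"
    by (intro eq_req assms real_mem K_mem)
  also have "req_in \<Gamma> \<dots> (s \<otimes> (C cK \<cdot> \<one> \<cdot> zero))"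
    by (intro radd_zero_left assms real_mem K_mem)
  also have "req_in \<Gamma> \<dots> (s \<otimes> \<one>)"
    by (intro rmul_cong req_refl eq_req eq_K assms real_mem)
  also have "req_in \<Gamma> \<dots> s"
    by (intro rmul_one_in assms)
  finally show ?thesis .
qed

text \<open>Inequality demands an explicit index with positive norm; zero works, since its norm
  dominates the absolute value of the combination, which is the given positive sum. The subtracted
  zero comes from the definition of \<open>vneq\<close>.\<close>

lemma combination_norm_pos:
  assumes "\<Gamma> \<turnstile> binary" "\<Gamma> \<turnstile> V ''l'' \<cdot> zero \<^bold>\<in> Real"
    and pos: "\<Gamma> \<turnstile> \<zero> \<^bold>< C cRec \<cdot> \<zero> \<cdot> lam ''k'' (lam ''t'' (V ''t'' \<oplus> rabs (V ''l'' \<cdot> V ''k''))) \<cdot> suc zero"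
  shows "\<Gamma> \<turnstile> \<zero> \<^bold>< qn \<cdot> zero \<cdot> (subst_tm ''b'' (C cK \<cdot> \<one>) comb \<oplus> \<ominus> \<zero>)"
proof -
  define w where "w = V ''l'' \<cdot> zero"
  define c where "c = subst_tm ''b'' (C cK \<cdot> \<one>) comb"
  have w: "\<Gamma> \<turnstile> w \<^bold>\<in> Real"
    using assms(2) by (simp add: w_def)
  have "req_in \<Gamma> c w"
    using w weaken[OF eq_comb_b, of \<Gamma>] unfolding c_def w_def by (intro combination_one) auto
  have c: "\<Gamma> \<turnstile> c \<^bold>\<in> Real"
    using \<open>req_in \<Gamma> c w\<close> by (rule req_memD)
  have sum: "req_in \<Gamma> (C cRec \<cdot> \<zero> \<cdot> lam ''k'' (lam ''t'' (V ''t'' \<oplus> rabs (V ''l'' \<cdot> V ''k''))) \<cdot> suc zero)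
      (\<zero> \<oplus> rabs w)"
    using eq_sum_one[of "rabs (V ''l'' \<cdot> V ''k'')" \<Gamma>] w
    by (intro eq_req) (simp_all add: w_def real_mem del: lam.simps)
  have "rless_in \<Gamma> \<zero> (C cRec \<cdot> \<zero> \<cdot> lam ''k'' (lam ''t'' (V ''t'' \<oplus> rabs (V ''l'' \<cdot> V ''k''))) \<cdot> suc zero)"
    using pos req_memD(1)[OF sum] by (simp add: rless_in_def rzero_mem del: lam.simps)
  also note sum
  also have "req_in \<Gamma> (\<zero> \<oplus> rabs w) (rabs w)"
    by (intro radd_zero_left rabs_mem w)
  also have "req_in \<Gamma> \<dots> (rabs (c \<oplus> \<zero>))"
    by (intro rabs_cong req_trans[OF req_sym req_sym[OF radd_zero_in]] \<open>req_in \<Gamma> c w\<close> c)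
  also have "req_in \<Gamma> \<dots> (rabs (c \<oplus> \<ominus> \<zero>))"
    by (intro rabs_cong radd_cong req_refl req_sym[OF rneg_zero] c)
  also have "rle_in \<Gamma> \<dots> (qn \<cdot> zero \<cdot> (c \<oplus> \<ominus> \<zero>))"
    using assms(1) by (intro rabs_le_qn nat_zero_mem real_mem c)
  finally show ?thesis
    by (simp add: rless_in_def c_def del: lam.simps subst_tm.simps)
qed

lemma finite_dimensional: "space_context \<turnstile> inst finite_dimensional"
  apply (simp add: inst_def finite_dimensional_def vsum_def rsum_def vneq_def subst_lam del: lam.simps)
  \<comment> \<open>A basis has \<open>m + 1\<close> elements, so dimension one means
    \<open>m = 0\<close>.\<close>
  apply (rule ex_in_I[of _ _ zero])
    apply (simp_all add: subst_lam del: lam.simps)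
  \<comment> \<open>The basis is given by a whole sequence in the space: the constant sequence
    1.\<close>
  apply (rule ex_I[of _ _ "C cK \<cdot> \<one>"])
   apply (simp_all add: subst_lam fv_subst_tm del: lam.simps)
  apply (intro conj_I)
  subgoal
    by (intro all_in_I K_mem real_mem) simp_all
  subgoal
    apply (rule all_in_I)
     \<comment> \<open>The coordinate of a real number \<open>x\<close> is \<open>x\<close> itself,
       again as a constant sequence.\<close>
     apply (rule ex_I[of _ _ "C cK \<cdot> V ''x''"])
      apply (simp_all add: fv_subst_tm del: lam.simps)
    apply (rule conj_I)
     apply (intro all_in_I K_mem)
      apply (simp_all add: mem_hyp del: lam.simps)
    apply (rule real_equality_I)
     apply simp
    apply (rule req_sym[OF req_trans[OF combination_one eq_req[OF eq_K[where t = zero]]]])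
      apply (intro K_mem)
      apply (simp_all add: mem_hyp del: lam.simps)
    using weaken[OF eq_comb] apply (simp del: lam.simps)
    done
  subgoal
    apply (rule all_I)
     apply (intro imp_I conj_insert)
     apply (rule ex_in_I[of _ _ zero])
       apply (simp_all add: fv_subst_tm del: lam.simps)
    apply (rule combination_norm_pos[simplified subst_tm.simps if_False if_True])
      apply (simp add: binary_hyp)
    using all_in_E[OF hyp, of "''n''" Nat "V ''l'' \<cdot> V ''n'' \<^bold>\<in> Real" _ zero]
     apply simp
    apply (rule hyp)
    apply simp
    done
  done

section \<open>Application of the premise to this space\<close>

lemma every_element_normable_inst:
  assumes "\<Gamma> \<turnstile> every_element_normable"
  shows "\<Gamma> \<turnstile> inst (qnormed_space \<^bold>\<and> finite_dimensional \<^bold>\<longrightarrow>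
    (\<^bold>\<forall>''x''\<^bold>\<in>SpX. normable (V ''x'')))"
proof -
  define \<phi> where "\<phi> = (qnormed_space \<^bold>\<and> finite_dimensional \<^bold>\<longrightarrow>
    (\<^bold>\<forall>''x''\<^bold>\<in>SpX. normable (V ''x'')))"
  define \<psi> where "\<psi> = substC ''I'' Nat (substC ''X'' Real \<phi>)"
  have "\<Gamma> \<turnstile> \<^bold>\<forall>\<^sub>C''E''. \<^bold>\<forall>\<^sub>C''I''. \<^bold>\<forall>\<^sub>C''J''. \<^bold>\<forall>''zero''. \<^bold>\<forall>''add''. \<^bold>\<forall>''neg''.
      \<^bold>\<forall>''smul''. \<^bold>\<forall>''norm''. substC ''X'' Real \<phi>"
    using allC_E[OF assms[unfolded every_element_normable_def \<phi>_def[symmetric]], of Real] by simp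
  from allC_E[OF this, of "CV ''E''"]
  have "\<Gamma> \<turnstile> \<^bold>\<forall>\<^sub>C''I''. \<^bold>\<forall>\<^sub>C''J''. \<^bold>\<forall>''zero''. \<^bold>\<forall>''add''. \<^bold>\<forall>''neg''.
      \<^bold>\<forall>''smul''. \<^bold>\<forall>''norm''. substC ''X'' Real \<phi>"
    by simp
  from allC_E[OF this, of Nat]
  have "\<Gamma> \<turnstile> \<^bold>\<forall>\<^sub>C''J''. \<^bold>\<forall>''zero''. \<^bold>\<forall>''add''. \<^bold>\<forall>''neg''. \<^bold>\<forall>''smul''. \<^bold>\<forall>''norm''. \<psi>"
    by (simp add: \<psi>_def)
  from allC_E[OF this, of "CV ''J''"]
  have "\<Gamma> \<turnstile> \<^bold>\<forall>''zero''. \<^bold>\<forall>''add''. \<^bold>\<forall>''neg''. \<^bold>\<forall>''smul''. \<^bold>\<forall>''norm''. \<psi>"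
    by simp
  from all_E[OF this, of \<zero>]
  have "\<Gamma> \<turnstile> \<^bold>\<forall>''add''. \<^bold>\<forall>''neg''. \<^bold>\<forall>''smul''. \<^bold>\<forall>''norm''. subst ''zero'' \<zero> \<psi>"
    by simp
  from all_E[OF this, of "C cRAdd"]
  have "\<Gamma> \<turnstile> \<^bold>\<forall>''neg''. \<^bold>\<forall>''smul''. \<^bold>\<forall>''norm''. subst ''add'' (C cRAdd) (subst ''zero'' \<zero> \<psi>)"
    by simp
  from all_E[OF this, of "C cRNeg"]
  have "\<Gamma> \<turnstile> \<^bold>\<forall>''smul''. \<^bold>\<forall>''norm''.
      subst ''neg'' (C cRNeg) (subst ''add'' (C cRAdd) (subst ''zero'' \<zero> \<psi>))"
    by simp
  from all_E[OF this, of "C cRMul"]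
  have "\<Gamma> \<turnstile> \<^bold>\<forall>''norm''. subst ''smul'' (C cRMul)
      (subst ''neg'' (C cRNeg) (subst ''add'' (C cRAdd) (subst ''zero'' \<zero> \<psi>)))"
    by simp
  \<comment> \<open>\<open>qn\<close> is the only inserted term with a free variable. The
    definitions are unfolded to check that no quantifier binds \<open>a\<close>.\<close>
  from all_E[OF this, of qn] show ?thesis
    unfolding inst_def \<phi>_def \<psi>_def
    by (simp add: qnormed_space_def finite_dimensional_def normable_def linear_space_def
        seminorm_family_def equivalence_def linear_operations_def vneq_def)
qed

lemma normable_one:
  assumes "\<Gamma> \<turnstile> every_element_normable" "space_context \<subseteq> \<Gamma>"
  shows "\<Gamma> \<turnstile> \<^bold>\<exists>''s''\<^bold>\<in>Real. (\<^bold>\<forall>''i''\<^bold>\<in>Nat. qn \<cdot> V ''i'' \<cdot> \<one> \<^bold>\<le> V ''s'') \<^bold>\<and>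
    (\<^bold>\<forall>''e''\<^bold>\<in>Real. \<zero> \<^bold>< V ''e'' \<^bold>\<longrightarrow> (\<^bold>\<exists>''i''\<^bold>\<in>Nat. V ''s'' \<oplus> \<ominus> V ''e'' \<^bold>< qn \<cdot> V ''i'' \<cdot> \<one>))"
proof -
  have "\<Gamma> \<turnstile> inst (qnormed_space \<^bold>\<and> finite_dimensional)"
    using qnormed_space finite_dimensional assms(2) unfolding inst_conj
    by (intro conj_I) (rule weaken; assumption)+
  then have "\<Gamma> \<turnstile> inst (\<^bold>\<forall>''x''\<^bold>\<in>SpX. normable (V ''x''))"
    using every_element_normable_inst[OF assms(1)] imp_E unfolding inst_imp by blast
  then have "\<Gamma> \<turnstile> \<^bold>\<forall>''x''\<^bold>\<in>Real. \<^bold>\<exists>''s''\<^bold>\<in>Real. (\<^bold>\<forall>''i''\<^bold>\<in>Nat. qn \<cdot> V ''i'' \<cdot> V ''x'' \<^bold>\<le> V ''s'') \<^bold>\<and>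
    (\<^bold>\<forall>''e''\<^bold>\<in>Real. \<zero> \<^bold>< V ''e'' \<^bold>\<longrightarrow> (\<^bold>\<exists>''i''\<^bold>\<in>Nat. V ''s'' \<oplus> \<ominus> V ''e'' \<^bold>< qn \<cdot> V ''i'' \<cdot> V ''x''))"
    by (simp add: inst_def normable_def)
  from all_in_E[OF this rone_mem] show ?thesis
    by simp
qed

lemma rabs_one: "req_in \<Gamma> (rabs \<one>) \<one>"
  by (intro rabs_of_nonneg rless_imp_rle rless_zero_one)

lemma rless_one_two: "rless_in \<Gamma> \<one> (\<one> \<oplus> \<one>)"
  by (rule req_rless_trans[OF req_sym[OF radd_zero_left] radd_less_left[OF rless_zero_one]])
    (rule real_mem)+

text \<open>Serves to turn approximation of a supremum \<open>s\<close> within \<open>e\<close> into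
  a lower bound \<open>t\<close> of one's choice, by taking \<open>e\<close> to be the difference of
  \<open>s\<close> and \<open>t\<close>.\<close>

lemma diff_diff:
  assumes "\<Gamma> \<turnstile> s \<^bold>\<in> Real" "\<Gamma> \<turnstile> t \<^bold>\<in> Real"
  shows "req_in \<Gamma> (s \<oplus> \<ominus> (s \<oplus> \<ominus> t)) t"
proof -
  have "req_in \<Gamma> (s \<oplus> \<ominus> (s \<oplus> \<ominus> t)) (s \<oplus> (\<ominus> s \<oplus> \<ominus> (\<ominus> t)))"
    by (intro radd_cong req_refl rneg_add assms real_mem)
  also have "req_in \<Gamma> \<dots> (s \<oplus> (\<ominus> s \<oplus> t))"
    by (intro radd_cong req_refl rneg_neg assms real_mem)
  also have "req_in \<Gamma> \<dots> (s \<oplus> \<ominus> s \<oplus> t)"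
    by (intro req_sym[OF radd_assoc_in] assms real_mem)
  also have "req_in \<Gamma> \<dots> (\<zero> \<oplus> t)"
    by (intro radd_cong radd_neg_in req_refl assms)
  also have "req_in \<Gamma> \<dots> t"
    by (intro radd_zero_left assms)
  finally show ?thesis .
qed

text \<open>The value 1 would give \<open>2 \<le> s < 2\<close>; the identity with zero is then the
  remaining branch of \<open>binary\<close>, not the conclusion of an indirect proof.\<close>

lemma all_zero_of_sup_less:
  assumes bin: "\<Gamma> \<turnstile> binary" and s: "\<Gamma> \<turnstile> s \<^bold>\<in> Real" and less: "\<Gamma> \<turnstile> s \<^bold>< \<one> \<oplus> \<one>"
    and n: "\<Gamma> \<turnstile> n \<^bold>\<in> Nat" and bound: "\<Gamma> \<turnstile> qn \<cdot> n \<cdot> \<one> \<^bold>\<le> s"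
  shows "\<Gamma> \<turnstile> V ''a'' \<cdot> n \<^bold>= zero"
proof (rule disj_cases[OF binary_disj[OF bin n]])
  fix \<Delta> assume \<Delta>: "\<Gamma> \<subseteq> \<Delta>" and one: "\<Delta> \<turnstile> V ''a'' \<cdot> n \<^bold>= suc zero"
  have "req_in \<Delta> (\<one> \<oplus> \<one>) (rabs \<one> \<oplus> rabs \<one>)"
    by (intro radd_cong req_sym[OF rabs_one])
  also have "req_in \<Delta> \<dots> (qn \<cdot> n \<cdot> \<one>)"
    by (intro req_sym[OF qn_double] one real_mem)
  also have "rle_in \<Gamma> (qn \<cdot> n \<cdot> \<one>) s"
    using bound s qn_mem[OF bin n rone_mem] by (simp add: rle_in_def)
  then have "rle_in \<Delta> (qn \<cdot> n \<cdot> \<one>) s"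
    using \<Delta> by (rule rle_in_weaken)
  also have "rless_in \<Gamma> s (\<one> \<oplus> \<one>)"
    using less s by (simp add: rless_in_def real_mem)
  then have "rless_in \<Delta> s (\<one> \<oplus> \<one>)"
    using \<Delta> by (rule rless_in_weaken)
  finally show "\<Delta> \<turnstile> V ''a'' \<cdot> n \<^bold>= zero"
    using rless_asym by blast
qed

lemma one_of_norm_greater:
  assumes bin: "\<Gamma> \<turnstile> binary" and i: "\<Gamma> \<turnstile> i \<^bold>\<in> Nat"
    and s: "\<Gamma> \<turnstile> s \<^bold>\<in> Real" and less: "\<Gamma> \<turnstile> s \<oplus> \<ominus> (s \<oplus> \<ominus> \<one>) \<^bold>< qn \<cdot> i \<cdot> \<one>"
  shows "\<Gamma> \<turnstile> V ''a'' \<cdot> i \<^bold>= suc zero"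
proof (rule disj_cases[OF binary_disj[OF bin i]])
  fix \<Delta> assume \<Delta>: "\<Gamma> \<subseteq> \<Delta>" and zero: "\<Delta> \<turnstile> V ''a'' \<cdot> i \<^bold>= zero"
  have "req_in \<Delta> \<one> (s \<oplus> \<ominus> (s \<oplus> \<ominus> \<one>))"
    by (intro req_sym[OF diff_diff] weaken[OF s \<Delta>] real_mem)
  also have "rless_in \<Gamma> (s \<oplus> \<ominus> (s \<oplus> \<ominus> \<one>)) (qn \<cdot> i \<cdot> \<one>)"
    using less s qn_mem[OF bin i rone_mem] by (simp add: rless_in_def real_mem)
  then have "rless_in \<Delta> (s \<oplus> \<ominus> (s \<oplus> \<ominus> \<one>)) (qn \<cdot> i \<cdot> \<one>)"
    using \<Delta> by (rule rless_in_weaken)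
  also have "req_in \<Delta> (qn \<cdot> i \<cdot> \<one>) (rabs \<one>)"
    by (intro qn_single zero real_mem)
  also have "req_in \<Delta> (rabs \<one>) \<one>"
    by (rule rabs_one)
  finally show "\<Delta> \<turnstile> V ''a'' \<cdot> i \<^bold>= suc zero"
    using rless_asym by blast
qed

text \<open>The premise stays in the context while variables are generalised and witnesses
  eliminated, so the variable conditions of those rules need it closed.\<close>

lemma closed_every_element_normable [simp]:
  "fv every_element_normable = {}" "fvC every_element_normable = {}"
  by (simp_all add: every_element_normable_def qnormed_space_def finite_dimensional_def normable_def
      linear_space_def seminorm_family_def equivalence_def linear_operations_def vneq_def rsum_def
      vsum_def insert_Diff_if Un_Diff del: lam.simps)

lemma every_zero_or_some_one:
  "insert every_element_normable space_context \<turnstile>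
    (\<^bold>\<forall>''n''\<^bold>\<in>Nat. V ''a'' \<cdot> V ''n'' \<^bold>= zero) \<^bold>\<or> (\<^bold>\<exists>''n''\<^bold>\<in>Nat. V ''a'' \<cdot> V ''n'' \<^bold>= suc zero)"
  (is "?\<Gamma> \<turnstile> ?all \<^bold>\<or> ?ex")
proof (rule ex_in_E[OF normable_one])
  let ?upper = "\<^bold>\<forall>''i''\<^bold>\<in>Nat. qn \<cdot> V ''i'' \<cdot> \<one> \<^bold>\<le> V ''s''"
  let ?least = "\<^bold>\<forall>''e''\<^bold>\<in>Real. \<zero> \<^bold>< V ''e'' \<^bold>\<longrightarrow>
      (\<^bold>\<exists>''i''\<^bold>\<in>Nat. V ''s'' \<oplus> \<ominus> V ''e'' \<^bold>< qn \<cdot> V ''i'' \<cdot> \<one>)"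
  let ?\<Delta> = "insert (V ''s'' \<^bold>\<in> Real) (insert (?upper \<^bold>\<and> ?least) ?\<Gamma>)"
  have both: "?\<Delta> \<turnstile> ?upper \<^bold>\<and> ?least"
    by (rule hyp) simp
  note upper = conj_E1[OF both] and least = conj_E2[OF both]
  have s: "?\<Delta> \<turnstile> V ''s'' \<^bold>\<in> Real"
    by (rule hyp) simp
  have "?\<Delta> \<turnstile> \<one> \<^bold>< V ''s'' \<^bold>\<or> V ''s'' \<^bold>< \<one> \<oplus> \<one>"
    using less_cotrans'[OF rone_mem radd_mem[OF rone_mem rone_mem] s] rless_one_two
    unfolding rless_in_def by (blast intro: imp_E)
  then show "?\<Delta> \<turnstile> ?all \<^bold>\<or> ?ex"
  proof (rule disj_E)
    let ?\<Delta>' = "insert (\<one> \<^bold>< V ''s'') ?\<Delta>"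
    have w: "?\<Delta>' \<turnstile> \<phi>" if "?\<Delta> \<turnstile> \<phi>" for \<phi>
      using that by (rule weaken) auto
    \<comment> \<open>Positive because \<open>1 < s\<close>; the supremum property for it yields a
      norm above \<open>s - (s - 1)\<close>, that is, above 1.\<close>
    let ?e = "V ''s'' \<oplus> \<ominus> \<one>"
    have e: "?\<Delta>' \<turnstile> ?e \<^bold>\<in> Real"
      by (intro real_mem w[OF s])
    have "req_in ?\<Delta>' \<zero> (\<one> \<oplus> \<ominus> \<one>)"
      by (intro req_sym[OF radd_neg_in] real_mem)
    also have "rless_in ?\<Delta>' \<one> (V ''s'')"
      using w[OF s] hyp[of "\<one> \<^bold>< V ''s''" ?\<Delta>'] by (simp add: rless_in_def rone_mem)
    then have "rless_in ?\<Delta>' (\<one> \<oplus> \<ominus> \<one>) ?e"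
      by (intro radd_less_left real_mem)
    finally have "?\<Delta>' \<turnstile> \<zero> \<^bold>< ?e"
      by (simp add: rless_in_def)
    moreover have "?\<Delta>' \<turnstile> \<zero> \<^bold>< ?e \<^bold>\<longrightarrow> (\<^bold>\<exists>''i''\<^bold>\<in>Nat. V ''s'' \<oplus> \<ominus> ?e \<^bold>< qn \<cdot> V ''i'' \<cdot> \<one>)"
      using all_in_E[OF w[OF least] e] by simp
    ultimately have "?\<Delta>' \<turnstile> \<^bold>\<exists>''i''\<^bold>\<in>Nat. V ''s'' \<oplus> \<ominus> ?e \<^bold>< qn \<cdot> V ''i'' \<cdot> \<one>"
      using imp_E by blast
    then show "?\<Delta>' \<turnstile> ?all \<^bold>\<or> ?ex"
    proof (rule ex_in_E)
      let ?\<Theta> = "insert (V ''i'' \<^bold>\<in> Nat) (insert (V ''s'' \<oplus> \<ominus> ?e \<^bold>< qn \<cdot> V ''i'' \<cdot> \<one>) ?\<Delta>')"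
      have "?\<Theta> \<turnstile> V ''a'' \<cdot> V ''i'' \<^bold>= suc zero"
        by (rule one_of_norm_greater[of _ _ "V ''s''"]; rule hyp) simp_all
      then show "?\<Theta> \<turnstile> ?all \<^bold>\<or> ?ex"
        by (intro disj_I2 ex_in_I[of _ _ "V ''i''"]) (simp_all add: mem_hyp)
    qed auto
  next
    let ?\<Delta>' = "insert (V ''s'' \<^bold>< \<one> \<oplus> \<one>) ?\<Delta>"
    let ?\<Theta> = "insert (V ''n'' \<^bold>\<in> Nat) ?\<Delta>'"
    have "?\<Theta> \<turnstile> ?upper"
      using upper by (rule weaken) auto
    then have "?\<Theta> \<turnstile> qn \<cdot> V ''n'' \<cdot> \<one> \<^bold>\<le> V ''s''"
      using all_in_E[of ?\<Theta> "''i''" Nat "qn \<cdot> V ''i'' \<cdot> \<one> \<^bold>\<le> V ''s''" "V ''n''"] by (simp add: mem_hyp)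
    then have "?\<Theta> \<turnstile> V ''a'' \<cdot> V ''n'' \<^bold>= zero"
      by (intro all_zero_of_sup_less[where s = "V ''s''"]) (auto intro!: hyp)
    then show "?\<Delta>' \<turnstile> ?all \<^bold>\<or> ?ex"
      by (intro disj_I1 all_in_I) auto
  qed
qed (auto intro: hyp)

theorem mainTheorem9:
  shows "{} \<turnstile> every_element_normable \<^bold>\<longrightarrow> LPO"
proof (rule imp_I)
  let ?concl = "(\<^bold>\<forall>''n''\<^bold>\<in>Nat. V ''a'' \<cdot> V ''n'' \<^bold>= zero) \<^bold>\<or> (\<^bold>\<exists>''n''\<^bold>\<in>Nat. V ''a'' \<cdot> V ''n'' \<^bold>= suc zero)"
  let ?\<Gamma> = "{binary, every_element_normable}"
  \<comment> \<open>Both defining formulas are elementary, so comprehension supplies the classes.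
    \<open>E\<close> and \<open>J\<close> are free neither in the conclusion nor in the hypotheses
    kept, hence they can be eliminated.\<close>
  have real_equality_ax: "bish_axiom (\<^bold>\<exists>\<^sub>C''E''. real_equality)"
    unfolding real_equality_def by (rule comprehension) simp_all
  have "bish_axiom (\<^bold>\<exists>\<^sub>C''J''. identity)"
    unfolding identity_def by (rule comprehension) simp_all
  moreover have "insert identity (insert real_equality ?\<Gamma>) \<turnstile> ?concl"
    using every_zero_or_some_one by (rule weaken) auto
  ultimately have "insert real_equality ?\<Gamma> \<turnstile> ?concl"
    by (rule exC_E[OF ax]) (simp add: binary_def real_equality_def)
  with real_equality_ax have "?\<Gamma> \<turnstile> ?concl"
    by (rule exC_E[OF ax]) (simp add: binary_def)
  \<comment> \<open>Once \<open>binary\<close> is discharged, only the closed premise remains and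
    \<open>a\<close> may be generalised.\<close>
  then show "{every_element_normable} \<turnstile> LPO"
    unfolding LPO_def binary_def by (intro all_I imp_I) simp_all
qed

end
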